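(* Let $K\subset\mathbb{R}^n$ be a convex body in Löwner position with $C^1$-smooth boundary, and let $f,g:\mathbb{R}\to\mathbb{R}$ satisfy: $f$ is locally Lipschitz, convex, $f(x)=0$ for $x\le-1$, and $f$ is strictly increasing in $[-1,\infty)$; $g$ is locally Lipschitz, non-increasing, $g(x)=1$ for $x\le-1$, $g(x)>0$ for $x\in(-1,1)$, and $g(x)=0$ for $x\ge1$. Then the functional $I_r(M,v)$ extends continuously to $r=1$ as $$I_1(M,v)=\int_{S^{n-1}\cap\partial K}F(\langle\xi,M\xi+v\rangle)\,d\xi,\qquad (M,v)\in\mathrm{Sym}\times\mathbb{R}^n,$$ where $F$ is the convolution $F(x)=(f*\bar g)(x)$, $\bar g(x)=g(-x)$, i.e. $F(x)=\int_{\mathbb{R}}f(t)\,g(t-x)\,dt$; and $F$ is a $C^1$ function that is non-negative, non-decreasing, convex, strictly convex in $[0,\infty)$, with $F'(0)>0$. Moreover, $I_r\to I_1$ as $r\to1^-$, uniformly in compact sets of $\mathrm{Sym}\times\mathbb{R}^n$.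
   Context: A convex body is a compact convex subset of $\mathbb{R}^n$ with non-empty interior. $\mathbb{B}$ is the closed unit Euclidean ball and $S^{n-1}$ its boundary. A convex body $K$ is in Löwner position if $\mathbb{B}$ is the (unique) ellipsoid of minimal volume containing $K$; in that case $0$ is in the interior of $K$. $|x|_2$ is the Euclidean norm and $\|x\|_K=\inf\{\lambda>0: x\in\lambda K\}$ the gauge function of $K$; $K$ has $C^1$-smooth boundary if $\|\cdot\|_K$ is $C^1$ on $\mathbb{R}^n\setminus\{0\}$. $d\xi$ denotes integration with respect to the $(n-1)$-dimensional Hausdorff measure on $S^{n-1}$. $\mathrm{Sym}$ is the space of real symmetric $n\times n$ matrices. For $r\in(1/2,1)$ and $h:\mathbb{R}\to\mathbb{R}$ put $h_r(s)=h\left(\frac{s-1}{1-r}\right)$. Let $B_r=\{M\in\mathrm{Sym}:\mathrm{Id}+(1-r)M\text{ is invertible}\}$, which contains the open ball of radius $(1-r)^{-1}$ about $0$ in the operator norm (so every compact subset of $\mathrm{Sym}$ is contained in $B_r$ for $r$ close to $1$). The functional $I_r:B_r\times\mathbb{R}^n\to\mathbb{R}$ is $$I_r(M,v)=\frac1{1-r}\int_{\mathbb{R}^n}f_r(|x|_2)\,g_r\!\left(\left\|(\mathrm{Id}+(1-r)M)^{-1}(x-(1-r)v)\right\|_K\right)dx.$$ *)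

theory Defs
  imports "HOL-Analysis.Analysis"
begin

section \<open>Hausdorff measure\<close>

text \<open>
  The \<open>k\<close>-dimensional Hausdorff measure in its usual normalisation, where a set \<open>C\<close> of a cover is
  charged \<open>\<omega>\<^sub>k (diam C / 2)\<^sup>k\<close> with \<open>\<omega>\<^sub>k\<close> the volume of the Euclidean unit ball of dimension \<open>k\<close>.
  Since \<open>0 ^ 0 = 1\<close>, for \<open>k = 0\<close> every nonempty set is charged \<open>1\<close>; the empty set is charged \<open>0\<close>
  for every \<open>k\<close>. Boundedness is required separately because \<^const>\<open>diameter\<close> is unspecified on
  unbounded sets.
\<close>

definition hausdorff_cost :: "nat \<Rightarrow> 'a::metric_space set \<Rightarrow> ennreal" where
  "hausdorff_cost k C =
     (if C = {} then 0 else ennreal (unit_ball_vol (real k) * (diameter C / 2) ^ k))"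

definition hausdorff_covers :: "real \<Rightarrow> 'a::metric_space set \<Rightarrow> (nat \<Rightarrow> 'a set) set" where
  "hausdorff_covers \<delta> A =
     {C. A \<subseteq> (\<Union>i. C i) \<and> (\<forall>i. bounded (C i) \<and> diameter (C i) \<le> \<delta>)}"

definition hausdorff_premeasure :: "nat \<Rightarrow> real \<Rightarrow> 'a::metric_space set \<Rightarrow> ennreal" where
  "hausdorff_premeasure k \<delta> A = (INF C\<in>hausdorff_covers \<delta> A. \<Sum>i. hausdorff_cost k (C i))"

definition hausdorff_outer :: "nat \<Rightarrow> 'a::metric_space set \<Rightarrow> ennreal" where
  "hausdorff_outer k A = (SUP \<delta>\<in>{0<..}. hausdorff_premeasure k \<delta> A)"

text \<open>
  The values on Borel sets are indeed those of the outer measure, see \<open>emeasure_hausdorff_measure\<close>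
  below.
\<close>

definition hausdorff_measure :: "nat \<Rightarrow> 'a::metric_space measure" where
  "hausdorff_measure k = measure_of UNIV (sets borel) (hausdorff_outer k)"

lemma hausdorff_premeasure_antimono:
  assumes "\<delta> \<le> \<epsilon>"
  shows "hausdorff_premeasure k \<epsilon> A \<le> hausdorff_premeasure k \<delta> A"
  unfolding hausdorff_premeasure_def
  using assms by (intro INF_superset_mono order_refl) (auto simp: hausdorff_covers_def intro: order_trans)

lemma hausdorff_outer_mono:
  assumes "A \<subseteq> B"
  shows "hausdorff_outer k A \<le> hausdorff_outer k B"
  unfolding hausdorff_outer_def hausdorff_premeasure_def
  using assms by (intro SUP_mono' INF_superset_mono order_refl) (force simp: hausdorff_covers_def)

lemma hausdorff_outer_empty: "hausdorff_outer k {} = 0"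
proof -
  have "hausdorff_premeasure k \<delta> ({} :: 'a set) \<le> 0" if "\<delta> > 0" for \<delta>
    unfolding hausdorff_premeasure_def
    using that by (intro INF_lower2[of "\<lambda>_. {}"]) (auto simp: hausdorff_covers_def hausdorff_cost_def)
  then have "hausdorff_outer k ({} :: 'a set) \<le> 0"
    unfolding hausdorff_outer_def by (intro SUP_least) auto
  then show ?thesis by simp
qed

lemma hausdorff_premeasure_UN_le:
  fixes A :: "nat \<Rightarrow> 'a::metric_space set"
  shows "hausdorff_premeasure k \<delta> (\<Union>i. A i) \<le> (\<Sum>n. hausdorff_premeasure k \<delta> (A n))"
proof (rule ennreal_le_epsilon)
  let ?P = "hausdorff_premeasure k \<delta>"
  fix e :: real assume e: "0 < e" and fin: "(\<Sum>n. ?P (A n)) < top"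
  then have less: "?P (A n) < ?P (A n) + e * (1/2)^Suc n" for n
    by (auto simp add: less_top dest!: ennreal_suminf_lessD)
  have "\<exists>C\<in>hausdorff_covers \<delta> (A n). (\<Sum>i. hausdorff_cost k (C i)) < ?P (A n) + e * (1/2)^Suc n" for n
    using less[of n] unfolding hausdorff_premeasure_def[of k \<delta> "A n"] INF_less_iff .
  then obtain B where cov: "\<And>n. B n \<in> hausdorff_covers \<delta> (A n)"
    and B: "\<And>n. (\<Sum>i. hausdorff_cost k (B n i)) < ?P (A n) + e * (1/2)^Suc n"
    by metis
  define C where "C = case_prod B o prod_decode"
  have AC: "(\<Union>i. A i) \<subseteq> (\<Union>i. C i)"
  proof
    fix x assume "x \<in> (\<Union>i. A i)"
    then obtain n m where "x \<in> B n m"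
      using cov by (force simp: hausdorff_covers_def)
    then have "x \<in> C (prod_encode (n, m))" by (simp add: C_def)
    then show "x \<in> (\<Union>i. C i)" by blast
  qed
  have "C \<in> hausdorff_covers \<delta> (\<Union>i. A i)"
    using AC cov by (auto simp: hausdorff_covers_def C_def split: prod.split)
  then have "?P (\<Union>i. A i) \<le> (\<Sum>i. hausdorff_cost k (C i))"
    unfolding hausdorff_premeasure_def by (rule INF_lower)
  also have "\<dots> = (\<Sum>n. \<Sum>i. hausdorff_cost k (B n i))"
    using suminf_ennreal_2dimen[of _ "\<lambda>(n, i). hausdorff_cost k (B n i)"]
    by (simp add: C_def case_prod_unfold)
  also have "\<dots> \<le> (\<Sum>n. ?P (A n) + e * (1/2) ^ Suc n)"
    using B by (intro suminf_le allI) (auto intro: less_imp_le)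
  also have "\<dots> = (\<Sum>n. ?P (A n)) + (\<Sum>n. ennreal e * ennreal ((1/2) ^ Suc n))"
    using e by (subst suminf_add[symmetric])
               (auto simp del: ennreal_suminf_cmult simp add: ennreal_mult[symmetric])
  also have "\<dots> = (\<Sum>n. ?P (A n)) + e"
    unfolding ennreal_suminf_cmult
    by (subst suminf_ennreal_eq[OF zero_le_power power_half_series]) auto
  finally show "?P (\<Union>i. A i) \<le> (\<Sum>n. ?P (A n)) + e" .
qed

lemma hausdorff_outer_UN_le:
  fixes A :: "nat \<Rightarrow> 'a::metric_space set"
  shows "hausdorff_outer k (\<Union>i. A i) \<le> (\<Sum>n. hausdorff_outer k (A n))"
  unfolding hausdorff_outer_def[of k "\<Union>i. A i"]
proof (rule SUP_least)
  fix \<delta> :: real assume \<delta>: "\<delta> \<in> {0<..}"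
  have "hausdorff_premeasure k \<delta> (\<Union>i. A i) \<le> (\<Sum>n. hausdorff_premeasure k \<delta> (A n))"
    by (rule hausdorff_premeasure_UN_le)
  also have "\<dots> \<le> (\<Sum>n. hausdorff_outer k (A n))"
    unfolding hausdorff_outer_def using \<delta> by (intro suminf_le SUP_upper) auto
  finally show "hausdorff_premeasure k \<delta> (\<Union>i. A i) \<le> (\<Sum>n. hausdorff_outer k (A n))" .
qed

lemma outer_measure_space_hausdorff_outer: "outer_measure_space UNIV (hausdorff_outer k)"
  by (auto simp: outer_measure_space_def positive_def increasing_def countably_subadditive_def
      hausdorff_outer_empty hausdorff_outer_mono hausdorff_outer_UN_le)

lemma hausdorff_outer_separated:
  fixes A B :: "'a::metric_space set"
  assumes d: "d > 0" and sep: "\<And>a b. a \<in> A \<Longrightarrow> b \<in> B \<Longrightarrow> d \<le> dist a b"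
  shows "hausdorff_outer k A + hausdorff_outer k B \<le> hausdorff_outer k (A \<union> B)"
proof -
  let ?P = "hausdorff_premeasure k"
  have small: "?P \<delta> A + ?P \<delta> B \<le> hausdorff_outer k (A \<union> B)" if \<delta>: "0 < \<delta>" "\<delta> < d" for \<delta>
  proof -
    have "?P \<delta> A + ?P \<delta> B \<le> (\<Sum>i. hausdorff_cost k (C i))"
      if C: "C \<in> hausdorff_covers \<delta> (A \<union> B)" for C
    proof -
      let ?restr = "\<lambda>S i. if C i \<inter> S = {} then {} else C i"
      have restr: "?restr S \<in> hausdorff_covers \<delta> S" if "S \<subseteq> A \<union> B" for S
        using C that \<delta> unfolding hausdorff_covers_def by fastforce
      have one: "hausdorff_cost k (?restr A i) + hausdorff_cost k (?restr B i)
                 \<le> hausdorff_cost k (C i)" for i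
      proof (cases "C i \<inter> A = {} \<or> C i \<inter> B = {}")
        case True
        then show ?thesis by (auto simp: hausdorff_cost_def)
      next
        case False
        then obtain a b where "a \<in> C i" "a \<in> A" "b \<in> C i" "b \<in> B" by blast
        moreover have "bounded (C i)" "diameter (C i) \<le> \<delta>"
          using C by (auto simp: hausdorff_covers_def)
        ultimately show ?thesis
          using diameter_bounded_bound[of "C i" a b] sep[of a b] \<delta> by linarith
      qed
      have "?P \<delta> A + ?P \<delta> B
            \<le> (\<Sum>i. hausdorff_cost k (?restr A i)) + (\<Sum>i. hausdorff_cost k (?restr B i))"
        unfolding hausdorff_premeasure_def by (intro add_mono INF_lower restr) auto
      also have "\<dots> = (\<Sum>i. hausdorff_cost k (?restr A i) + hausdorff_cost k (?restr B i))"
        by (rule suminf_add) auto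
      also have "\<dots> \<le> (\<Sum>i. hausdorff_cost k (C i))"
        by (intro suminf_le one) auto
      finally show ?thesis .
    qed
    then have "?P \<delta> A + ?P \<delta> B \<le> ?P \<delta> (A \<union> B)"
      unfolding hausdorff_premeasure_def[of k \<delta> "A \<union> B"] by (intro INF_greatest)
    also have "\<dots> \<le> hausdorff_outer k (A \<union> B)"
      unfolding hausdorff_outer_def using \<delta> by (intro SUP_upper) auto
    finally show ?thesis .
  qed
  have any: "?P \<delta> A + ?P \<epsilon> B \<le> hausdorff_outer k (A \<union> B)" if "\<delta> > 0" "\<epsilon> > 0" for \<delta> \<epsilon>
  proof -
    let ?m = "min (min \<delta> \<epsilon>) (d / 2)"
    have "?P \<delta> A + ?P \<epsilon> B \<le> ?P ?m A + ?P ?m B"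
      by (intro add_mono hausdorff_premeasure_antimono) auto
    also have "\<dots> \<le> hausdorff_outer k (A \<union> B)"
      using that d by (intro small) auto
    finally show ?thesis .
  qed
  have "?P \<delta> A + hausdorff_outer k B \<le> hausdorff_outer k (A \<union> B)" if "\<delta> > 0" for \<delta>
  proof -
    have "?P \<delta> A + hausdorff_outer k B = (SUP \<epsilon>\<in>{0<..}. ?P \<delta> A + ?P \<epsilon> B)"
      unfolding hausdorff_outer_def by (rule ennreal_SUP_add_right) auto
    also have "\<dots> \<le> hausdorff_outer k (A \<union> B)"
      using any that by (intro SUP_least) auto
    finally show ?thesis .
  qed
  moreover have "hausdorff_outer k A + hausdorff_outer k B
      = (SUP \<delta>\<in>{0<..}. ?P \<delta> A + hausdorff_outer k B)"
    unfolding hausdorff_outer_def[of k A] by (rule ennreal_SUP_add_left[symmetric]) auto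
  ultimately show ?thesis by (auto intro!: SUP_least)
qed

lemma closed_in_lambda_system_hausdorff:
  fixes F :: "'a::metric_space set"
  assumes F: "closed F"
  shows "F \<in> lambda_system UNIV UNIV (hausdorff_outer k)"
proof -
  let ?H = "hausdorff_outer k"
  have key: "?H (A \<inter> F) + ?H (A - F) \<le> ?H A" for A
  proof (cases "F = {} \<or> ?H A = \<infinity>")
    case True
    then show ?thesis by (auto simp: hausdorff_outer_empty)
  next
    case False
    then have ne: "F \<noteq> {}" and fin: "?H A \<noteq> \<infinity>" by auto
    define P where "P n = {x \<in> A. infdist x F > 1 / (real n + 1)}" for n
    define R where "R n = {x \<in> A. 1 / (real n + 2) < infdist x F \<and> infdist x F \<le> 1 / (real n + 1)}"
      for n
    have sep_infdist: "?H S + ?H T \<le> ?H A"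
      if "b < a" "S \<subseteq> A" "T \<subseteq> A" "\<And>x. x \<in> S \<Longrightarrow> infdist x F > a" "\<And>x. x \<in> T \<Longrightarrow> infdist x F \<le> b"
      for S T a b
    proof -
      have "?H S + ?H T \<le> ?H (S \<union> T)"
      proof (rule hausdorff_outer_separated[of "a - b"])
        fix x y assume "x \<in> S" "y \<in> T"
        then show "a - b \<le> dist x y"
          using that(4)[of x] that(5)[of y] infdist_triangle[of x F y] by linarith
      qed (use that in auto)
      also have "\<dots> \<le> ?H A" using that by (intro hausdorff_outer_mono) auto
      finally show ?thesis .
    qed
    have sepR: "?H S + ?H (R n) \<le> ?H (S \<union> R n)"
      if "\<And>x. x \<in> S \<Longrightarrow> infdist x F > 1 / real n" "n > 0" for S n
    proof (rule hausdorff_outer_separated[of "1 / real n - 1 / (real n + 1)"])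
      show "1 / real n - 1 / (real n + 1) > 0" using that by (simp add: frac_less2)
      fix x y assume "x \<in> S" "y \<in> R n"
      then show "1 / real n - 1 / (real n + 1) \<le> dist x y"
        using that(1)[of x] infdist_triangle[of x F y] by (auto simp: R_def)
    qed
    have step: "(\<Sum>i<m. ?H (R (2 * i + e))) \<le> ?H (\<Union>i<m. R (2 * i + e))" for m e
    proof (induction m)
      case (Suc m)
      let ?U = "\<Union>i<m. R (2 * i + e)"
      have "?H ?U + ?H (R (2 * m + e)) \<le> ?H (?U \<union> R (2 * m + e))"
      proof (cases "m = 0")
        case True
        then show ?thesis by (simp add: hausdorff_outer_empty)
      next
        case False
        show ?thesis
        proof (rule sepR)
          show "2 * m + e > 0" using False by simp
          fix x assume "x \<in> ?U"
          then obtain i where i: "i < m" "1 / (real (2 * i + e) + 2) < infdist x F"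
            by (auto simp: R_def)
          have "1 / real (2 * m + e) \<le> 1 / (real (2 * i + e) + 2)"
            using i(1) by (intro divide_left_mono) auto
          then show "1 / real (2 * m + e) < infdist x F" using i(2) by linarith
        qed
      qed
      also have "?U \<union> R (2 * m + e) = (\<Union>i<Suc m. R (2 * i + e))"
        by (auto simp: lessThan_Suc)
      finally have "?H ?U + ?H (R (2 * m + e)) \<le> ?H (\<Union>i<Suc m. R (2 * i + e))" .
      then show ?case
        using order_trans[OF add_right_mono[OF Suc.IH]] by simp
    qed (simp add: hausdorff_outer_empty)
    have half: "(\<Sum>i<m. ?H (R (2 * i + e))) \<le> ?H A" for e m
      by (rule order_trans[OF step hausdorff_outer_mono]) (auto simp: R_def)
    have "(\<Sum>i<m. ?H (R i)) \<le> ?H A + ?H A" for m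
    proof -
      have "(\<Sum>i<2 * m. ?H (R i)) = (\<Sum>i<m. ?H (R (2 * i + 0))) + (\<Sum>i<m. ?H (R (2 * i + 1)))"
        by (induction m) (auto simp: algebra_simps)
      moreover have "(\<Sum>i<m. ?H (R i)) \<le> (\<Sum>i<2 * m. ?H (R i))"
        by (intro sum_mono2) auto
      ultimately show ?thesis
        using add_mono[OF half[of 0 m] half[of 1 m]] by simp
    qed
    then have "(\<Sum>i. ?H (R i)) \<le> ?H A + ?H A"
      by (intro suminf_le_const) auto
    with fin have sum_fin: "(\<Sum>i. ?H (R i)) \<noteq> \<infinity>"
      by (auto simp: top_unique)
    have bound: "?H (A \<inter> F) + ?H (A - F) + (\<Sum>i<n. ?H (R i)) \<le> ?H A + (\<Sum>i. ?H (R i))" for n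
    proof -
      define Q where "Q i = (if i = 0 then P n else R (i - 1 + n))" for i
      have "A - F \<subseteq> (\<Union>i. Q i)"
      proof
        fix x assume x: "x \<in> A - F"
        then have pos: "infdist x F > 0"
          using F ne in_closed_iff_infdist_zero[of F x] infdist_nonneg[of x F] by force
        show "x \<in> (\<Union>i. Q i)"
        proof (cases "infdist x F > 1 / (real n + 1)")
          case True
          then have "x \<in> Q 0" using x by (simp add: Q_def P_def)
          then show ?thesis by blast
        next
          case False
          define N where "N = (LEAST j. 1 / (real j + 1) < infdist x F)"
          obtain j where "1 / (real j + 1) < infdist x F"
            using pos reals_Archimedean[of "infdist x F"] by (auto simp: inverse_eq_divide add.commute)
          then have N: "1 / (real N + 1) < infdist x F"
            unfolding N_def by (rule LeastI)
          have "N > n"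
          proof (rule ccontr)
            assume "\<not> N > n"
            then have "1 / (real n + 1) \<le> 1 / (real N + 1)" by (intro divide_left_mono) auto
            then show False using N False by linarith
          qed
          then obtain l where l: "N = Suc (l + n)"
            by (metis add.commute less_iff_Suc_add)
          have "\<not> 1 / (real (l + n) + 1) < infdist x F"
            using not_less_Least[of "l + n" "\<lambda>j. 1 / (real j + 1) < infdist x F"] l
            by (simp add: N_def)
          moreover have "1 / (real (l + n) + 2) < infdist x F"
            using N by (simp add: l add.commute add.left_commute)
          ultimately have "x \<in> R (l + n)"
            using x unfolding R_def by (simp only: mem_Collect_eq not_less DiffE) blast
          then have "x \<in> Q (Suc l)" by (simp add: Q_def)
          then show ?thesis by blast
        qed
      qed
      then have "?H (A - F) \<le> (\<Sum>i. ?H (Q i))"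
        using hausdorff_outer_mono hausdorff_outer_UN_le order_trans by blast
      also have "\<dots> = (\<Sum>i. ?H (R (i + n))) + ?H (P n)"
        using suminf_offset[of "\<lambda>i. ?H (Q i)" 1] by (simp add: Q_def)
      finally have "?H (A - F) \<le> (\<Sum>i. ?H (R (i + n))) + ?H (P n)" .
      then have "?H (A \<inter> F) + ?H (A - F) + (\<Sum>i<n. ?H (R i))
          \<le> ?H (A \<inter> F) + ((\<Sum>i. ?H (R (i + n))) + ?H (P n)) + (\<Sum>i<n. ?H (R i))"
        by (intro add_mono order_refl)
      also have "\<dots> = (?H (P n) + ?H (A \<inter> F)) + ((\<Sum>i. ?H (R (i + n))) + (\<Sum>i<n. ?H (R i)))"
        by (simp add: ac_simps)
      also have "(\<Sum>i. ?H (R (i + n))) + (\<Sum>i<n. ?H (R i)) = (\<Sum>i. ?H (R i))"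
        by (rule suminf_offset[symmetric]) auto
      also have "?H (P n) + ?H (A \<inter> F) \<le> ?H A"
        by (rule sep_infdist[of 0 "1 / (real n + 1)"]) (auto simp: P_def)
      finally show ?thesis by (simp add: add_right_mono)
    qed
    have "(\<Sum>i. ?H (R i)) + (?H (A \<inter> F) + ?H (A - F)) \<le> ?H A + (\<Sum>i. ?H (R i))"
      using bound by (intro ennreal_suminf_bound_add) (auto simp: ac_simps)
    then have "(\<Sum>i. ?H (R i)) + (?H (A \<inter> F) + ?H (A - F)) \<le> (\<Sum>i. ?H (R i)) + ?H A"
      by (simp add: add.commute)
    then show ?thesis
      using sum_fin by (simp add: ennreal_add_left_cancel_le)
  qed
  have "?H A \<le> ?H (A \<inter> F) + ?H (A - F)" for A
  proof -
    define Q where "Q i = (if i = 0 then A \<inter> F else if i = 1 then A - F else {})" for i :: nat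
    have "(\<Union>i. Q i) = A"
      unfolding Q_def by (auto split: if_splits)
    moreover have "(\<Sum>i. ?H (Q i)) = (\<Sum>i<2. ?H (Q i))"
      by (intro suminf_finite) (auto simp: Q_def hausdorff_outer_empty)
    ultimately show ?thesis
      using hausdorff_outer_UN_le[of k Q] by (simp add: Q_def numeral_2_eq_2)
  qed
  then show ?thesis
    using key by (auto simp: lambda_system_def Int_commute Compl_eq_Diff_UNIV[symmetric]
        Diff_eq intro!: antisym)
qed

lemma space_hausdorff_measure [simp]: "space (hausdorff_measure k) = UNIV"
  by (simp add: hausdorff_measure_def)

lemma sets_hausdorff_measure [simp, measurable_cong]: "sets (hausdorff_measure k) = sets borel"
  by (simp add: hausdorff_measure_def sets_measure_of_conv sets.sigma_sets_eq[of borel, simplified])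

lemma emeasure_hausdorff_measure:
  fixes A :: "'a::metric_space set"
  assumes A: "A \<in> sets borel"
  shows "emeasure (hausdorff_measure k) A = hausdorff_outer k A"
proof -
  let ?H = "hausdorff_outer k :: 'a set \<Rightarrow> ennreal"
  let ?L = "lambda_system UNIV UNIV ?H"
  interpret U: sigma_algebra "UNIV :: 'a set" UNIV by (use sigma_algebra_Pow[of UNIV] in simp)
  have ms: "measure_space UNIV ?L ?H"
    by (rule U.caratheodory_lemma[OF outer_measure_space_hausdorff_outer])
  then interpret L: sigma_algebra "UNIV :: 'a set" ?L by (simp add: measure_space_def)
  have "sigma_sets UNIV {S :: 'a set. closed S} \<subseteq> ?L"
    using closed_in_lambda_system_hausdorff by (intro L.sigma_sets_subset) auto
  then have sub: "sets borel \<subseteq> ?L"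
    by (simp add: borel_eq_closed)
  show ?thesis
    unfolding hausdorff_measure_def
  proof (rule emeasure_measure_of_sigma[OF _ _ _ A])
    show "sigma_algebra (UNIV :: 'a set) (sets borel)"
      using sets.sigma_algebra_axioms[of "borel :: 'a measure"] by simp
    show "positive (sets borel) ?H" by (simp add: positive_def hausdorff_outer_empty)
    show "countably_additive (sets borel) ?H"
      using ms sub unfolding measure_space_def countably_additive_def by blast
  qed
qed

section \<open>Convex bodies\<close>

definition convex_body :: "'a::euclidean_space set \<Rightarrow> bool" where
  "convex_body K \<longleftrightarrow> compact K \<and> convex K \<and> interior K \<noteq> {}"

definition ellipsoid :: "(real^'n) set \<Rightarrow> bool" where
  "ellipsoid E \<longleftrightarrow> (\<exists>(A::real^'n^'n) a. invertible A \<and> E = (\<lambda>x. a + A *v x) ` cball 0 1)"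

text \<open>
  Minimality only is required: that the minimal ellipsoid of a convex body is unique is a theorem.
\<close>

definition loewner_position :: "(real^'n) set \<Rightarrow> bool" where
  "loewner_position K \<longleftrightarrow> is_arg_min (measure lebesgue) (\<lambda>E. ellipsoid E \<and> K \<subseteq> E) (cball 0 1)"

definition gauge_norm :: "'a::real_vector set \<Rightarrow> 'a \<Rightarrow> real" where
  "gauge_norm K x = Inf {t. t > 0 \<and> x \<in> (*\<^sub>R) t ` K}"

text \<open>For open \<open>S\<close>.\<close>

definition C1_on :: "('a::real_normed_vector \<Rightarrow> 'b::real_normed_vector) \<Rightarrow> 'a set \<Rightarrow> bool" where
  "C1_on f S \<longleftrightarrow>
     (\<exists>f'. (\<forall>x\<in>S. (f has_derivative blinfun_apply (f' x)) (at x)) \<and> continuous_on S f')"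

definition C1_smooth_boundary :: "'a::euclidean_space set \<Rightarrow> bool" where
  "C1_smooth_boundary K \<longleftrightarrow> C1_on (gauge_norm K) (- {0})"

section \<open>Functions of one real variable\<close>

definition locally_Lipschitz :: "(real \<Rightarrow> real) \<Rightarrow> bool" where
  "locally_Lipschitz f \<longleftrightarrow> (\<forall>x. \<exists>u>0. \<exists>L. L-lipschitz_on (cball x u) f)"

definition strictly_convex_on :: "real set \<Rightarrow> (real \<Rightarrow> real) \<Rightarrow> bool" where
  "strictly_convex_on S f \<longleftrightarrow> convex S \<and>
     (\<forall>x\<in>S. \<forall>y\<in>S. \<forall>t. x \<noteq> y \<longrightarrow> 0 < t \<longrightarrow> t < 1 \<longrightarrow>
        f ((1 - t) * x + t * y) < (1 - t) * f x + t * f y)"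

definition convolution :: "(real \<Rightarrow> real) \<Rightarrow> (real \<Rightarrow> real) \<Rightarrow> real \<Rightarrow> real" where
  "convolution f h x = (LINT t|lborel. f t * h (x - t))"

text \<open>With \<open>h(s) = g(-s)\<close> this is \<open>F(x) = \<integral> f(t) g(t - x) dt\<close>.\<close>

definition F_conv :: "(real \<Rightarrow> real) \<Rightarrow> (real \<Rightarrow> real) \<Rightarrow> real \<Rightarrow> real" where
  "F_conv f g = convolution f (\<lambda>s. g (- s))"

definition rescale :: "real \<Rightarrow> (real \<Rightarrow> real) \<Rightarrow> real \<Rightarrow> real" where
  "rescale r h s = h ((s - 1) / (1 - r))"

section \<open>The functionals\<close>

definition Sym :: "(real^'n^'n) set" where
  "Sym = {M. transpose M = M}"

definition B_dom :: "real \<Rightarrow> (real^'n^'n) set" where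
  "B_dom r = {M \<in> Sym. invertible (mat 1 + (1 - r) *\<^sub>R M)}"

definition I_fun ::
  "(real^'n) set \<Rightarrow> (real \<Rightarrow> real) \<Rightarrow> (real \<Rightarrow> real) \<Rightarrow> real \<Rightarrow> real^'n^'n \<Rightarrow> real^'n \<Rightarrow> real" where
  "I_fun K f g r M v = 1 / (1 - r) *
     (LINT x|lborel. rescale r f (norm x) *
        rescale r g (gauge_norm K (matrix_inv (mat 1 + (1 - r) *\<^sub>R M) *v (x - (1 - r) *\<^sub>R v))))"

definition I_one ::
  "(real^'n) set \<Rightarrow> (real \<Rightarrow> real) \<Rightarrow> (real \<Rightarrow> real) \<Rightarrow> real^'n^'n \<Rightarrow> real^'n \<Rightarrow> real" where
  "I_one K f g M v =
     (LINT \<xi>:sphere 0 1 \<inter> frontier K|hausdorff_measure (CARD('n) - 1).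
        F_conv f g (\<xi> \<bullet> (M *v \<xi> + v)))"

definition I_ext ::
  "(real^'n) set \<Rightarrow> (real \<Rightarrow> real) \<Rightarrow> (real \<Rightarrow> real) \<Rightarrow> real \<Rightarrow> real^'n^'n \<Rightarrow> real^'n \<Rightarrow> real" where
  "I_ext K f g r M v = (if r = 1 then I_one K f g M v else I_fun K f g r M v)"

definition I_ext_dom :: "(real \<times> (real^'n^'n) \<times> (real^'n)) set" where
  "I_ext_dom = {(r, M, v). 1/2 < r \<and> r < 1 \<and> M \<in> B_dom r} \<union> {(r, M, v). r = 1 \<and> M \<in> Sym}"

end

theory Submission
  imports Defs
begin

text \<open>
  Put \<open>\<epsilon> = 1 - r\<close>. In polar coordinates with radius \<open>1 + \<epsilon> s\<close> the functional is the integral over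
  \<open>(\<xi>, s)\<close>, with \<open>\<xi>\<close> in the sphere and \<open>s\<close> real, of
  \<open>(1 + \<epsilon> s)\<^sup>n\<^sup>-\<^sup>1 f(s) g((\<parallel>y\<parallel> - 1) / \<epsilon>)\<close>. Here \<open>\<parallel>\<cdot>\<parallel>\<close> is the gauge of \<open>K\<close> and \<open>y = \<xi> + \<epsilon> z\<close>, where \<open>z\<close> tends
  to \<open>s \<xi> - v - M \<xi>\<close> as \<open>\<epsilon>\<close> tends to \<open>0\<close>. If \<open>\<xi>\<close> lies outside \<open>K\<close>, then \<open>\<parallel>y\<parallel>\<close> stays above \<open>1\<close> and the
  integrand vanishes for small \<open>\<epsilon>\<close>. If \<open>\<xi>\<close> lies in \<open>K\<close>, it is a contact point of \<open>K\<close> with the unit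
  ball; as \<open>K\<close> is contained in the ball, the gradient of the gauge at \<open>\<xi>\<close> is \<open>\<xi>\<close>
  (\<open>gauge_derivative_contact\<close>), and the argument of \<open>g\<close> tends to \<open>s - \<langle>\<xi>, M \<xi> + v\<rangle>\<close>. The inclusion in
  the ball also keeps \<open>s\<close> bounded on the support of the integrand (\<open>scaled_integrand_bound\<close>).
  Dominated convergence therefore yields the integral of \<open>F(\<langle>\<xi>, M \<xi> + v\<rangle>)\<close> over the contact points,
  along every sequence of parameters (\<open>I_fun_tendsto_I_one\<close>). Convergence at parameters with \<open>r < 1\<close>
  is dominated in the same way, so the extended functional is jointly continuous
  (\<open>I_ext_continuous\<close>). Uniform convergence on compact sets is a consequence, by uniform continuity.

  The surface measure is the Hausdorff measure in its usual normalisation, so polar coordinates rest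
  on the identity of that measure with the cone measure of the sphere
  (\<open>hausdorff_outer_eq_cone_content\<close>). The difficult half bounds the cone measure of a small set by
  its diameter. It follows from the Brunn--Minkowski inequality, applied not in a tangent plane but
  to a thin shell \<open>X\<close> over the set: the volume of \<open>X\<close> is at most that of \<open>(X - X) / 2\<close>, which fits
  into a flat cylinder of radius about half the diameter. The opposite bound is needed for the
  whole sphere only, where Vitali's covering lemma supplies an efficient cover by caps.

  That \<open>0\<close> is an interior point of \<open>K\<close> comes from the minimality of the ball: half a ball fits into an
  ellipsoid of smaller volume than the ball (\<open>loewner_position_zero_interior\<close>).

  The properties of \<open>F\<close> follow from \<open>F(x) = \<integral> f(u + x) g(u) du\<close>. Convolving the right derivative of
  \<open>f\<close> with the continuous function \<open>g\<close> gives a continuous subgradient of \<open>F\<close>, which must then be its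
  derivative.
\<close>

section \<open>The volume of the difference body\<close>

lemma
  fixes A :: "'a::euclidean_space set"
  assumes A: "A \<in> sets borel"
  shows sets_borel_translate: "(+) c ` A \<in> sets borel"
    and emeasure_lborel_translate: "emeasure lborel ((+) c ` A) = emeasure lborel A"
proof -
  have eq: "(+) c ` A = (+) (- c) -` A"
    by (auto simp: image_iff algebra_simps) (metis add_diff_cancel_left' add.commute diff_add_cancel)
  have "emeasure lborel A = emeasure (distr lborel borel ((+) (- c))) A"
    by (simp add: lborel_distr_plus)
  also have "\<dots> = emeasure lborel ((+) (- c) -` A)"
    using A by (subst emeasure_distr) auto
  finally show "emeasure lborel ((+) c ` A) = emeasure lborel A" by (simp add: eq)
  show "(+) c ` A \<in> sets borel"
    unfolding eq using measurable_sets[of "(+) (- c)" borel borel A] A by simp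
qed

text \<open>
  Two translates of the summands fit into the sumset: \<open>A\<close> shifted by an almost minimal point of
  \<open>B\<close>, and \<open>B\<close> shifted by an almost maximal point of \<open>A\<close>. The first ends where the second
  begins, up to an overlap as short as desired.
\<close>

lemma emeasure_lborel_sumset_bounded:
  fixes A B C :: "real set"
  assumes sets[measurable]: "A \<in> sets borel" "B \<in> sets borel" "C \<in> sets borel"
    and ne: "A \<noteq> {}" "B \<noteq> {}" and bdd: "bdd_above A" "bdd_below B"
    and sums: "\<And>x y. x \<in> A \<Longrightarrow> y \<in> B \<Longrightarrow> x + y \<in> C"
  shows "emeasure lborel A + emeasure lborel B \<le> emeasure lborel C"
proof (rule ennreal_le_epsilon)
  fix e :: real assume e: "0 < e"
  obtain a where a: "a \<in> A" "Sup A - e / 2 < a"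
    using less_cSupD[OF ne(1), of "Sup A - e / 2"] e by auto
  obtain b where b: "b \<in> B" "b < Inf B + e / 2"
    using cInf_lessD[OF ne(2), of "Inf B + e / 2"] e by auto
  let ?A = "(+) b ` A" and ?B = "(+) a ` B"
  have [measurable]: "?A \<in> sets borel" "?B \<in> sets borel"
    using sets by (auto intro: sets_borel_translate)
  have "emeasure lborel A + emeasure lborel B = emeasure lborel ?A + emeasure lborel ?B"
    by (simp add: emeasure_lborel_translate)
  also have "\<dots> = emeasure lborel (?A \<union> ?B) + emeasure lborel (?A \<inter> ?B)"
    by (rule emeasure_Un_Int) auto
  also have "\<dots> \<le> emeasure lborel C + emeasure lborel {a + Inf B .. b + Sup A}"
  proof (intro add_mono emeasure_mono)
    show "?A \<union> ?B \<subseteq> C"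
      using sums[OF _ b(1)] sums[OF a(1)] by (auto simp: add.commute)
    show "?A \<inter> ?B \<subseteq> {a + Inf B .. b + Sup A}"
    proof
      fix z assume "z \<in> ?A \<inter> ?B"
      then obtain x y where "x \<in> A" "y \<in> B" "z = b + x" "z = a + y" by auto
      then show "z \<in> {a + Inf B .. b + Sup A}"
        using cInf_lower[OF _ bdd(2), of y] cSup_upper[OF _ bdd(1), of x] by auto
    qed
  qed auto
  also have "emeasure lborel {a + Inf B .. b + Sup A} \<le> ennreal e"
    using a b e by (cases "a + Inf B \<le> b + Sup A") (auto intro!: ennreal_leI)
  finally show "emeasure lborel A + emeasure lborel B \<le> emeasure lborel C + ennreal e"
    by (simp add: add_left_mono)
qed

lemma emeasure_lborel_sumset:
  fixes A B C :: "real set"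
  assumes sets[measurable]: "A \<in> sets borel" "B \<in> sets borel" "C \<in> sets borel"
    and ne: "A \<noteq> {}" "B \<noteq> {}"
    and sums: "\<And>x y. x \<in> A \<Longrightarrow> y \<in> B \<Longrightarrow> x + y \<in> C"
  shows "emeasure lborel A + emeasure lborel B \<le> emeasure lborel C"
proof -
  obtain a b where ab: "a \<in> A" "b \<in> B" using ne by auto
  define k where "k = nat \<lceil>max \<bar>a\<bar> \<bar>b\<bar>\<rceil>"
  have k: "\<bar>a\<bar> \<le> real k" "\<bar>b\<bar> \<le> real k"
    unfolding k_def by linarith+
  let ?A = "\<lambda>n. A \<inter> {..real (n + k)}" and ?B = "\<lambda>n. B \<inter> {- real (n + k)..}"
  have UA: "(\<Union>n. ?A n) = A" and UB: "(\<Union>n. ?B n) = B"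
  proof -
    have *: "\<exists>n. x \<le> real n + real k" for x
      by (meson real_arch_simple add_increasing2 of_nat_0_le_iff order_trans)
    show "(\<Union>n. ?A n) = A" using * by auto
    have "\<exists>n. - real n - real k \<le> x" for x
    proof -
      obtain n where "- x \<le> real n + real k" using *[of "- x"] by blast
      then show ?thesis by (intro exI[of _ n]) linarith
    qed
    then show "(\<Union>n. ?B n) = B" by auto
  qed
  have lim: "(\<lambda>n. emeasure lborel (?A n) + emeasure lborel (?B n))
      \<longlonglongrightarrow> emeasure lborel (\<Union>n. ?A n) + emeasure lborel (\<Union>n. ?B n)"
    by (intro tendsto_add Lim_emeasure_incseq) (auto simp: incseq_def)
  have "emeasure lborel (\<Union>n. ?A n) + emeasure lborel (\<Union>n. ?B n) \<le> emeasure lborel C"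
  proof (rule LIMSEQ_le_const2[OF lim], intro exI[of _ 0] allI impI)
    fix n
    have "a \<in> ?A n" "b \<in> ?B n" using ab k by auto
    then show "emeasure lborel (?A n) + emeasure lborel (?B n) \<le> emeasure lborel C"
      by (intro emeasure_lborel_sumset_bounded) (auto intro!: sums bdd_above.I2 bdd_below.I2)
  qed
  then show ?thesis by (simp only: UA UB)
qed

lemma nn_integral_layer_cake:
  fixes f :: "'a \<Rightarrow> ennreal"
  assumes sf: "sigma_finite_measure M" and f[measurable]: "f \<in> borel_measurable M"
    and fin: "\<And>x. f x < \<infinity>"
  shows "(\<integral>\<^sup>+x. f x \<partial>M) = (\<integral>\<^sup>+s. indicator {0..} s * emeasure M {x \<in> space M. ennreal s < f x} \<partial>lborel)"
proof -
  interpret sigma_finite_measure M by fact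
  interpret P: pair_sigma_finite M "lborel :: real measure" ..
  have "f x = (\<integral>\<^sup>+s. indicator {0..} s * indicator {s. ennreal s < f x} s \<partial>lborel)" for x
  proof -
    obtain y where y: "f x = ennreal y" "y \<ge> 0" using fin[of x] by (cases "f x") auto
    have "(\<integral>\<^sup>+s. indicator {0..} s * indicator {s. ennreal s < f x} s \<partial>lborel)
        = (\<integral>\<^sup>+s. indicator {0..<y} s \<partial>lborel)"
      by (intro nn_integral_cong) (auto simp: indicator_def y ennreal_less_iff)
    then show ?thesis using y by simp
  qed
  then have "(\<integral>\<^sup>+x. f x \<partial>M)
     = (\<integral>\<^sup>+x. (\<integral>\<^sup>+s. indicator {0..} s * indicator {s. ennreal s < f x} s \<partial>lborel) \<partial>M)"
    by simp
  also have "\<dots> = (\<integral>\<^sup>+s. (\<integral>\<^sup>+x. indicator {0..} s * indicator {s. ennreal s < f x} s \<partial>M) \<partial>lborel)"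
    by (rule P.Fubini'[symmetric]) (simp add: case_prod_unfold indicator_def cong: if_cong)
  also have "\<dots> = (\<integral>\<^sup>+s. indicator {0..} s * emeasure M {x \<in> space M. ennreal s < f x} \<partial>lborel)"
  proof (intro nn_integral_cong)
    fix s :: real
    have "(\<integral>\<^sup>+x. indicator {0..} s * indicator {s. ennreal s < f x} s \<partial>M)
        = (\<integral>\<^sup>+x. indicator {0..} s * indicator {x \<in> space M. ennreal s < f x} x \<partial>M)"
      by (intro nn_integral_cong) (auto simp: indicator_def)
    also have "\<dots> = indicator {0..} s * emeasure M {x \<in> space M. ennreal s < f x}"
      by (subst nn_integral_cmult) auto
    finally show "(\<integral>\<^sup>+x. indicator {0..} s * indicator {s. ennreal s < f x} s \<partial>M)
       = indicator {0..} s * emeasure M {x \<in> space M. ennreal s < f x}" .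
  qed
  finally show ?thesis .
qed

text \<open>
  When both suprema are \<open>1\<close>, the superlevel sets of \<open>f\<close> and \<open>g\<close> at every level below \<open>1\<close> are
  nonempty, and half of their sum lies in the superlevel set of \<open>h\<close>. The measures of sumsets then
  compare the layer cake formulas of the three functions level by level.
\<close>

lemma Prekopa_Leindler_normalized:
  fixes f g h :: "real \<Rightarrow> ennreal"
  assumes [measurable]: "f \<in> borel_measurable borel" "g \<in> borel_measurable borel" "h \<in> borel_measurable borel"
    and sup: "(SUP x. f x) = 1" "(SUP x. g x) = 1"
    and fgh: "\<And>x y. f x * g y \<le> (h ((x + y) / 2))\<^sup>2"
  shows "integral\<^sup>N lborel f + integral\<^sup>N lborel g \<le> 2 * integral\<^sup>N lborel h"
proof -
  \<comment> \<open>Truncation at the common supremum loses nothing and makes the function finite, as the layer cake formula requires.\<close>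
  define k where "k z = min 1 (h (z / 2))" for z
  have [measurable]: "k \<in> borel_measurable borel" unfolding k_def by measurable
  have f1: "f x \<le> 1" for x using SUP_upper[of x UNIV f] sup by simp
  have g1: "g x \<le> 1" for x using SUP_upper[of x UNIV g] sup by simp
  have fin: "f x < \<infinity>" "g x < \<infinity>" "k x < \<infinity>" for x
    using f1[of x] g1[of x] by (auto simp: k_def le_less_trans[OF _ ennreal_one_less_top])
  have level: "emeasure lborel {x. ennreal s < f x} + emeasure lborel {x. ennreal s < g x}
      \<le> emeasure lborel {x. ennreal s < k x}" if "0 \<le> s" for s
  proof (cases "s < 1")
    case True
    then have s1: "ennreal s < 1" using that by (simp add: ennreal_less_one_iff)
    then obtain x0 y0 where "ennreal s < f x0" "ennreal s < g y0"
      using sup by (metis less_SUP_iff)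
    moreover have "ennreal s < k (x + y)" if "ennreal s < f x" "ennreal s < g y" for x y
    proof (rule ccontr)
      assume "\<not> ennreal s < k (x + y)"
      then have le: "h ((x + y) / 2) \<le> ennreal s"
        using s1 unfolding k_def by (auto simp: min_def not_less split: if_splits)
      have "f x * g y \<le> ennreal s * ennreal s"
        using order_trans[OF fgh[of x y] power_mono[OF le]] by (simp add: power2_eq_square)
      moreover have "ennreal s * ennreal s < f x * g y"
      proof -
        obtain p q where "f x = ennreal p" "0 \<le> p" "g y = ennreal q" "0 \<le> q"
          using fin(1)[of x] fin(2)[of y] by (cases "f x"; cases "g y") auto
        then show ?thesis
          using that \<open>0 \<le> s\<close>
          by (auto simp: ennreal_mult[symmetric] ennreal_less_iff intro!: mult_strict_mono')
      qed
      ultimately show False by simp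
    qed
    ultimately show ?thesis
      by (intro emeasure_lborel_sumset) auto
  next
    case False
    then have "1 \<le> ennreal s" by simp
    then have "{x. ennreal s < f x} = {}" "{x. ennreal s < g x} = {}"
      using f1 g1 by (auto simp: not_less simp del: ennreal_ge_1 intro: order_trans)
    then show ?thesis by (simp only: emeasure_empty) simp
  qed
  have sf: "sigma_finite_measure (lborel :: real measure)" by (rule lborel.sigma_finite_measure_axioms)
  have "integral\<^sup>N lborel f + integral\<^sup>N lborel g =
      (\<integral>\<^sup>+s. indicator {0..} s * emeasure lborel {x. ennreal s < f x} \<partial>lborel)
    + (\<integral>\<^sup>+s. indicator {0..} s * emeasure lborel {x. ennreal s < g x} \<partial>lborel)"
    using nn_integral_layer_cake[OF sf, of f] nn_integral_layer_cake[OF sf, of g] fin by simp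
  also have "\<dots> = (\<integral>\<^sup>+s. indicator {0..} s * emeasure lborel {x. ennreal s < f x}
       + indicator {0..} s * emeasure lborel {x. ennreal s < g x} \<partial>lborel)"
    by (rule nn_integral_add[symmetric]) (auto simp: measurable_split_conv)
  also have "\<dots> \<le> (\<integral>\<^sup>+s. indicator {0..} s * emeasure lborel {x. ennreal s < k x} \<partial>lborel)"
    using level by (intro nn_integral_mono) (auto simp: indicator_def)
  also have "\<dots> = integral\<^sup>N lborel k"
    using nn_integral_layer_cake[OF sf, of k] fin by simp
  also have "\<dots> \<le> (\<integral>\<^sup>+z. h (z / 2) \<partial>lborel)"
    by (intro nn_integral_mono) (auto simp: k_def)
  also have "\<dots> = 2 * integral\<^sup>N lborel h"
    using nn_integral_real_affine[of "\<lambda>z. h (z / 2)" 2 0] by simp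
  finally show ?thesis .
qed

lemma ennreal_four_mult_le:
  fixes u v :: ennreal
  shows "4 * (u * v) \<le> (u + v)\<^sup>2"
proof (cases "u = \<infinity> \<or> v = \<infinity>")
  case True
  then show ?thesis by (auto simp: power2_eq_square ennreal_top_mult ennreal_mult_top)
next
  case False
  then obtain p q where p: "u = ennreal p" "0 \<le> p" and q: "v = ennreal q" "0 \<le> q"
    by (cases u; cases v) auto
  have "4 * (p * q) \<le> (p + q)\<^sup>2" using zero_le_power2[of "p - q"] by (simp add: power2_eq_square algebra_simps)
  then have "ennreal (4 * (p * q)) \<le> ennreal ((p + q)\<^sup>2)" by (rule ennreal_leI)
  then show ?thesis using p q
    by (simp add: ennreal_mult ennreal_plus[symmetric] ennreal_power del: ennreal_plus)
qed

text \<open>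
  Dividing by the suprema reduces to the normalised case. That case yields an arithmetic mean, which
  is at least the geometric mean.
\<close>

lemma Prekopa_Leindler_bounded:
  fixes f g h :: "real \<Rightarrow> ennreal"
  assumes [measurable]: "f \<in> borel_measurable borel" "g \<in> borel_measurable borel" "h \<in> borel_measurable borel"
    and bdd: "\<And>x. f x \<le> ennreal c" "\<And>x. g x \<le> ennreal c"
    and fgh: "\<And>x y. f x * g y \<le> (h ((x + y) / 2))\<^sup>2"
  shows "integral\<^sup>N lborel f * integral\<^sup>N lborel g \<le> (integral\<^sup>N lborel h)\<^sup>2"
proof (cases "(SUP x. f x) = 0 \<or> (SUP x. g x) = 0")
  case True
  then have "(\<forall>x. f x = 0) \<or> (\<forall>x. g x = 0)"
    by (metis SUP_upper UNIV_I le_zero_eq)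
  then have "f = (\<lambda>_. 0) \<or> g = (\<lambda>_. 0)" by blast
  then show ?thesis by (elim disjE) (simp_all only: nn_integral_const mult_zero_left mult_zero_right zero_le)
next
  case False
  have "(SUP x. f x) \<le> ennreal c" "(SUP x. g x) \<le> ennreal c" using bdd by (auto intro: SUP_least)
  with False obtain a b where a: "(SUP x. f x) = ennreal a" "a > 0" and b: "(SUP x. g x) = ennreal b" "b > 0"
    by (cases "SUP x. f x"; cases "SUP x. g x") (auto simp: top_unique zero_less_iff_neq_zero)
  define r where "r = sqrt (a * b)"
  have r: "r > 0" "r\<^sup>2 = a * b" using a b by (auto simp: r_def)
  let ?F = "integral\<^sup>N lborel f" and ?G = "integral\<^sup>N lborel g" and ?H = "integral\<^sup>N lborel h"
  let ?a = "ennreal (1 / a)" and ?b = "ennreal (1 / b)"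
  let ?f = "\<lambda>x. ?a * f x" and ?g = "\<lambda>x. ?b * g x" and ?h = "\<lambda>x. ennreal (1 / r) * h x"
  have "integral\<^sup>N lborel ?f + integral\<^sup>N lborel ?g \<le> 2 * integral\<^sup>N lborel ?h"
  proof (rule Prekopa_Leindler_normalized)
    show "(SUP x. ?f x) = 1" "(SUP x. ?g x) = 1"
      using a b by (auto simp: SUP_mult_left_ennreal[symmetric] ennreal_mult[symmetric])
    fix x y
    have "?f x * ?g y = ennreal (1 / a * (1 / b)) * (f x * g y)"
      using a b by (subst ennreal_mult) (auto simp: mult_ac)
    also have "\<dots> \<le> ennreal (1 / a * (1 / b)) * (h ((x + y) / 2))\<^sup>2"
      by (intro mult_left_mono fgh) auto
    also have "1 / a * (1 / b) = (1 / r)\<^sup>2" using r by (simp add: power_divide)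
    also have "ennreal ((1 / r)\<^sup>2) * (h ((x + y) / 2))\<^sup>2 = (?h ((x + y) / 2))\<^sup>2"
      using r by (simp add: power_mult_distrib ennreal_power)
    finally show "?f x * ?g y \<le> (?h ((x + y) / 2))\<^sup>2" .
  qed auto
  then have sum: "?a * ?F + ?b * ?G
      \<le> 2 * (ennreal (1 / r) * ?H)"
    by (simp add: nn_integral_cmult)
  have "ennreal (1 / r) * ennreal (1 / r) = ennreal (1 / a * (1 / b))"
    using r by (subst ennreal_mult[symmetric]) (auto simp: power2_eq_square)
  also have "\<dots> = ?a * ?b" using a b by (subst ennreal_mult) auto
  finally have rr: "(ennreal (1 / r))\<^sup>2 = ?a * ?b"
    by (simp add: power2_eq_square)
  have "4 * ((?a * ?F) * (?b * ?G))
      \<le> (2 * (ennreal (1 / r) * ?H))\<^sup>2"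
    by (rule order_trans[OF ennreal_four_mult_le power_mono[OF sum]]) simp
  also have "\<dots> = 4 * ((?a * ?b) * (?H)\<^sup>2)"
    by (simp only: power_mult_distrib rr) simp
  finally have "(4 * (?a * ?b)) * (?F * ?G)
      \<le> (4 * (?a * ?b)) * (?H)\<^sup>2"
    by (simp only: mult_ac)
  moreover have "4 * (?a * ?b) = ennreal (4 * (1 / a * (1 / b)))"
  proof -
    have "ennreal (4 * (1 / a * (1 / b))) = ennreal 4 * ennreal (1 / a * (1 / b))"
      using a b by (intro ennreal_mult) auto
    also have "ennreal (1 / a * (1 / b)) = ?a * ?b"
      using a b by (intro ennreal_mult) auto
    finally show ?thesis by (simp only: ennreal_numeral)
  qed
  ultimately show ?thesis
    using a b by (simp only:) (subst (asm) ennreal_mult_le_mult_iff, auto)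
qed

lemma Prekopa_Leindler_real:
  fixes f g h :: "real \<Rightarrow> ennreal"
  assumes [measurable]: "f \<in> borel_measurable borel" "g \<in> borel_measurable borel" "h \<in> borel_measurable borel"
    and fgh: "\<And>x y. f x * g y \<le> (h ((x + y) / 2))\<^sup>2"
  shows "integral\<^sup>N lborel f * integral\<^sup>N lborel g \<le> (integral\<^sup>N lborel h)\<^sup>2"
proof -
  let ?I = "integral\<^sup>N lborel :: (real \<Rightarrow> ennreal) \<Rightarrow> ennreal"
  define T where "T u n x = min (u x) (ennreal (real n))" for u :: "real \<Rightarrow> ennreal" and n :: nat and x
  have sup: "?I u = (SUP n. ?I (T u n))"
    if [measurable]: "u \<in> borel_measurable borel" for u
  proof -
    have [measurable]: "T u n \<in> borel_measurable borel" for n unfolding T_def by measurable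
    have inc: "incseq (T u)"
      by (auto simp: incseq_def le_fun_def T_def min_le_iff_disj intro!: ennreal_leI)
    have "(SUP n. T u n x) = u x" for x
    proof -
      have "(SUP n. T u n x) = min (u x) (SUP n. ennreal (real n))"
        unfolding T_def by (simp add: inf_min[symmetric] inf_SUP)
      also have "(SUP n. ennreal (real n)) = top"
        by (simp add: ennreal_SUP_of_nat_eq_top ennreal_of_nat_eq_real_of_nat[symmetric])
      finally show ?thesis by simp
    qed
    then show ?thesis
      using nn_integral_monotone_convergence_SUP[OF inc, of lborel] by (simp add: image_comp)
  qed
  have bound: "?I (T f n) * ?I (T g n) \<le> (?I h)\<^sup>2" for n
  proof (rule Prekopa_Leindler_bounded[where c = "real n"])
    fix x y
    have "T f n x * T g n y \<le> f x * g y" by (intro mult_mono) (auto simp: T_def)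
    then show "T f n x * T g n y \<le> (h ((x + y) / 2))\<^sup>2" using fgh order_trans by blast
  qed (auto simp: T_def[abs_def])
  have mono: "?I (T u m) \<le> ?I (T u n)" if "m \<le> n" for u m n
    using that by (auto simp: T_def min_le_iff_disj intro!: nn_integral_mono ennreal_leI)
  show ?thesis
    unfolding sup[OF assms(1)] sup[OF assms(2)] SUP_mult_left_ennreal SUP_mult_right_ennreal
  proof (intro SUP_least)
    fix m n
    have "?I (T f m) * ?I (T g n)
       \<le> ?I (T f (max m n)) * ?I (T g (max m n))"
      by (intro mult_mono mono) auto
    then show "?I (T f m) * ?I (T g n) \<le> (?I h)\<^sup>2"
      using bound order_trans by blast
  qed
qed

text \<open>
  The inequality tensorises: integrating out all coordinates but one turns the hypothesis, by
  induction, into the hypothesis of the inequality on the line.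
\<close>

lemma Prekopa_Leindler_PiM:
  fixes f g h :: "('i \<Rightarrow> real) \<Rightarrow> ennreal"
  assumes "finite I"
    and "f \<in> borel_measurable (Pi\<^sub>M I (\<lambda>_. lborel))" "g \<in> borel_measurable (Pi\<^sub>M I (\<lambda>_. lborel))"
      "h \<in> borel_measurable (Pi\<^sub>M I (\<lambda>_. lborel))"
    and "\<And>x y. x \<in> extensional I \<Longrightarrow> y \<in> extensional I \<Longrightarrow> f x * g y \<le> (h (\<lambda>i\<in>I. (x i + y i) / 2))\<^sup>2"
  shows "integral\<^sup>N (Pi\<^sub>M I (\<lambda>_. lborel)) f * integral\<^sup>N (Pi\<^sub>M I (\<lambda>_. lborel)) g
      \<le> (integral\<^sup>N (Pi\<^sub>M I (\<lambda>_. lborel)) h)\<^sup>2"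
  using assms
proof (induction I arbitrary: f g h rule: finite_induct)
  case empty
  interpret product_sigma_finite "\<lambda>_. lborel :: real measure" by standard
  show ?case using empty(4)[of "\<lambda>_. undefined" "\<lambda>_. undefined"]
    by (simp add: PiM_empty nn_integral_count_space_finite power2_eq_square restrict_def)
next
  case (insert i I)
  interpret product_sigma_finite "\<lambda>_. lborel :: real measure" by standard
  let ?P = "Pi\<^sub>M I (\<lambda>_. lborel :: real measure)"
  note [measurable] = insert.prems(1-3)
  have slice[measurable]: "(\<lambda>x. u (x(i := t))) \<in> borel_measurable ?P"
    if [measurable]: "u \<in> borel_measurable (Pi\<^sub>M (insert i I) (\<lambda>_. lborel))" for u :: "('i \<Rightarrow> real) \<Rightarrow> ennreal" and t
    by measurable
  have fub: "integral\<^sup>N (Pi\<^sub>M (insert i I) (\<lambda>_. lborel)) u = (\<integral>\<^sup>+t. (\<integral>\<^sup>+x. u (x(i := t)) \<partial>?P) \<partial>lborel)"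
    if "u \<in> borel_measurable (Pi\<^sub>M (insert i I) (\<lambda>_. lborel))" for u :: "('i \<Rightarrow> real) \<Rightarrow> ennreal"
    using product_nn_integral_insert_rev[OF insert.hyps(1,2) that] .
  interpret I: finite_product_sigma_finite "\<lambda>_. lborel :: real measure" I by standard fact
  have sf: "sigma_finite_measure ?P" by (rule sigma_finite[OF insert.hyps(1)])
  have outer[measurable]: "(\<lambda>t. (\<integral>\<^sup>+x. u (x(i := t)) \<partial>?P)) \<in> borel_measurable borel"
    if [measurable]: "u \<in> borel_measurable (Pi\<^sub>M (insert i I) (\<lambda>_. lborel))" for u :: "('i \<Rightarrow> real) \<Rightarrow> ennreal"
    using sigma_finite_measure.borel_measurable_nn_integral[OF sf, of "\<lambda>t x. u (x(i := t))" borel]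
    by simp
  show ?case
    unfolding fub[OF insert.prems(1)] fub[OF insert.prems(2)] fub[OF insert.prems(3)]
  proof (rule Prekopa_Leindler_real)
    fix s t :: real
    show "(\<integral>\<^sup>+x. f (x(i := s)) \<partial>?P) * (\<integral>\<^sup>+x. g (x(i := t)) \<partial>?P) \<le> (\<integral>\<^sup>+x. h (x(i := (s + t) / 2)) \<partial>?P)\<^sup>2"
    proof (rule insert.IH)
      fix x y :: "'i \<Rightarrow> real" assume xy: "x \<in> extensional I" "y \<in> extensional I"
      have "f (x(i := s)) * g (y(i := t)) \<le> (h (\<lambda>j\<in>insert i I. ((x(i := s)) j + (y(i := t)) j) / 2))\<^sup>2"
        using xy by (intro insert.prems(4)) (auto simp: extensional_def)
      also have "(\<lambda>j\<in>insert i I. ((x(i := s)) j + (y(i := t)) j) / 2) = (\<lambda>j\<in>I. (x j + y j) / 2)(i := (s + t) / 2)"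
        using insert.hyps by (auto simp: fun_eq_iff)
      finally show "f (x(i := s)) * g (y(i := t)) \<le> (h ((\<lambda>j\<in>I. (x j + y j) / 2)(i := (s + t) / 2)))\<^sup>2" .
    qed measurable
  qed measurable
qed

lemma emeasure_lborel_eq_PiM:
  assumes A: "A \<in> sets (borel :: 'a::euclidean_space measure)"
  shows "emeasure lborel A = (\<integral>\<^sup>+x. indicator A (\<Sum>b\<in>Basis. x b *\<^sub>R b) \<partial>Pi\<^sub>M (Basis :: 'a set) (\<lambda>_. lborel))"
proof -
  have "emeasure lborel A = (\<integral>\<^sup>+x. indicator A x \<partial>lborel)" using A by simp
  also have "\<dots> = (\<integral>\<^sup>+x. indicator A (\<Sum>b\<in>Basis. x b *\<^sub>R b) \<partial>Pi\<^sub>M (Basis :: 'a set) (\<lambda>_. lborel))"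
    by (subst lborel_eq, subst nn_integral_distr) (use A in auto)
  finally show ?thesis .
qed

text \<open>
  The Brunn--Minkowski inequality in its multiplicative form.
\<close>

lemma emeasure_midpoint_sumset:
  fixes A B C :: "'a::euclidean_space set"
  assumes [measurable]: "A \<in> sets borel" "B \<in> sets borel" "C \<in> sets borel"
    and mid: "\<And>x y. x \<in> A \<Longrightarrow> y \<in> B \<Longrightarrow> (1/2) *\<^sub>R (x + y) \<in> C"
  shows "emeasure lborel A * emeasure lborel B \<le> (emeasure lborel C)\<^sup>2"
  unfolding emeasure_lborel_eq_PiM[OF assms(1)] emeasure_lborel_eq_PiM[OF assms(2)] emeasure_lborel_eq_PiM[OF assms(3)]
proof (rule Prekopa_Leindler_PiM)
  fix x y :: "'a \<Rightarrow> real"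
  have "(\<Sum>b\<in>Basis. (\<lambda>i\<in>Basis. (x i + y i) / 2) b *\<^sub>R b)
      = (1/2) *\<^sub>R ((\<Sum>b\<in>Basis. x b *\<^sub>R b) + (\<Sum>b\<in>Basis. y b *\<^sub>R (b :: 'a)))"
    by (simp add: sum.distrib[symmetric] scaleR_sum_right scaleR_add_left[symmetric] add_divide_distrib)
  then show "indicator A (\<Sum>b\<in>Basis. x b *\<^sub>R b) * indicator B (\<Sum>b\<in>Basis. y b *\<^sub>R b)
     \<le> (indicator C (\<Sum>b\<in>Basis. (\<lambda>i\<in>Basis. (x i + y i) / 2) b *\<^sub>R b) :: ennreal)\<^sup>2"
    using mid by (auto simp: indicator_def)
qed auto

text \<open>
  The set \<open>C\<close> contains the symmetrised set \<open>(A - A) / 2\<close>. In the comparison with Hausdorff measure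
  this takes the place of the isodiametric inequality: the symmetrised set is centred, so a bound on
  the differences of points of \<open>A\<close> confines it to an explicit body of known volume.
\<close>

lemma emeasure_le_difference_body:
  fixes A C :: "'a::euclidean_space set"
  assumes [measurable]: "A \<in> sets borel" "C \<in> sets borel"
    and mid: "\<And>x y. x \<in> A \<Longrightarrow> y \<in> A \<Longrightarrow> (1/2) *\<^sub>R (x - y) \<in> C"
  shows "emeasure lborel A \<le> emeasure lborel C"
proof -
  have eq: "uminus ` A = uminus -` A" by (auto simp: image_iff) (metis minus_minus)
  have [measurable]: "uminus ` A \<in> sets borel"
    unfolding eq using measurable_sets[of uminus borel borel A] by simp
  have "emeasure lborel A = emeasure (distr lborel borel uminus) A"
    using lborel_affine[of "-1" "0 :: 'a"] by (simp add: density_1 comp_def[symmetric])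
  also have "\<dots> = emeasure lborel (uminus ` A)"
    unfolding eq by (subst emeasure_distr) auto
  finally have neg: "emeasure lborel (uminus ` A) = emeasure lborel A" ..
  have "emeasure lborel A * emeasure lborel (uminus ` A) \<le> (emeasure lborel C)\<^sup>2"
    by (rule emeasure_midpoint_sumset) (auto intro: mid)
  then have "(emeasure lborel A)\<^sup>2 \<le> (emeasure lborel C)\<^sup>2"
    by (simp add: neg power2_eq_square)
  then show ?thesis
    by (cases "emeasure lborel A"; cases "emeasure lborel C")
       (auto simp: ennreal_power top_power_ennreal power2_le_iff_abs_le top_unique)
qed

section \<open>Rotations and the volume of cylinders\<close>

text \<open>
  Both sides are translation invariant measures in \<open>A\<close>. Integrating \<open>1\<^sub>B(x) 1\<^sub>A(U y + x)\<close> over both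
  variables in either order shows that they are proportional, and the unit ball, which \<open>U\<close>
  preserves, gives the constant \<open>1\<close>.
\<close>

lemma emeasure_lborel_orthogonal_vimage:
  fixes U :: "'a::euclidean_space \<Rightarrow> 'a"
  assumes U: "orthogonal_transformation U" and A[measurable]: "A \<in> sets borel"
  shows "emeasure lborel (U -` A) = emeasure lborel A"
proof -
  have lin: "linear U" using U by (simp add: orthogonal_transformation_linear)
  then have [measurable]: "U \<in> borel_measurable borel"
    by (intro borel_measurable_continuous_onI linear_continuous_on linear_conv_bounded_linear[THEN iffD1])
  have [measurable]: "U -` A \<in> sets borel"
    using measurable_sets[of U borel borel A] by simp
  let ?B = "cball 0 1 :: 'a set"
  have [measurable]: "?B \<in> sets borel" by simp
  let ?i = "\<lambda>x y. indicator ?B x * indicator A (U y + x)"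
    and ?j = "\<lambda>x y. indicator ?B (x - U y) * indicator A x"
  have shift: "(\<integral>\<^sup>+y. indicator A (U y + x) \<partial>lborel) = emeasure lborel (U -` A)" for x
  proof -
    obtain z where z: "x = U z" using orthogonal_transformation_surj[OF U] by (metis surjD)
    have "(\<integral>\<^sup>+y. indicator A (U y + x) \<partial>lborel) = (\<integral>\<^sup>+y. indicator (U -` A) (z + y) \<partial>lborel)"
      by (intro nn_integral_cong) (auto simp: z linear_add[OF lin] indicator_def add.commute)
    also have "\<dots> = (\<integral>\<^sup>+y. indicator (U -` A) y \<partial>distr lborel borel ((+) z))"
      by (subst nn_integral_distr) auto
    finally show ?thesis by (simp add: lborel_distr_plus)
  qed
  have "emeasure lborel ?B * emeasure lborel (U -` A)
      = (\<integral>\<^sup>+x. indicator ?B x * (\<integral>\<^sup>+y. indicator A (U y + x) \<partial>lborel) \<partial>lborel)"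
    by (simp only: shift, subst nn_integral_multc) (auto intro!: borel_measurable_indicator)
  also have "\<dots> = (\<integral>\<^sup>+x. (\<integral>\<^sup>+y. ?i x y \<partial>lborel) \<partial>lborel)"
    by (simp add: nn_integral_cmult)
  also have "\<dots> = (\<integral>\<^sup>+y. (\<integral>\<^sup>+x. ?i x y \<partial>lborel) \<partial>lborel)"
    by (rule lborel_pair.Fubini') measurable
  also have "\<dots> = (\<integral>\<^sup>+y. (\<integral>\<^sup>+x. ?j x y \<partial>distr lborel borel ((+) (U y))) \<partial>lborel)"
    by (intro nn_integral_cong, subst nn_integral_distr) auto
  also have "\<dots> = (\<integral>\<^sup>+y. (\<integral>\<^sup>+x. ?j x y \<partial>lborel) \<partial>lborel)"
    by (simp only: lborel_distr_plus)
  also have "\<dots> = (\<integral>\<^sup>+x. (\<integral>\<^sup>+y. ?j x y \<partial>lborel) \<partial>lborel)"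
    by (rule lborel_pair.Fubini') measurable
  also have "\<dots> = (\<integral>\<^sup>+x. emeasure lborel ?B * indicator A x \<partial>lborel)"
  proof (intro nn_integral_cong)
    fix x :: 'a
    obtain z where z: "x = U z" using orthogonal_transformation_surj[OF U] by (metis surjD)
    have "x - U y \<in> ?B \<longleftrightarrow> y \<in> cball z 1" for y
      unfolding z linear_diff[OF lin, symmetric]
      using orthogonal_transformation_norm[OF U, of "z - y"] by (simp add: dist_norm)
    then have "(\<integral>\<^sup>+y. ?j x y \<partial>lborel)
        = (\<integral>\<^sup>+y. indicator A x * indicator (cball z 1) y \<partial>lborel)"
      by (intro nn_integral_cong) (auto simp: indicator_def)
    also have "\<dots> = indicator A x * emeasure lborel (cball z 1)"
      by (rule nn_integral_cmult_indicator) simp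
    finally show "(\<integral>\<^sup>+y. ?j x y \<partial>lborel) = emeasure lborel ?B * indicator A x"
      by (simp add: emeasure_cball mult.commute)
  qed
  also have "\<dots> = emeasure lborel ?B * emeasure lborel A"
    by (simp add: nn_integral_cmult)
  finally show ?thesis
    by (simp add: emeasure_cball ennreal_mult_cancel_left unit_ball_vol_pos less_imp_neq[symmetric])
qed

definition cylinder :: "'a::euclidean_space \<Rightarrow> real \<Rightarrow> real \<Rightarrow> real \<Rightarrow> 'a set" where
  "cylinder e \<rho> a b = {x. norm (x - (x \<bullet> e) *\<^sub>R e) \<le> \<rho> \<and> a \<le> x \<bullet> e \<and> x \<bullet> e \<le> b}"

lemma closed_cylinder: "closed (cylinder e \<rho> a b)"
  unfolding cylinder_def
  by (intro closed_Collect_conj closed_Collect_le continuous_intros)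

lemma emeasure_cylinder_Basis:
  fixes e :: "'a::euclidean_space"
  assumes e: "e \<in> Basis" and \<rho>: "\<rho> > 0" and ab: "a \<le> b"
  shows "emeasure lborel (cylinder e \<rho> a b)
     = ennreal (unit_ball_vol (real (DIM('a) - 1)) * \<rho> ^ (DIM('a) - 1) * (b - a))"
proof -
  interpret product_sigma_finite "\<lambda>_. lborel :: real measure" by standard
  let ?I = "Basis - {e} :: 'a set"
  let ?D = "{y. sqrt (\<Sum>i\<in>?I. (y i)\<^sup>2) \<le> \<rho>} :: ('a \<Rightarrow> real) set"
  let ?P = "Pi\<^sub>M ?I (\<lambda>_. lborel :: real measure)" and ?C = "cylinder e \<rho> a b"
  have ins: "insert e ?I = Basis" using e by auto
  have [measurable]: "?C \<in> sets borel"
    by (intro borel_closed closed_cylinder)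
  have split: "(\<Sum>c\<in>Basis. (y(e := t)) c *\<^sub>R c) = t *\<^sub>R e + (\<Sum>c\<in>?I. y c *\<^sub>R c)" for y and t :: real
    using e by (subst sum.remove[of _ e]) (auto intro!: sum.cong)
  have inner_e: "(\<Sum>c\<in>?I. y c *\<^sub>R c) \<bullet> e = 0" for y :: "'a \<Rightarrow> real"
    using e by (simp add: inner_sum_left inner_Basis)
  have norm: "norm (\<Sum>c\<in>?I. y c *\<^sub>R c) = sqrt (\<Sum>i\<in>?I. (y i)\<^sup>2)" for y :: "'a \<Rightarrow> real"
    by (simp add: norm_eq_sqrt_inner inner_sum_left inner_sum_right inner_Basis power2_eq_square if_distrib
        cong: if_cong)
  have mem: "(\<Sum>c\<in>Basis. (y(e := t)) c *\<^sub>R c) \<in> ?C \<longleftrightarrow> t \<in> {a..b} \<and> y \<in> ?D" for y and t :: real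
  proof -
    have "(t *\<^sub>R e + (\<Sum>c\<in>?I. y c *\<^sub>R c)) \<bullet> e = t"
      using e by (simp add: inner_add_left inner_e)
    then show ?thesis unfolding split cylinder_def by (auto simp: norm)
  qed
  have "emeasure lborel (?C)
     = (\<integral>\<^sup>+x. indicator (?C) (\<Sum>c\<in>Basis. x c *\<^sub>R c) \<partial>Pi\<^sub>M (insert e ?I) (\<lambda>_. lborel))"
    unfolding ins by (rule emeasure_lborel_eq_PiM) measurable
  also have "\<dots> = (\<integral>\<^sup>+t. (\<integral>\<^sup>+y. indicator (?C) (\<Sum>c\<in>Basis. (y(e := t)) c *\<^sub>R c)
      \<partial>?P) \<partial>lborel)"
    by (rule product_nn_integral_insert_rev) (auto simp: ins)
  also have "\<dots> = (\<integral>\<^sup>+t. indicator {a..b} t *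
       emeasure (?P) (?D \<inter> space (?P)) \<partial>lborel)"
  proof (intro nn_integral_cong)
    fix t :: real
    have D: "?D \<inter> space (?P) \<in> sets (?P)"
      by measurable
    have "(\<integral>\<^sup>+y. indicator (?C) (\<Sum>c\<in>Basis. (y(e := t)) c *\<^sub>R c) \<partial>?P)
       = (\<integral>\<^sup>+y. indicator {a..b} t * indicator (?D \<inter> space (?P)) y \<partial>?P)"
      by (intro nn_integral_cong) (simp only: indicator_def mem Int_iff, auto)
    also have "\<dots> = indicator {a..b} t * emeasure (?P) (?D \<inter> space (?P))"
      using D by (simp add: nn_integral_cmult)
    finally show "(\<integral>\<^sup>+y. indicator (?C) (\<Sum>c\<in>Basis. (y(e := t)) c *\<^sub>R c) \<partial>?P)
       = indicator {a..b} t * emeasure (?P) (?D \<inter> space (?P))" .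
  qed
  also have "\<dots> = ennreal (b - a) * ennreal (unit_ball_vol (real (card ?I)) * \<rho> ^ card ?I)"
    using ab \<rho> by (simp add: nn_integral_multc emeasure_cball_aux)
  also have "card ?I = DIM('a) - 1" using e by simp
  finally show ?thesis
    using ab \<rho> by (simp add: ennreal_mult[symmetric] unit_ball_vol_nonneg mult_ac)
qed

lemma emeasure_cylinder_pos:
  fixes e :: "real^'n"
  assumes e: "norm e = 1" and \<rho>: "\<rho> > 0" and ab: "a \<le> b"
  shows "emeasure lborel (cylinder e \<rho> a b)
     = ennreal (unit_ball_vol (real (CARD('n) - 1)) * \<rho> ^ (CARD('n) - 1) * (b - a))"
proof -
  obtain e0 :: "real^'n" where e0: "e0 \<in> Basis" using nonempty_Basis by blast
  obtain U where U: "orthogonal_transformation U" "U e0 = e"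
    using orthogonal_transformation_exists_1[of e0 e] e e0 by auto
  have inner: "U x \<bullet> U y = x \<bullet> y" for x y
    using U(1) by (simp add: orthogonal_transformation_def)
  have lin: "linear U" using U(1) by (simp add: orthogonal_transformation_linear)
  have nrm: "norm (U x - (U x \<bullet> e) *\<^sub>R e) = norm (x - (x \<bullet> e0) *\<^sub>R e0)" for x
  proof -
    have "U x - (U x \<bullet> e) *\<^sub>R e = U (x - (x \<bullet> e0) *\<^sub>R e0)"
      using inner[of x e0] U(2) by (simp add: linear_diff[OF lin] linear_scale[OF lin])
    then show ?thesis using orthogonal_transformation_norm[OF U(1)] by simp
  qed
  have im: "U ` cylinder e0 \<rho> a b = cylinder e \<rho> a b"
  proof (intro equalityI subsetI)
    fix x assume "x \<in> cylinder e \<rho> a b"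
    moreover obtain y where y: "x = U y"
      using orthogonal_transformation_surj[OF U(1)] by (metis surjD)
    ultimately have "y \<in> cylinder e0 \<rho> a b"
      using nrm[of y] inner[of y e0] U(2) by (simp add: cylinder_def)
    then show "x \<in> U ` cylinder e0 \<rho> a b" using y by blast
  qed (use nrm inner[of _ e0] U(2) in \<open>auto simp: cylinder_def\<close>)
  have "U -` cylinder e \<rho> a b = cylinder e0 \<rho> a b"
    unfolding im[symmetric] by (rule inj_vimage_image_eq[OF orthogonal_transformation_inj[OF U(1)]])
  then have "emeasure lborel (cylinder e \<rho> a b) = emeasure lborel (cylinder e0 \<rho> a b)"
    using emeasure_lborel_orthogonal_vimage[OF U(1), of "cylinder e \<rho> a b"]
    by (simp add: borel_closed closed_cylinder)
  then show ?thesis using emeasure_cylinder_Basis[OF e0 \<rho> ab] by simp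
qed

text \<open>
  Radius \<open>0\<close> has to be admitted, since sets of diameter \<open>0\<close> occur in covers.
\<close>

lemma emeasure_cylinder_le:
  fixes e :: "real^'n"
  assumes e: "norm e = 1" and \<rho>: "\<rho> \<ge> 0" and ab: "a \<le> b"
  shows "emeasure lborel (cylinder e \<rho> a b)
     \<le> ennreal (unit_ball_vol (real (CARD('n) - 1)) * \<rho> ^ (CARD('n) - 1) * (b - a))"
proof (rule tendsto_lowerbound)
  let ?v = "\<lambda>\<rho>. ennreal (unit_ball_vol (real (CARD('n) - 1)) * \<rho> ^ (CARD('n) - 1) * (b - a))"
  show "(?v \<longlongrightarrow> ?v \<rho>) (at_right \<rho>)"
    by (intro tendsto_intros)
  show "\<forall>\<^sub>F r in at_right \<rho>. emeasure lborel (cylinder e \<rho> a b) \<le> ?v r"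
    unfolding eventually_at_right_field
  proof (intro exI[of _ "\<rho> + 1"] conjI allI impI)
    fix r assume "\<rho> < r" "r < \<rho> + 1"
    then show "emeasure lborel (cylinder e \<rho> a b) \<le> ?v r"
      using \<rho> by (subst emeasure_cylinder_pos[OF e _ ab, symmetric])
        (auto simp: cylinder_def intro!: emeasure_mono borel_closed closed_cylinder[unfolded cylinder_def])
  qed simp
qed simp

section \<open>Shells over subsets of the sphere\<close>

text \<open>
  The half-open radial range makes shells over a fixed base add up. For \<open>a \<ge> 0\<close> it also keeps the
  origin out.
\<close>

definition shell :: "'a::euclidean_space set \<Rightarrow> real \<Rightarrow> real \<Rightarrow> 'a set" where
  "shell A a b = {x. a < norm x \<and> norm x \<le> b \<and> x /\<^sub>R norm x \<in> A}"

text \<open>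
  This is the cone measure: \<open>n\<close> times the volume of the cone over \<open>A\<close> with apex \<open>0\<close>. For a
  Borel subset of the sphere it turns out to be the surface measure.
\<close>

definition cone_content :: "'a::euclidean_space set \<Rightarrow> ennreal" where
  "cone_content A = of_nat DIM('a) * emeasure lborel (shell A 0 1)"

lemma sets_shell [measurable]: "A \<in> sets borel \<Longrightarrow> shell A a b \<in> sets borel"
proof -
  assume [measurable]: "A \<in> sets borel"
  have "(\<lambda>x :: 'a. x /\<^sub>R norm x) -` A \<inter> space borel \<in> sets borel"
    by (rule measurable_sets[of _ borel borel]) measurable
  then have [measurable]: "{x. x /\<^sub>R norm x \<in> A} \<in> sets borel"
    by (simp add: vimage_def)
  have "shell A a b = {x. a < norm x \<and> norm x \<le> b} \<inter> {x. x /\<^sub>R norm x \<in> A}"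
    by (auto simp: shell_def)
  also have "\<dots> \<in> sets borel" by measurable
  finally show ?thesis .
qed

lemma shell_subset_cball: "shell A a b \<subseteq> cball 0 b"
  by (auto simp: shell_def)

lemma emeasure_shell_finite: "emeasure lborel (shell A a b) \<noteq> \<infinity>"
  using emeasure_mono[OF shell_subset_cball, of b lborel A a] emeasure_lborel_cball_finite[of "0::'a" b]
  by (auto simp: top_unique)

lemma emeasure_shell_0:
  fixes A :: "'a::euclidean_space set"
  assumes [measurable]: "A \<in> sets borel" and b: "0 < b"
  shows "emeasure lborel (shell A 0 b) = ennreal (b ^ DIM('a)) * emeasure lborel (shell A 0 1)"
proof -
  have *: "b *\<^sub>R x \<in> shell A 0 b \<longleftrightarrow> x \<in> shell A 0 1" for x
  proof -
    have "(b *\<^sub>R x) /\<^sub>R norm (b *\<^sub>R x) = x /\<^sub>R norm x" using b by simp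
    then show ?thesis
      unfolding shell_def mem_Collect_eq using b by (simp only: norm_scaleR) (simp add: zero_less_mult_iff)
  qed
  have "emeasure lborel (shell A 0 b)
     = (\<integral>\<^sup>+x. indicator (shell A 0 b) x \<partial>density (distr lborel borel (\<lambda>x. 0 + b *\<^sub>R x)) (\<lambda>_. \<bar>b\<bar> ^ DIM('a)))"
    using b by (subst lborel_affine[symmetric]) auto
  also have "\<dots> = (\<integral>\<^sup>+x. ennreal (b ^ DIM('a)) * indicator (shell A 0 b) (b *\<^sub>R x) \<partial>lborel)"
    using b by (simp add: emeasure_density nn_integral_distr)
  also have "\<dots> = (\<integral>\<^sup>+x. ennreal (b ^ DIM('a)) * indicator (shell A 0 1) x \<partial>lborel)"
    by (simp add: indicator_def *)
  finally show ?thesis by (simp add: nn_integral_cmult)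
qed

lemma emeasure_shell:
  fixes A :: "'a::euclidean_space set"
  assumes [measurable]: "A \<in> sets borel" and ab: "0 \<le> a" "a \<le> b"
  shows "emeasure lborel (shell A a b) = ennreal (b ^ DIM('a) - a ^ DIM('a)) * emeasure lborel (shell A 0 1)"
proof -
  have shell0: "emeasure lborel (shell A 0 c) = ennreal (c ^ DIM('a)) * emeasure lborel (shell A 0 1)"
    if "0 \<le> c" for c
  proof (cases "c = 0")
    case True
    then have "shell A 0 c = {}" by (auto simp: shell_def)
    then show ?thesis using True by (simp add: zero_power)
  next
    case False
    then show ?thesis using that by (intro emeasure_shell_0) auto
  qed
  have "shell A a b = shell A 0 b - shell A 0 a"
    unfolding shell_def using ab by auto
  moreover have "shell A 0 a \<subseteq> shell A 0 b"
    unfolding shell_def using ab by auto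
  ultimately have "emeasure lborel (shell A a b) = emeasure lborel (shell A 0 b) - emeasure lborel (shell A 0 a)"
    using ab emeasure_shell_finite[of A 0 a]
    by (simp add: emeasure_Diff)
  moreover obtain m where "emeasure lborel (shell A 0 1) = ennreal m" "0 \<le> m"
    using emeasure_shell_finite[of A 0 1] by (cases "emeasure lborel (shell A 0 1)") auto
  ultimately show ?thesis
    using ab by (simp add: shell0[of a] shell0[of b] ennreal_mult[symmetric] ennreal_minus left_diff_distrib power_mono)
qed

lemma cone_content_finite: "cone_content A \<noteq> \<infinity>"
  using emeasure_shell_finite[of A 0 1] by (auto simp: cone_content_def ennreal_mult_eq_top_iff)

lemma cone_content_mono:
  fixes A B :: "'a::euclidean_space set"
  assumes "A \<subseteq> B" "B \<in> sets borel"
  shows "cone_content A \<le> cone_content B"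
  unfolding cone_content_def using assms
  by (intro mult_left_mono emeasure_mono) (auto simp: shell_def sets_shell[unfolded shell_def])

lemma cone_content_subadditive:
  fixes A :: "nat \<Rightarrow> 'a::euclidean_space set"
  assumes [measurable]: "\<And>i. A i \<in> sets borel"
  shows "cone_content (\<Union>i. A i) \<le> (\<Sum>i. cone_content (A i))"
proof -
  have "shell (\<Union>i. A i) 0 1 = (\<Union>i. shell (A i) 0 1)" by (auto simp: shell_def)
  then show ?thesis
    unfolding cone_content_def
    by (auto intro!: mult_left_mono emeasure_subadditive_countably)
qed

lemma cone_content_disjoint:
  fixes A :: "nat \<Rightarrow> 'a::euclidean_space set"
  assumes [measurable]: "\<And>i. A i \<in> sets borel" and "disjoint_family A"
  shows "(\<Sum>i. cone_content (A i)) = cone_content (\<Union>i. A i)"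
proof -
  have "shell (\<Union>i. A i) 0 1 = (\<Union>i. shell (A i) 0 1)" by (auto simp: shell_def)
  moreover have "disjoint_family (\<lambda>i. shell (A i) 0 1)"
    using assms(2) by (fastforce simp: disjoint_family_on_def shell_def)
  ultimately show ?thesis
    unfolding cone_content_def
    by (simp add: suminf_emeasure image_subset_iff)
qed

text \<open>
  Bernoulli's inequality. Together with the next bound it says that a thin shell over \<open>A\<close> has volume
  close to its thickness times the cone measure of \<open>A\<close>.
\<close>

lemma cone_content_le_shell:
  fixes A :: "'a::euclidean_space set"
  assumes [measurable]: "A \<in> sets borel" and h: "0 \<le> h"
  shows "ennreal h * cone_content A \<le> emeasure lborel (shell A 1 (1 + h))"
proof -
  have "h * DIM('a) \<le> (1 + h) ^ DIM('a) - 1"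
    using Bernoulli_inequality[of h "DIM('a)"] h by (simp add: mult.commute)
  then have "ennreal (h * DIM('a)) * emeasure lborel (shell A 0 1)
     \<le> ennreal ((1 + h) ^ DIM('a) - 1 ^ DIM('a)) * emeasure lborel (shell A 0 1)"
    by (intro mult_right_mono ennreal_leI) auto
  then show ?thesis
    using h by (simp add: emeasure_shell[of A 1 "1 + h"] cone_content_def ennreal_mult ennreal_of_nat_eq_real_of_nat mult.assoc)
qed

lemma shell_le_cone_content:
  fixes A :: "'a::euclidean_space set"
  assumes [measurable]: "A \<in> sets borel" and h: "0 \<le> h"
  shows "emeasure lborel (shell A 1 (1 + h)) \<le> ennreal (h * (1 + h) ^ (DIM('a) - 1)) * cone_content A"
proof -
  have "(1 + h) ^ n - 1 \<le> h * (1 + h) ^ (n - 1) * n" for n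
  proof (induction n)
    case (Suc n)
    have "(1 + h) ^ (n - 1) \<le> (1 + h) ^ n" using h by (intro power_increasing) auto
    then have "h * (1 + h) ^ (n - 1) * n \<le> h * (1 + h) ^ n * n"
      using h by (intro mult_right_mono mult_left_mono) auto
    then show ?case using Suc by (simp add: algebra_simps)
  qed simp
  then have "ennreal ((1 + h) ^ DIM('a) - 1 ^ DIM('a)) * emeasure lborel (shell A 0 1)
     \<le> ennreal (h * (1 + h) ^ (DIM('a) - 1) * DIM('a)) * emeasure lborel (shell A 0 1)"
    by (intro mult_right_mono ennreal_leI) auto
  then show ?thesis
    using h by (simp add: emeasure_shell[of A 1 "1 + h"] cone_content_def ennreal_mult ennreal_of_nat_eq_real_of_nat mult.assoc)
qed

section \<open>Hausdorff measure on the sphere\<close>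

text \<open>
  A bound for the factor by which volumes in a piece of the sphere of diameter at most \<open>\<delta>\<close> differ from
  those in a flat piece; it tends to \<open>1\<close> as \<open>\<delta>\<close> tends to \<open>0\<close>.
\<close>

definition distortion :: "nat \<Rightarrow> real \<Rightarrow> real" where
  "distortion n \<delta> = (1 + 2 * \<delta>) ^ (n - 1) * (1 + \<delta> / 2)"

lemma distortion_nonneg: "0 \<le> \<delta> \<Longrightarrow> 0 \<le> distortion n \<delta>"
  by (simp add: distortion_def)

lemma tendsto_distortion: "((\<lambda>\<delta>. ennreal (distortion n \<delta>) * c) \<longlongrightarrow> c) (at_right 0)"
proof -
  have "((\<lambda>\<delta>. ennreal (distortion n \<delta>)) \<longlongrightarrow> ennreal (distortion n 0)) (at_right 0)"
    unfolding distortion_def by (intro tendsto_intros) auto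
  then have "((\<lambda>\<delta>. ennreal (distortion n \<delta>) * c) \<longlongrightarrow> ennreal (distortion n 0) * c) (at_right 0)"
    by (intro tendsto_mult_ennreal tendsto_const) (auto simp: distortion_def)
  then show ?thesis by (simp add: distortion_def)
qed

text \<open>
  Let \<open>X\<close> be the shell of thickness \<open>\<delta>\<close> over a set \<open>C\<close> of diameter \<open>d \<le> \<delta>\<close>, and \<open>e\<close> a point of \<open>C\<close>.
  Half differences of points of \<open>X\<close> have a component orthogonal to \<open>e\<close> of length at most
  \<open>(1 + 2 \<delta>) d / 2\<close> and a component along \<open>e\<close> of absolute value at most \<open>(\<delta> + d\<^sup>2 / 2) / 2\<close>. So
  \<open>(X - X) / 2\<close> lies in a cylinder whose base has radius about \<open>d / 2\<close>, and the volume of \<open>X\<close> is at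
  most about \<open>\<delta>\<close> times the cost charged to \<open>C\<close>.
\<close>

lemma cone_content_le_hausdorff_cost:
  fixes C :: "(real^'n) set"
  assumes C[measurable]: "C \<in> sets borel" and sph: "C \<subseteq> sphere 0 1"
    and \<delta>: "0 < \<delta>" "\<delta> \<le> 1" and diam: "diameter C \<le> \<delta>"
  shows "cone_content C \<le> ennreal (distortion CARD('n) \<delta>) * hausdorff_cost (CARD('n) - 1) C"
proof (cases "C = {}")
  case True
  then show ?thesis by (simp add: cone_content_def shell_def)
next
  case False
  then obtain e where e: "e \<in> C" by blast
  have unit: "\<xi> \<bullet> \<xi> = 1" if "\<xi> \<in> C" for \<xi>
    using that sph by (auto simp: norm_eq_1[symmetric])
  note ee = unit[OF e]
  then have e1: "norm e = 1" by (simp add: norm_eq_1)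
  have bC: "bounded C" using sph bounded_subset bounded_sphere by blast
  define d where "d = diameter C"
  have d: "0 \<le> d" "d \<le> \<delta>" "\<And>\<xi> \<eta>. \<xi> \<in> C \<Longrightarrow> \<eta> \<in> C \<Longrightarrow> norm (\<xi> - \<eta>) \<le> d"
    using diameter_ge_0[OF bC] diam diameter_bounded_bound[OF bC] by (auto simp: d_def dist_norm)
  define P where "P x = x - (x \<bullet> e) *\<^sub>R e" for x
  have P_diff: "P (x - y) = P x - P y" and P_scale: "P (c *\<^sub>R x) = c *\<^sub>R P x" for x y c
    by (simp_all add: P_def algebra_simps inner_diff_left)
  have P_le: "norm (P x) \<le> norm x" for x
  proof -
    have "(norm (P x))\<^sup>2 = (norm x)\<^sup>2 - (x \<bullet> e)\<^sup>2"
      unfolding P_def power2_norm_eq_inner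
      by (simp add: inner_diff_left inner_diff_right inner_commute[of e x] power2_eq_square ee)
    then show ?thesis using power2_le_imp_le[of "norm (P x)" "norm x"] by simp
  qed
  have Pe: "P e = 0" by (simp add: P_def ee)
  have P_C: "norm (P \<eta>) \<le> d" if "\<eta> \<in> C" for \<eta>
  proof -
    have "norm (P \<eta>) = norm (P (\<eta> - e))" by (simp only: P_diff Pe diff_0_right)
    also have "\<dots> \<le> norm (\<eta> - e)" by (rule P_le)
    also have "\<dots> \<le> d" by (rule d(3)[OF that e])
    finally show ?thesis .
  qed
  have inner_C: "1 - d\<^sup>2 / 2 \<le> \<xi> \<bullet> e" "\<xi> \<bullet> e \<le> 1" if "\<xi> \<in> C" for \<xi>
  proof -
    have "(norm (\<xi> - e))\<^sup>2 = 2 - 2 * (\<xi> \<bullet> e)"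
      unfolding power2_norm_eq_inner
      by (simp add: inner_diff_left inner_diff_right inner_commute[of e \<xi>] ee unit[OF that])
    moreover have "(norm (\<xi> - e))\<^sup>2 \<le> d\<^sup>2" using d(3)[OF that e] by (intro power_mono) auto
    moreover have "0 \<le> (norm (\<xi> - e))\<^sup>2" by simp
    ultimately show "1 - d\<^sup>2 / 2 \<le> \<xi> \<bullet> e" "\<xi> \<bullet> e \<le> 1" by linarith+
  qed
  have d2: "d\<^sup>2 \<le> \<delta> * \<delta>" "d\<^sup>2 \<le> 1"
    using d \<delta> mult_mono[of d \<delta> d \<delta>] mult_mono[of \<delta> 1 \<delta> 1] by (auto simp: power2_eq_square)
  let ?c = "(\<delta> + d\<^sup>2 / 2) / 2"
  let ?\<rho> = "(1 + 2 * \<delta>) * (d / 2)"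
  have mid: "(1/2) *\<^sub>R (x - y) \<in> cylinder e ?\<rho> (- ?c) ?c"
    if xy: "x \<in> shell C 1 (1 + \<delta>)" "y \<in> shell C 1 (1 + \<delta>)" for x y
  proof -
    have dec: "\<exists>s \<xi>. 1 < s \<and> s \<le> 1 + \<delta> \<and> \<xi> \<in> C \<and> x = s *\<^sub>R \<xi>" if "x \<in> shell C 1 (1 + \<delta>)" for x
    proof (intro exI conjI)
      have "1 < norm x" using that by (simp add: shell_def)
      then have "0 < norm x" by linarith
      then show "x = norm x *\<^sub>R (x /\<^sub>R norm x)" by simp
    qed (use that in \<open>auto simp: shell_def\<close>)
    obtain s \<xi> where s: "1 < s" "s \<le> 1 + \<delta>" "\<xi> \<in> C" "x = s *\<^sub>R \<xi>" using dec[OF xy(1)] by blast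
    obtain t \<eta> where t: "1 < t" "t \<le> 1 + \<delta>" "\<eta> \<in> C" "y = t *\<^sub>R \<eta>" using dec[OF xy(2)] by blast
    have "norm (P (x - y)) = norm (s *\<^sub>R P (\<xi> - \<eta>) + (s - t) *\<^sub>R P \<eta>)"
      by (simp add: s(4) t(4) P_diff P_scale algebra_simps)
    also have "\<dots> \<le> norm (s *\<^sub>R P (\<xi> - \<eta>)) + norm ((s - t) *\<^sub>R P \<eta>)" by (rule norm_triangle_ineq)
    also have "\<dots> \<le> (1 + \<delta>) * d + \<delta> * d"
    proof (intro add_mono)
      show "norm (s *\<^sub>R P (\<xi> - \<eta>)) \<le> (1 + \<delta>) * d"
        using s \<delta> order_trans[OF P_le d(3)[OF s(3) t(3)]] by (auto intro!: mult_mono)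
      show "norm ((s - t) *\<^sub>R P \<eta>) \<le> \<delta> * d"
        using s t \<delta> P_C[OF t(3)] by (auto intro!: mult_mono)
    qed
    finally have perp: "norm (P ((1/2) *\<^sub>R (x - y))) \<le> ?\<rho>"
      by (simp only: P_scale norm_scaleR) (simp add: algebra_simps)
    have range: "1 - d\<^sup>2 / 2 \<le> u * (\<zeta> \<bullet> e) \<and> u * (\<zeta> \<bullet> e) \<le> 1 + \<delta>"
      if "1 < u" "u \<le> 1 + \<delta>" "\<zeta> \<in> C" for u \<zeta>
    proof
      have "0 \<le> \<zeta> \<bullet> e" using inner_C(1)[OF that(3)] d2 by linarith
      then show "1 - d\<^sup>2 / 2 \<le> u * (\<zeta> \<bullet> e)"
        using inner_C(1)[OF that(3)] mult_right_mono[of 1 u "\<zeta> \<bullet> e"] that(1) by simp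
      have "u * (\<zeta> \<bullet> e) \<le> u * 1" using inner_C(2)[OF that(3)] that(1) by (intro mult_left_mono) auto
      then show "u * (\<zeta> \<bullet> e) \<le> 1 + \<delta>" using that(2) by simp
    qed
    have "((1/2) *\<^sub>R (x - y)) \<bullet> e = (s * (\<xi> \<bullet> e) - t * (\<eta> \<bullet> e)) / 2"
      by (simp add: s(4) t(4) inner_diff_left)
    moreover have "- ?c \<le> (a - b) / 2 \<and> (a - b) / 2 \<le> ?c"
      if "1 - d\<^sup>2 / 2 \<le> a \<and> a \<le> 1 + \<delta>" "1 - d\<^sup>2 / 2 \<le> b \<and> b \<le> 1 + \<delta>" for a b :: real
      using that by (simp add: field_simps)
    ultimately have "- ?c \<le> ((1/2) *\<^sub>R (x - y)) \<bullet> e \<and> ((1/2) *\<^sub>R (x - y)) \<bullet> e \<le> ?c"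
      using range[OF s(1-3)] range[OF t(1-3)] by metis
    then show ?thesis
      using perp unfolding cylinder_def P_def by blast
  qed
  let ?w = "unit_ball_vol (real (CARD('n) - 1))"
  have "ennreal \<delta> * cone_content C \<le> emeasure lborel (shell C 1 (1 + \<delta>))"
    using \<delta> by (intro cone_content_le_shell) auto
  also have "\<dots> \<le> emeasure lborel (cylinder e ?\<rho> (- ?c) ?c)"
    by (rule emeasure_le_difference_body[OF _ _ mid]) (auto intro: borel_closed closed_cylinder)
  also have "\<dots> \<le> ennreal (?w * ?\<rho> ^ (CARD('n) - 1) * (?c - - ?c))"
  proof (rule emeasure_cylinder_le[OF e1])
    have "0 \<le> ?c" using \<delta> by simp
    then show "- ?c \<le> ?c" by (metis neg_le_0_iff_le order_trans)
  qed (use d \<delta> in simp)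
  also have "\<dots> \<le> ennreal (\<delta> * (distortion CARD('n) \<delta> * (?w * (d / 2) ^ (CARD('n) - 1))))"
  proof (rule ennreal_leI)
    have "?c - - ?c \<le> \<delta> * (1 + \<delta> / 2)" using d2 by (simp add: algebra_simps)
    then have "?w * ?\<rho> ^ (CARD('n) - 1) * (?c - - ?c) \<le> ?w * ?\<rho> ^ (CARD('n) - 1) * (\<delta> * (1 + \<delta> / 2))"
      using d \<delta> by (intro mult_left_mono) auto
    also have "\<dots> = \<delta> * (distortion CARD('n) \<delta> * (?w * (d / 2) ^ (CARD('n) - 1)))"
      unfolding power_mult_distrib distortion_def by (simp only: mult_ac)
    finally show "?w * ?\<rho> ^ (CARD('n) - 1) * (?c - - ?c)
       \<le> \<delta> * (distortion CARD('n) \<delta> * (?w * (d / 2) ^ (CARD('n) - 1)))" .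
  qed
  also have "\<dots> = ennreal \<delta> * (ennreal (distortion CARD('n) \<delta>) * hausdorff_cost (CARD('n) - 1) C)"
    using False \<delta> d distortion_nonneg[of \<delta> "CARD('n)"]
    by (simp add: hausdorff_cost_def d_def ennreal_mult)
  finally show ?thesis using \<delta> by (subst (asm) ennreal_mult_le_mult_iff) auto
qed

text \<open>
  The sets of a cover may be replaced by the traces of their closures on the sphere, which are Borel
  and cost no more.
\<close>

lemma cone_content_le_hausdorff_outer:
  fixes A :: "(real^'n) set"
  assumes [measurable]: "A \<in> sets borel" and sph: "A \<subseteq> sphere 0 1"
  shows "cone_content A \<le> hausdorff_outer (CARD('n) - 1) A"
proof -
  let ?k = "CARD('n) - 1"
  let ?\<kappa> = "\<lambda>\<delta>. ennreal (distortion CARD('n) \<delta>)"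
  have pre: "cone_content A \<le> ?\<kappa> \<delta> * hausdorff_outer ?k A" if \<delta>: "0 < \<delta>" "\<delta> < 1" for \<delta>
  proof -
    have "cone_content A \<le> ?\<kappa> \<delta> * (\<Sum>i. hausdorff_cost ?k (C i))"
      if C: "C \<in> hausdorff_covers \<delta> A" for C
    proof -
      define D where "D i = closure (C i) \<inter> sphere 0 1" for i
      have bC: "bounded (C i)" "diameter (C i) \<le> \<delta>" for i using C by (auto simp: hausdorff_covers_def)
      have [measurable]: "D i \<in> sets borel" for i unfolding D_def by (intro borel_closed) auto
      have diam: "diameter (D i) \<le> diameter (C i)" for i
        unfolding D_def using diameter_subset[of "closure (C i) \<inter> sphere 0 1" "closure (C i)"]
          diameter_closure[OF bC(1)] bC(1) by (simp add: bounded_closure)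
      have cost: "hausdorff_cost ?k (D i) \<le> hausdorff_cost ?k (C i)" for i
      proof (cases "C i = {}")
        case False
        have "0 \<le> diameter (D i)"
          unfolding D_def by (intro diameter_ge_0) (simp add: bounded_Int)
        then show ?thesis
          using False diam[of i]
          by (auto simp: hausdorff_cost_def intro!: ennreal_leI mult_left_mono power_mono divide_right_mono)
      qed (simp add: D_def)
      have "A \<subseteq> (\<Union>i. D i)"
      proof
        fix x assume "x \<in> A"
        then obtain i where "x \<in> C i" using C by (auto simp: hausdorff_covers_def)
        then have "x \<in> D i" using \<open>x \<in> A\<close> sph closure_subset by (auto simp: D_def)
        then show "x \<in> (\<Union>i. D i)" by blast
      qed
      then have "cone_content A \<le> cone_content (\<Union>i. D i)"
        by (rule cone_content_mono) measurable
      also have "\<dots> \<le> (\<Sum>i. cone_content (D i))" by (intro cone_content_subadditive) auto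
      also have "\<dots> \<le> (\<Sum>i. ?\<kappa> \<delta> * hausdorff_cost ?k (C i))"
      proof (intro suminf_le allI)
        fix i
        have "cone_content (D i) \<le> ?\<kappa> \<delta> * hausdorff_cost ?k (D i)"
          using \<delta> diam[of i] bC(2)[of i]
          by (intro cone_content_le_hausdorff_cost) (auto simp: D_def intro!: borel_closed)
        also have "\<dots> \<le> ?\<kappa> \<delta> * hausdorff_cost ?k (C i)"
          by (intro mult_left_mono cost) simp
        finally show "cone_content (D i) \<le> ?\<kappa> \<delta> * hausdorff_cost ?k (C i)" .
      qed auto
      finally show ?thesis by simp
    qed
    moreover have \<kappa>: "0 < ?\<kappa> \<delta>"
      using \<delta> by (simp add: distortion_def)
    ultimately have "cone_content A / ?\<kappa> \<delta> \<le> hausdorff_premeasure ?k \<delta> A"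
      unfolding hausdorff_premeasure_def by (intro INF_greatest divide_le_posI_ennreal)
    then have "?\<kappa> \<delta> * (cone_content A / ?\<kappa> \<delta>)
        \<le> ?\<kappa> \<delta> * hausdorff_premeasure ?k \<delta> A"
      by (rule mult_left_mono) simp
    then have "cone_content A \<le> ?\<kappa> \<delta> * hausdorff_premeasure ?k \<delta> A"
      using \<kappa> by (simp add: ennreal_times_divide mult_divide_eq_ennreal mult.commute[of _ "cone_content A"])
    also have "\<dots> \<le> ?\<kappa> \<delta> * hausdorff_outer ?k A"
      using \<delta> unfolding hausdorff_outer_def by (intro mult_left_mono SUP_upper) auto
    finally show ?thesis .
  qed
  show ?thesis
  proof (rule tendsto_lowerbound[OF tendsto_distortion])
    show "\<forall>\<^sub>F \<delta> in at_right 0. cone_content A \<le> ?\<kappa> \<delta> * hausdorff_outer ?k A"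
      unfolding eventually_at_right_field using pre by (intro exI[of _ 1]) auto
  qed simp
qed

text \<open>
  The shell over a cap of radius \<open>r\<close> contains a cylinder of radius \<open>r\<close> standing on the tangent plane,
  because radial projection to the sphere moves points outside the ball no further apart. A cap is
  therefore a set for which the general bound is asymptotically sharp.
\<close>

lemma hausdorff_cost_cball_le:
  fixes e :: "real^'n"
  assumes e: "norm e = 1" and r: "0 < r" "r \<le> \<delta>" and \<delta>: "\<delta> \<le> 1"
  shows "ennreal (unit_ball_vol (real (CARD('n) - 1)) * r ^ (CARD('n) - 1))
     \<le> ennreal (distortion CARD('n) \<delta>) * cone_content (cball e r \<inter> sphere 0 1)"
proof -
  let ?w = "unit_ball_vol (real (CARD('n) - 1)) * r ^ (CARD('n) - 1)"
  let ?A = "cball e r \<inter> sphere 0 1"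
  have ee: "e \<bullet> e = 1" using e by (simp add: norm_eq_1)
  have [measurable]: "?A \<in> sets borel" by (intro borel_closed closed_Int) auto
  define h where "h = \<delta> + r\<^sup>2 / 2"
  have r2: "r\<^sup>2 \<le> \<delta> * \<delta>" "\<delta> * \<delta> \<le> \<delta>"
    using r \<delta> mult_mono[of r \<delta> r \<delta>] mult_left_mono[of \<delta> 1 \<delta>] by (auto simp: power2_eq_square)
  have h: "0 \<le> h" "h \<le> \<delta> * (1 + \<delta> / 2)" "h \<le> 2 * \<delta>"
  proof -
    show "0 \<le> h" using r by (simp add: h_def)
    show "h \<le> \<delta> * (1 + \<delta> / 2)" using r2 by (simp add: h_def algebra_simps)
    have "r\<^sup>2 \<le> \<delta>" using r2 by linarith
    then show "h \<le> 2 * \<delta>" using r by (simp add: h_def)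
  qed
  have sub: "cylinder e r 1 (1 + \<delta>) \<subseteq> insert e (shell ?A 1 (1 + h))"
  proof
    fix x assume x: "x \<in> cylinder e r 1 (1 + \<delta>)"
    define s where "s = x \<bullet> e"
    define y where "y = x - s *\<^sub>R e"
    have y: "norm y \<le> r" and s: "1 \<le> s" "s \<le> 1 + \<delta>"
      using x by (auto simp: cylinder_def y_def s_def)
    have ye: "y \<bullet> e = 0" by (simp add: y_def s_def inner_diff_left ee)
    have xy: "x = y + s *\<^sub>R e" by (simp add: y_def)
    have nx: "(norm x)\<^sup>2 = (norm y)\<^sup>2 + s\<^sup>2"
      unfolding xy power2_norm_eq_inner
      by (simp add: inner_add_left inner_add_right ye inner_commute[of e y] ee power2_eq_square)
    have "s\<^sup>2 \<le> (norm x)\<^sup>2" by (simp add: nx)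
    then have s_le: "s \<le> norm x" by (rule power2_le_imp_le) simp
    then have x1: "1 \<le> norm x" using s by simp
    have "(norm x)\<^sup>2 \<le> r\<^sup>2 + s\<^sup>2" using power_mono[OF y, of 2] by (simp add: nx)
    also have "\<dots> \<le> (s + r\<^sup>2 / 2)\<^sup>2"
    proof -
      have "r\<^sup>2 \<le> s * r\<^sup>2" using s mult_right_mono[of 1 s "r\<^sup>2"] by simp
      moreover have "(s + r\<^sup>2 / 2)\<^sup>2 = s\<^sup>2 + s * r\<^sup>2 + (r\<^sup>2 / 2)\<^sup>2"
        unfolding power2_sum by simp
      moreover have "0 \<le> (r\<^sup>2 / 2)\<^sup>2" by simp
      ultimately show ?thesis by linarith
    qed
    finally have "norm x \<le> s + r\<^sup>2 / 2" by (rule power2_le_imp_le) (use s in simp)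
    then have xh: "norm x \<le> 1 + h" using s by (simp add: h_def)
    define v where "v = x /\<^sub>R norm x"
    have nu: "norm v = 1"
    proof -
      have "norm x \<noteq> 0" using x1 by linarith
      then show ?thesis by (simp add: v_def)
    qed
    then have vv: "v \<bullet> v = 1" unfolding norm_eq_1 .
    have "(norm (v - e))\<^sup>2 \<le> (norm y)\<^sup>2"
    proof -
      have "(norm (v - e))\<^sup>2 = 2 - 2 * (v \<bullet> e)"
        unfolding power2_norm_eq_inner
        by (simp add: inner_diff_left inner_diff_right inner_commute[of e v] vv ee)
      also have "v \<bullet> e = s / norm x" by (simp add: s_def v_def divide_inverse)
      also have "2 - 2 * (s / norm x) \<le> (norm x)\<^sup>2 - s\<^sup>2"
      proof -
        have "0 \<le> (norm x - s) * (norm x * (norm x + s) - 2)"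
          using s s_le x1 mult_mono[of 1 "norm x" 2 "norm x + s"] by (intro mult_nonneg_nonneg) auto
        then have "(2 - 2 * (s / norm x)) * norm x \<le> ((norm x)\<^sup>2 - s\<^sup>2) * norm x"
          using x1 by (simp add: algebra_simps power2_eq_square)
        moreover have "0 < norm x" using x1 by linarith
        ultimately show ?thesis using mult_right_le_imp_le by blast
      qed
      finally show ?thesis by (simp add: nx)
    qed
    then have "norm (v - e) \<le> norm y" by (rule power2_le_imp_le) simp
    then have "norm (v - e) \<le> r" using y by linarith
    then have uA: "v \<in> ?A" using nu by (simp add: dist_norm norm_minus_commute)
    show "x \<in> insert e (shell ?A 1 (1 + h))"
    proof (cases "norm x = 1")
      case True
      then have "s = 1" using s s_le by simp
      then have "y = 0" using nx True by simp
      then show ?thesis using xy \<open>s = 1\<close> by simp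
    qed (use x1 xh uA in \<open>auto simp: shell_def v_def\<close>)
  qed
  have "ennreal (?w * (1 + \<delta> - 1)) = emeasure lborel (cylinder e r 1 (1 + \<delta>))"
    using r by (intro emeasure_cylinder_pos[OF e, symmetric]) auto
  also have "\<dots> \<le> emeasure lborel ({e} \<union> shell ?A 1 (1 + h))"
    using sub by (intro emeasure_mono) auto
  also have "\<dots> \<le> emeasure lborel {e} + emeasure lborel (shell ?A 1 (1 + h))"
    by (intro emeasure_subadditive) auto
  also have "\<dots> = emeasure lborel (shell ?A 1 (1 + h))" by simp
  also have "\<dots> \<le> ennreal (h * (1 + h) ^ (CARD('n) - 1)) * cone_content ?A"
    using shell_le_cone_content[of ?A h] h by simp
  also have "\<dots> \<le> ennreal (\<delta> * distortion CARD('n) \<delta>) * cone_content ?A"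
  proof (intro mult_right_mono ennreal_leI)
    have "h * (1 + h) ^ (CARD('n) - 1) \<le> (\<delta> * (1 + \<delta> / 2)) * (1 + 2 * \<delta>) ^ (CARD('n) - 1)"
      using h r by (intro mult_mono power_mono) auto
    then show "h * (1 + h) ^ (CARD('n) - 1) \<le> \<delta> * distortion CARD('n) \<delta>"
      by (simp add: distortion_def mult_ac)
  qed simp
  finally have "ennreal \<delta> * ennreal ?w \<le> ennreal \<delta> * (ennreal (distortion CARD('n) \<delta>) * cone_content ?A)"
    using r distortion_nonneg[of \<delta> "CARD('n)"] by (simp add: ennreal_mult mult_ac)
  then show ?thesis using r by (subst (asm) ennreal_mult_le_mult_iff) auto
qed

lemma ennreal_suminf_tail_tendsto_0:
  fixes u :: "nat \<Rightarrow> ennreal"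
  assumes "(\<Sum>i. u i) \<noteq> \<infinity>"
  shows "(\<lambda>N. \<Sum>i. u (i + N)) \<longlonglongrightarrow> 0"
proof -
  have fin: "u i \<noteq> \<infinity>" for i
    using assms ennreal_suminf_lessD[of u \<infinity> i] by (auto simp: less_top)
  define v where "v i = enn2real (u i)" for i
  have u: "u i = ennreal (v i)" and v: "0 \<le> v i" for i
    using fin[of i] by (auto simp: v_def less_top)
  have sm: "summable v"
    using assms u v by (intro summable_suminf_not_top) auto
  have "(\<lambda>N. ennreal (\<Sum>i. v (i + N))) \<longlonglongrightarrow> ennreal 0"
    by (intro tendsto_ennrealI suminf_exist_split2[OF sm])
  moreover have "(\<Sum>i. u (i + N)) = ennreal (\<Sum>i. v (i + N))" for N
    unfolding u using v sm by (intro suminf_ennreal2) (auto simp: summable_iff_shift)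
  ultimately show ?thesis by simp
qed

text \<open>
  Vitali's covering lemma gives disjoint balls centred on the sphere. The caps which they cut out
  have total cone measure at most that of the sphere, and by the previous lemma their costs are
  bounded by their cone measures up to the distortion. The first \<open>N\<close> balls, together with the fivefold enlargements of
  all later ones, still cover; the enlargements contribute a constant times the tail of a convergent
  series.
\<close>

lemma hausdorff_premeasure_sphere_le:
  assumes \<delta>: "0 < \<delta>" "\<delta> \<le> 1"
  shows "hausdorff_premeasure (CARD('n) - 1) \<delta> (sphere 0 1 :: (real^'n) set)
     \<le> ennreal (distortion CARD('n) \<delta>) * cone_content (sphere 0 1 :: (real^'n) set)"
proof -
  let ?S = "sphere 0 1 :: (real^'n) set" and ?k = "CARD('n) - 1"
  let ?\<kappa> = "ennreal (distortion CARD('n) \<delta>)"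
  let ?K = "?S \<times> {0<..\<delta> / 10}"
  let ?b = "\<lambda>i :: (real^'n) \<times> real. cball (fst i) (snd i)"
  obtain C where C: "countable C" "C \<subseteq> ?K"
     "pairwise (\<lambda>i j. disjnt (?b i) (?b j)) C"
     "\<And>i. i \<in> ?K \<Longrightarrow> \<exists>j. j \<in> C \<and> \<not> disjnt (?b i) (?b j) \<and>
           ?b i \<subseteq> ball (fst j) (5 * snd j)"
  proof (rule Vitali_covering_lemma_cballs_balls[where a = fst and r = snd and K = ?K and B = "\<delta> / 10"])
    show "0 < snd i \<and> snd i \<le> \<delta> / 10" if "i \<in> ?K" for i using that by auto
  qed (rule that)
  obtain p :: "nat \<Rightarrow> (real^'n) \<times> real" and J where p: "bij_betw p J C"
    by (rule countableE_bij[OF C(1)])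
  define a where "a i = fst (p i)" for i
  define r where "r i = snd (p i)" for i
  have J: "norm (a i) = 1" "0 < r i" "r i \<le> \<delta> / 10" if "i \<in> J" for i
  proof -
    have "p i \<in> ?K" using bij_betwE[OF p] C(2) that by blast
    then show "norm (a i) = 1" "0 < r i" "r i \<le> \<delta> / 10"
      by (auto simp: a_def r_def mem_Times_iff)
  qed
  have disj: "cball (a i) (r i) \<inter> cball (a j) (r j) = {}" if "i \<in> J" "j \<in> J" "i \<noteq> j" for i j
  proof -
    have "p i \<in> C" "p j \<in> C" "p i \<noteq> p j"
      using that p by (auto simp: bij_betw_def inj_on_def)
    then show ?thesis using C(3) by (simp add: pairwise_def disjnt_def a_def r_def)
  qed
  define w where "w = unit_ball_vol (real ?k)"
  have w: "0 \<le> w" by (simp add: w_def)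
  define u where "u i = (if i \<in> J then ennreal (w * r i ^ ?k) else 0)" for i
  define B where "B i = (if i \<in> J then cball (a i) (r i) \<inter> ?S else {})" for i
  have [measurable]: "B i \<in> sets borel" for i
    unfolding B_def by (auto intro!: borel_closed closed_Int)
  have "u i \<le> ?\<kappa> * cone_content (B i)" for i
    using hausdorff_cost_cball_le[of "a i" "r i" \<delta>] J[of i] \<delta> by (auto simp: u_def B_def w_def)
  then have "(\<Sum>i. u i) \<le> (\<Sum>i. ?\<kappa> * cone_content (B i))" by (intro suminf_le) auto
  also have "\<dots> = ?\<kappa> * cone_content (\<Union>i. B i)"
  proof -
    have "disjoint_family B"
      using disj by (fastforce simp: disjoint_family_on_def B_def)
    then show ?thesis by (simp add: cone_content_disjoint)
  qed
  also have "\<dots> \<le> ?\<kappa> * cone_content ?S"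
    by (intro mult_left_mono cone_content_mono) (auto simp: B_def split: if_splits intro: borel_closed)
  finally have sum_u: "(\<Sum>i. u i) \<le> ?\<kappa> * cone_content ?S" .
  moreover have "?\<kappa> * cone_content ?S < \<infinity>"
    using cone_content_finite[of ?S] by (simp add: ennreal_mult_less_top less_top)
  ultimately have fin: "(\<Sum>i. u i) \<noteq> \<infinity>" by (auto simp: top_unique)
  have cost: "hausdorff_cost ?k (cball (a i) (c * r i)) = ennreal (c ^ ?k) * u i"
    if "i \<in> J" "0 \<le> c" for i and c :: real
  proof -
    have "cball (a i) (c * r i) \<noteq> {}" "diameter (cball (a i) (c * r i)) = 2 * (c * r i)"
    proof -
      have "0 \<le> c * r i" using that J(2)[of i] by simp
      then show "cball (a i) (c * r i) \<noteq> {}" "diameter (cball (a i) (c * r i)) = 2 * (c * r i)"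
        by (simp_all add: diameter_cball not_less)
    qed
    then show ?thesis
      using that J(2)[OF that(1)] w
      by (simp add: hausdorff_cost_def u_def w_def ennreal_mult[symmetric] power_mult_distrib mult_ac)
  qed
  have bound: "hausdorff_premeasure ?k \<delta> ?S \<le> ?\<kappa> * cone_content ?S + ennreal (5 ^ ?k) * (\<Sum>i. u (i + N))" for N
  proof -
    define E where "E i = (if i \<in> J then cball (a i) ((if i < N then 1 else 5) * r i) else {})" for i
    have "?S \<subseteq> (\<Union>i. E i)"
    proof
      fix x assume x: "x \<in> ?S"
      show "x \<in> (\<Union>i. E i)"
      proof (cases "\<exists>i<N. i \<in> J \<and> x \<in> cball (a i) (r i)")
        case True
        then obtain i where "i < N" "i \<in> J" "x \<in> cball (a i) (r i)" by blast
        then have "x \<in> E i" by (simp add: E_def)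
        then show ?thesis by blast
      next
        case False
        let ?F = "\<Union>i\<in>{i\<in>J. i < N}. cball (a i) (r i)"
        have "closed ?F" by (intro closed_UN) auto
        then have "open (- ?F)" by (rule open_Compl)
        moreover have "x \<in> - ?F" using False by auto
        ultimately obtain d where d: "d > 0" "ball x d \<subseteq> - ?F" by (rule openE)
        \<comment> \<open>A ball around the point that avoids the first balls can only meet, hence be swallowed by the enlargement of, a later one. The radius bound leaves room for the factor five.\<close>
        define \<rho> where "\<rho> = min (d / 2) (\<delta> / 10)"
        have "(x, \<rho>) \<in> ?K" using x d \<delta> by (auto simp: \<rho>_def)
        then obtain c where c: "c \<in> C" "\<not> disjnt (cball x \<rho>) (cball (fst c) (snd c))"
            "cball x \<rho> \<subseteq> ball (fst c) (5 * snd c)"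
          using C(4)[of "(x, \<rho>)"] by auto
        obtain j where j: "j \<in> J" "p j = c"
          using c(1) p by (auto simp: bij_betw_def)
        have "cball x \<rho> \<subseteq> ball x d" using d by (auto simp: \<rho>_def)
        have "\<not> j < N" using c(2)
        proof (rule contrapos_nn)
          assume "j < N"
          then have "cball (fst c) (snd c) \<subseteq> ?F" using j by (auto simp: a_def r_def)
          then show "disjnt (cball x \<rho>) (cball (fst c) (snd c))"
            using d(2) \<open>cball x \<rho> \<subseteq> ball x d\<close> by (auto simp: disjnt_def)
        qed
        moreover have "x \<in> ball (a j) (5 * r j)"
        proof -
          have "x \<in> cball x \<rho>" using d(1) \<delta> by (simp add: \<rho>_def)
          then have "x \<in> ball (fst c) (5 * snd c)" using c(3) by blast
          then show ?thesis using j(2) by (simp add: a_def r_def)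
        qed
        ultimately have "x \<in> E j" using j by (simp add: E_def)
        then show ?thesis by blast
      qed
    qed
    moreover have "diameter (E i) \<le> \<delta>" "bounded (E i)" for i
    proof -
      show "bounded (E i)" by (simp add: E_def)
      show "diameter (E i) \<le> \<delta>"
      proof (cases "i \<in> J")
        case True
        then show ?thesis using J[OF True] \<delta> by (simp add: E_def diameter_cball)
      qed (use \<delta> in \<open>simp add: E_def\<close>)
    qed
    ultimately have "E \<in> hausdorff_covers \<delta> ?S" by (auto simp: hausdorff_covers_def)
    then have "hausdorff_premeasure ?k \<delta> ?S \<le> (\<Sum>i. hausdorff_cost ?k (E i))"
      unfolding hausdorff_premeasure_def by (rule INF_lower)
    also have "\<dots> = (\<Sum>i. hausdorff_cost ?k (E (i + N))) + (\<Sum>i<N. hausdorff_cost ?k (E i))"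
      by (rule suminf_offset) auto
    also have "\<dots> \<le> (\<Sum>i. ennreal (5 ^ ?k) * u (i + N)) + (\<Sum>i<N. u i)"
    proof (intro add_mono suminf_le sum_mono)
      fix i show "hausdorff_cost ?k (E (i + N)) \<le> ennreal (5 ^ ?k) * u (i + N)"
        using cost[of "i + N" 5] by (auto simp: E_def hausdorff_cost_def[of _ "{}"])
    next
      fix i assume "i \<in> {..<N}"
      then show "hausdorff_cost ?k (E i) \<le> u i"
        using cost[of i 1] by (auto simp: E_def hausdorff_cost_def[of _ "{}"])
    qed auto
    also have "\<dots> \<le> ennreal (5 ^ ?k) * (\<Sum>i. u (i + N)) + ?\<kappa> * cone_content ?S"
      by (intro add_mono order_trans[OF sum_le_suminf sum_u]) auto
    finally show ?thesis by (simp add: add.commute)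
  qed
  have "(\<lambda>N. ?\<kappa> * cone_content ?S + ennreal (5 ^ ?k) * (\<Sum>i. u (i + N)))
      \<longlonglongrightarrow> ?\<kappa> * cone_content ?S + ennreal (5 ^ ?k) * 0"
    by (intro tendsto_add tendsto_const tendsto_mult_ennreal ennreal_suminf_tail_tendsto_0 fin) auto
  then show ?thesis
    using bound by (intro LIMSEQ_le_const) auto
qed

text \<open>
  One inequality holds for every Borel subset of the sphere, the opposite one for the whole sphere.
  Both sides are finite and additive, so passing to the complement gives equality everywhere.
\<close>

theorem hausdorff_outer_eq_cone_content:
  fixes A :: "(real^'n) set"
  assumes A[measurable]: "A \<in> sets borel" and sph: "A \<subseteq> sphere 0 1"
  shows "hausdorff_outer (CARD('n) - 1) A = cone_content A"
proof (rule antisym)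
  let ?S = "sphere 0 1 :: (real^'n) set" and ?k = "CARD('n) - 1"
  let ?H = "hausdorff_outer ?k :: (real^'n) set \<Rightarrow> ennreal"
  have [measurable]: "?S \<in> sets borel" by (intro borel_closed) auto
  have S: "?H ?S \<le> cone_content ?S"
    unfolding hausdorff_outer_def
  proof (rule SUP_least)
    fix \<epsilon> :: real assume "\<epsilon> \<in> {0<..}"
    show "hausdorff_premeasure ?k \<epsilon> ?S \<le> cone_content ?S"
    proof (rule tendsto_lowerbound[OF tendsto_distortion])
      show "\<forall>\<^sub>F \<delta> in at_right 0. hausdorff_premeasure ?k \<epsilon> ?S \<le> ennreal (distortion CARD('n) \<delta>) * cone_content ?S"
        unfolding eventually_at_right_field
      proof (intro exI[of _ "min 1 \<epsilon>"] conjI allI impI)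
        fix \<delta> :: real assume "0 < \<delta>" "\<delta> < min 1 \<epsilon>"
        then show "hausdorff_premeasure ?k \<epsilon> ?S \<le> ennreal (distortion CARD('n) \<delta>) * cone_content ?S"
          by (intro order_trans[OF hausdorff_premeasure_antimono hausdorff_premeasure_sphere_le]) auto
      qed (use \<open>\<epsilon> \<in> {0<..}\<close> in auto)
    qed simp
  qed
  have split: "cone_content A + cone_content (?S - A) = cone_content ?S"
  proof -
    have eq: "shell ?S 0 1 = shell A 0 1 \<union> shell (?S - A) 0 1" using sph by (auto simp: shell_def)
    have "emeasure lborel (shell A 0 1) + emeasure lborel (shell (?S - A) 0 1) = emeasure lborel (shell ?S 0 1)"
      unfolding eq by (rule plus_emeasure) (auto simp: shell_def sets_shell[unfolded shell_def])
    then show ?thesis by (simp add: cone_content_def distrib_left[symmetric])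
  qed
  have "?H A + ?H (?S - A) = ?H ?S"
  proof -
    have "emeasure (hausdorff_measure ?k) A + emeasure (hausdorff_measure ?k) (?S - A) = emeasure (hausdorff_measure ?k) (A \<union> (?S - A))"
      by (rule plus_emeasure) auto
    moreover have "A \<union> (?S - A) = ?S" using sph by auto
    ultimately show ?thesis by (simp add: emeasure_hausdorff_measure)
  qed
  have "cone_content (?S - A) + ?H A \<le> ?H (?S - A) + ?H A"
    by (intro add_right_mono cone_content_le_hausdorff_outer) auto
  also have "\<dots> = ?H ?S" by (subst add.commute) fact
  also have "\<dots> \<le> cone_content ?S" by (rule S)
  also have "\<dots> = cone_content (?S - A) + cone_content A" unfolding split[symmetric] by (rule add.commute)
  finally show "?H A \<le> cone_content A"
    using cone_content_finite[of "?S - A"] by (simp add: ennreal_add_left_cancel_le)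
qed (rule cone_content_le_hausdorff_outer[OF assms])

section \<open>Polar coordinates\<close>

lemma borel_measurable_sgn [measurable]: "(sgn :: real^'n \<Rightarrow> _) \<in> borel_measurable borel"
  unfolding sgn_div_norm[abs_def] by measurable

definition sphere_measure :: "(real^'n) measure" where
  "sphere_measure = density (hausdorff_measure (CARD('n) - 1)) (indicator (sphere 0 1))"

lemma sets_sphere_measure [simp, measurable_cong]: "sets (sphere_measure :: (real^'n) measure) = sets borel"
  by (simp add: sphere_measure_def)

lemma space_sphere_measure [simp]: "space (sphere_measure :: (real^'n) measure) = UNIV"
  by (simp add: sphere_measure_def)

lemma emeasure_sphere_measure:
  assumes A[measurable]: "A \<in> sets borel"
  shows "emeasure (sphere_measure :: (real^'n) measure) A = of_nat CARD('n) * emeasure lborel (shell A 0 1)"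
proof -
  have [measurable]: "sphere 0 1 \<in> sets (borel :: (real^'n) measure)" by (intro borel_closed) auto
  have "emeasure sphere_measure A = emeasure (hausdorff_measure (CARD('n) - 1)) (sphere 0 1 \<inter> A)"
    unfolding sphere_measure_def
    by (subst emeasure_density) (auto simp: nn_integral_indicator[symmetric] indicator_inter_arith
        simp del: nn_integral_indicator intro!: nn_integral_cong)
  also have "\<dots> = cone_content (sphere 0 1 \<inter> A)"
  proof -
    have "sphere 0 1 \<inter> A \<in> sets borel" by measurable
    then show ?thesis
      by (subst emeasure_hausdorff_measure) (auto simp del: One_nat_def intro: hausdorff_outer_eq_cone_content)
  qed
  also have "shell (sphere 0 1 \<inter> A) 0 1 = shell A 0 1"
    by (auto simp: shell_def)
  then have "cone_content (sphere 0 1 \<inter> A) = of_nat CARD('n) * emeasure lborel (shell A 0 1)"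
    by (simp add: cone_content_def)
  finally show ?thesis .
qed

lemma emeasure_sphere_measure_finite:
  "A \<in> sets borel \<Longrightarrow> emeasure (sphere_measure :: (real^'n) measure) A \<noteq> \<infinity>"
  using cone_content_finite[of A] by (simp add: emeasure_sphere_measure cone_content_def)

lemma finite_measure_sphere_measure: "finite_measure (sphere_measure :: (real^'n) measure)"
  by (rule finite_measureI) (use emeasure_sphere_measure_finite[of UNIV] in simp)

definition radial_measure :: "nat \<Rightarrow> real measure" where
  "radial_measure n = density lborel (\<lambda>t. ennreal (t ^ (n - 1)) * indicator {0<..} t)"

lemma sets_radial_measure [simp, measurable_cong]: "sets (radial_measure n) = sets borel"
  by (simp add: radial_measure_def)

lemma emeasure_radial_measure_Ioc:
  assumes n: "n > 0" and ab: "0 \<le> a" "a \<le> b"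
  shows "emeasure (radial_measure n) {a<..b} = ennreal ((b ^ n - a ^ n) / n)"
proof -
  have "emeasure (radial_measure n) {a<..b}
      = (\<integral>\<^sup>+t. (ennreal (t ^ (n - 1)) * indicator {0<..} t) * indicator {a<..b} t \<partial>lborel)"
    unfolding radial_measure_def by (subst emeasure_density) auto
  also have "\<dots> = (\<integral>\<^sup>+t. ennreal (t ^ (n - 1)) * indicator {a..b} t \<partial>lborel)"
    using AE_lborel_singleton[of a] ab
    by (intro nn_integral_cong_AE) (auto simp: indicator_def elim!: eventually_mono)
  also have "\<dots> = ennreal (b ^ n / n - a ^ n / n)"
  proof (rule nn_integral_FTC_Icc)
    fix t assume "t \<in> {a..b}"
    then show "0 \<le> t ^ (n - 1)" using ab by simp
    show "DERIV (\<lambda>t. t ^ n / real n) t :> t ^ (n - 1)"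
      using n by (auto intro!: derivative_eq_intros)
  qed (use ab in auto)
  finally show ?thesis by (simp add: diff_divide_distrib)
qed

text \<open>
  For fixed \<open>A\<close> both sides are measures in \<open>B\<close>, and they agree on half-open intervals by the formula
  for the volume of a shell.
\<close>

lemma radial_slice_eq:
  fixes A :: "(real^'n) set"
  assumes A[measurable]: "A \<in> sets borel" and B: "B \<in> sets borel"
  shows "emeasure sphere_measure A * emeasure (radial_measure CARD('n)) B
    = emeasure lborel {x. sgn x \<in> A \<and> norm x \<in> B}"
proof -
  let ?n = "CARD('n)"
  let ?R = "radial_measure ?n" and ?S = "emeasure sphere_measure A"
  have [measurable]: "{x. sgn x \<in> A} \<in> sets borel"
    using measurable_sets[OF borel_measurable_sgn A] by (simp add: vimage_def)
  define N where "N = distr (density lborel (indicator {x. sgn x \<in> A})) borel (norm :: real^'n \<Rightarrow> real)"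
  define N' where "N' = density lborel
      (\<lambda>t. ?S * (ennreal (t ^ (?n - 1)) * indicator {0<..} t))"
  have N: "emeasure N B = emeasure lborel {x. sgn x \<in> A \<and> norm x \<in> B}" if [measurable]: "B \<in> sets borel" for B
  proof -
    have [measurable]: "norm -` B \<in> sets (borel :: (real^'n) measure)"
      using measurable_sets[of norm borel borel B] by simp
    have "emeasure N B = (\<integral>\<^sup>+x. indicator {x. sgn x \<in> A} x * indicator (norm -` B) x \<partial>lborel)"
      unfolding N_def by (simp add: emeasure_distr emeasure_density)
    also have "\<dots> = (\<integral>\<^sup>+x. indicator ({x. sgn x \<in> A} \<inter> norm -` B) x \<partial>lborel)"
      by (simp only: indicator_inter_arith)
    also have "\<dots> = emeasure lborel ({x. sgn x \<in> A} \<inter> norm -` B)" by (rule nn_integral_indicator) measurable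
    also have "{x. sgn x \<in> A} \<inter> norm -` B = {x. sgn x \<in> A \<and> norm x \<in> B}" by auto
    finally show ?thesis .
  qed
  have N': "emeasure N' B = ?S * emeasure (?R) B" if [measurable]: "B \<in> sets borel" for B
    unfolding N'_def radial_measure_def
    by (subst (1 2) emeasure_density) (auto simp: nn_integral_cmult[symmetric] mult.assoc)
  have Ioc: "emeasure N {a<..b} = emeasure N' {a<..b}" for a b
  proof -
    define a' b' where "a' = max 0 a" and "b' = max a' b"
    have ab: "0 \<le> a'" "a' \<le> b'" by (auto simp: a'_def b'_def)
    have "emeasure N {a<..b} = emeasure lborel {x. sgn x \<in> A \<and> norm x \<in> {a<..b}}" by (rule N) simp
    also have "\<dots> = emeasure lborel (shell A a' b')"
    proof (rule emeasure_eq_AE)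
      show "AE x in lborel. (x \<in> {x. sgn x \<in> A \<and> norm x \<in> {a<..b}}) = (x \<in> shell A a' b')"
        using AE_lborel_singleton[of 0]
      proof eventually_elim
        case (elim x)
        then have "0 < norm x" by simp
        then have "norm x \<in> {a<..b} \<longleftrightarrow> a' < norm x \<and> norm x \<le> b'"
          unfolding a'_def b'_def greaterThanAtMost_iff max_less_iff_conj le_max_iff_disj by argo
        then show ?case by (auto simp: shell_def sgn_div_norm)
      qed
      have "norm -` {a<..b} \<in> sets (borel :: (real^'n) measure)"
        using measurable_sets[of norm borel borel "{a<..b}"] by simp
      then have "{x. sgn x \<in> A} \<inter> norm -` {a<..b} \<in> sets borel" by (intro sets.Int) auto
      then show "{x. sgn x \<in> A \<and> norm x \<in> {a<..b}} \<in> sets lborel"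
        by (simp add: Int_def vimage_def)
    qed simp
    also have "\<dots> = ennreal (b' ^ ?n - a' ^ ?n) * emeasure lborel (shell A 0 1)"
      using emeasure_shell[OF A ab] by simp
    also have "\<dots> = (of_nat ?n * emeasure lborel (shell A 0 1)) * ennreal ((b' ^ ?n - a' ^ ?n) / ?n)"
    proof -
      have "ennreal (b' ^ ?n - a' ^ ?n) = ennreal (real ?n * ((b' ^ ?n - a' ^ ?n) / ?n))" by simp
      also have "\<dots> = of_nat ?n * ennreal ((b' ^ ?n - a' ^ ?n) / ?n)"
        using ab by (subst ennreal_mult) (auto simp: ennreal_of_nat_eq_real_of_nat power_mono)
      finally show ?thesis by (simp add: mult_ac)
    qed
    also have "\<dots> = ?S * emeasure (?R) {a'<..b'}"
      using ab by (simp add: emeasure_sphere_measure emeasure_radial_measure_Ioc)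
    also have "emeasure (?R) {a'<..b'} = emeasure (?R) {a<..b}"
      unfolding radial_measure_def
      by (subst (1 2) emeasure_density) (auto simp: a'_def b'_def indicator_def intro!: nn_integral_cong)
    finally show ?thesis by (simp add: N')
  qed
  have "N = N'"
  proof (rule measure_eqI_generator_eq[where \<Omega> = UNIV and E = "range (\<lambda>(a, b). {a<..b::real})"
        and A = "\<lambda>i. {- real i<..real i}"])
    show "Int_stable (range (\<lambda>(a, b). {a<..b::real}))"
    proof (rule Int_stableI_image)
      fix i j :: "real \<times> real"
      show "\<exists>k\<in>UNIV. (case i of (a, b) \<Rightarrow> {a<..b}) \<inter> (case j of (a, b) \<Rightarrow> {a<..b}) = (case k of (a, b) \<Rightarrow> {a<..b})"
        by (intro bexI[of _ "(max (fst i) (fst j), min (snd i) (snd j))"]) (auto simp: case_prod_unfold)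
    qed
    show "sets N = sigma_sets UNIV (range (\<lambda>(a, b). {a<..b::real}))"
      by (simp add: N_def borel_sigma_sets_Ioc)
    show "sets N' = sigma_sets UNIV (range (\<lambda>(a, b). {a<..b::real}))"
      by (simp add: N'_def borel_sigma_sets_Ioc)
    show "(\<Union>i. {- real i<..real i}) = UNIV"
    proof -
      have "\<exists>i. - real i < x \<and> x \<le> real i" for x
      proof -
        obtain i where "\<bar>x\<bar> < real i" using reals_Archimedean2 by blast
        then show ?thesis by (intro exI[of _ i]) linarith
      qed
      then show ?thesis by auto
    qed
    fix i :: nat
    have "emeasure (?R) {- real i<..real i} \<le> emeasure (?R) {0<..real i}"
      unfolding radial_measure_def
      by (subst (1 2) emeasure_density) (auto simp: indicator_def intro!: nn_integral_mono)
    also have "\<dots> < \<infinity>" by (subst emeasure_radial_measure_Ioc) auto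
    finally show "emeasure N {- real i<..real i} \<noteq> \<infinity>"
      using emeasure_sphere_measure_finite[OF A]
      by (simp add: Ioc N' ennreal_mult_eq_top_iff)
  qed (auto simp: Ioc)
  then show ?thesis using N[OF B] N'[OF B] by simp
qed

lemma sigma_finite_radial_measure: "n > 0 \<Longrightarrow> sigma_finite_measure (radial_measure n)"
  unfolding radial_measure_def
  by (subst sigma_finite_measure.sigma_finite_iff_density_finite[OF lborel.sigma_finite_measure_axioms]) (auto simp: indicator_def)

lemma polar_coordinates_measure:
  "sphere_measure \<Otimes>\<^sub>M radial_measure CARD('n)
     = distr lborel (borel \<Otimes>\<^sub>M borel) (\<lambda>x :: real^'n. (sgn x, norm x))"
proof -
  interpret S: finite_measure "sphere_measure :: (real^'n) measure" by (rule finite_measure_sphere_measure)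
  interpret R: sigma_finite_measure "radial_measure CARD('n)" by (rule sigma_finite_radial_measure) simp
  show ?thesis
  proof (rule pair_measure_eqI[OF S.sigma_finite_measure_axioms R.sigma_finite_measure_axioms])
    show "sets (sphere_measure \<Otimes>\<^sub>M radial_measure CARD('n)) =
      sets (distr lborel (borel \<Otimes>\<^sub>M borel) (\<lambda>x :: real^'n. (sgn x, norm x)))"
      by (simp cong: sets_pair_measure_cong)
    fix A :: "(real^'n) set" and B :: "real set"
    assume "A \<in> sets sphere_measure" "B \<in> sets (radial_measure CARD('n))"
    then have [measurable]: "A \<in> sets borel" "B \<in> sets borel" by auto
    have "emeasure (distr lborel (borel \<Otimes>\<^sub>M borel) (\<lambda>x :: real^'n. (sgn x, norm x))) (A \<times> B)
       = emeasure lborel {x. sgn x \<in> A \<and> norm x \<in> B}"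
      by (subst emeasure_distr) (auto intro!: arg_cong[where f = "emeasure lborel"])
    then show "emeasure sphere_measure A * emeasure (radial_measure CARD('n)) B
      = emeasure (distr lborel (borel \<Otimes>\<^sub>M borel) (\<lambda>x :: real^'n. (sgn x, norm x))) (A \<times> B)"
      by (simp add: radial_slice_eq)
  qed
qed

lemma nn_integral_polar:
  fixes h :: "real^'n \<Rightarrow> ennreal"
  assumes [measurable]: "h \<in> borel_measurable borel"
  shows "(\<integral>\<^sup>+x. h x \<partial>lborel)
    = (\<integral>\<^sup>+\<xi>. (\<integral>\<^sup>+t. ennreal (t ^ (CARD('n) - 1)) * indicator {0<..} t * h (t *\<^sub>R \<xi>) \<partial>lborel) \<partial>sphere_measure)"
proof -
  interpret R: sigma_finite_measure "radial_measure CARD('n)" by (rule sigma_finite_radial_measure) simp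
  have "(\<integral>\<^sup>+x. h x \<partial>lborel) = (\<integral>\<^sup>+x. (\<lambda>p. h (snd p *\<^sub>R fst p)) (sgn x, norm x) \<partial>lborel)"
  proof (intro nn_integral_cong)
    fix x :: "real^'n"
    show "h x = (\<lambda>p. h (snd p *\<^sub>R fst p)) (sgn x, norm x)"
      by (cases "x = 0") (simp_all add: sgn_div_norm)
  qed
  also have "\<dots> = (\<integral>\<^sup>+p. h (snd p *\<^sub>R fst p) \<partial>distr lborel (borel \<Otimes>\<^sub>M borel) (\<lambda>x :: real^'n. (sgn x, norm x)))"
    by (rule nn_integral_distr[symmetric]) measurable
  also have "\<dots> = (\<integral>\<^sup>+p. h (snd p *\<^sub>R fst p) \<partial>(sphere_measure \<Otimes>\<^sub>M radial_measure CARD('n)))"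
    by (simp only: polar_coordinates_measure)
  also have "\<dots> = (\<integral>\<^sup>+\<xi>. (\<integral>\<^sup>+t. h (t *\<^sub>R \<xi>) \<partial>radial_measure CARD('n)) \<partial>sphere_measure)"
    by (subst R.nn_integral_fst[symmetric]) auto
  also have "\<dots> = (\<integral>\<^sup>+\<xi>. (\<integral>\<^sup>+t. ennreal (t ^ (CARD('n) - 1)) * indicator {0<..} t * h (t *\<^sub>R \<xi>) \<partial>lborel) \<partial>sphere_measure)"
    unfolding radial_measure_def by (intro nn_integral_cong, subst nn_integral_density) auto
  finally show ?thesis .
qed

text \<open>
  The substitution \<open>t = 1 + \<epsilon> s\<close> in the radius. For a nonnegative function it can be carried out on
  the level of nonnegative integrals, so that no integrability is needed.
\<close>

lemma integral_polar_affine: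
  fixes \<phi> :: "real^'n \<Rightarrow> real"
  assumes [measurable]: "\<phi> \<in> borel_measurable borel" and nonneg: "\<And>x. 0 \<le> \<phi> x" and \<epsilon>: "0 < \<epsilon>"
  shows "(LINT x|lborel. \<phi> x) = \<epsilon> * (LINT p|(sphere_measure \<Otimes>\<^sub>M lborel).
      (1 + \<epsilon> * snd p) ^ (CARD('n) - 1) * indicator {0<..} (1 + \<epsilon> * snd p) * \<phi> ((1 + \<epsilon> * snd p) *\<^sub>R fst p))"
proof -
  let ?m = "CARD('n) - 1"
  let ?u = "\<lambda>\<xi>. \<integral>\<^sup>+t. ennreal (t ^ ?m) * indicator {0<..} t * ennreal (\<phi> (t *\<^sub>R \<xi>)) \<partial>lborel"
  let ?w = "\<lambda>\<xi> s. (1 + \<epsilon> * s) ^ ?m * indicator {0<..} (1 + \<epsilon> * s) * \<phi> ((1 + \<epsilon> * s) *\<^sub>R \<xi>)"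
  have w0: "0 \<le> ?w \<xi> s" for \<xi> s by (auto simp: indicator_def nonneg)
  have "(\<integral>\<^sup>+x. ennreal (\<phi> x) \<partial>lborel)
    = (\<integral>\<^sup>+\<xi>. ?u \<xi> \<partial>sphere_measure)"
    by (rule nn_integral_polar) measurable
  also have "\<dots> = (\<integral>\<^sup>+\<xi>. ennreal \<epsilon> * (\<integral>\<^sup>+s. ennreal (?w \<xi> s) \<partial>lborel) \<partial>sphere_measure)"
  proof (intro nn_integral_cong)
    fix \<xi> :: "real^'n"
    have "?u \<xi>
       = ennreal \<bar>\<epsilon>\<bar> * (\<integral>\<^sup>+s. ennreal ((1 + \<epsilon> * s) ^ ?m) * indicator {0<..} (1 + \<epsilon> * s) * ennreal (\<phi> ((1 + \<epsilon> * s) *\<^sub>R \<xi>)) \<partial>lborel)"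
      using \<epsilon> by (subst nn_integral_real_affine[where c = \<epsilon> and t = 1]) auto
    also have "(\<integral>\<^sup>+s. ennreal ((1 + \<epsilon> * s) ^ ?m) * indicator {0<..} (1 + \<epsilon> * s) * ennreal (\<phi> ((1 + \<epsilon> * s) *\<^sub>R \<xi>)) \<partial>lborel)
       = (\<integral>\<^sup>+s. ennreal (?w \<xi> s) \<partial>lborel)"
      by (intro nn_integral_cong) (auto simp: indicator_def ennreal_mult nonneg)
    finally show "?u \<xi>
       = ennreal \<epsilon> * (\<integral>\<^sup>+s. ennreal (?w \<xi> s) \<partial>lborel)" using \<epsilon> by simp
  qed
  also have "\<dots> = ennreal \<epsilon> * (\<integral>\<^sup>+\<xi>. (\<integral>\<^sup>+s. ennreal (?w \<xi> s) \<partial>lborel) \<partial>sphere_measure)"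
    by (rule nn_integral_cmult) measurable
  also have "(\<integral>\<^sup>+\<xi>. (\<integral>\<^sup>+s. ennreal (?w \<xi> s) \<partial>lborel) \<partial>sphere_measure)
      = (\<integral>\<^sup>+p. ennreal (?w (fst p) (snd p)) \<partial>(sphere_measure \<Otimes>\<^sub>M lborel))"
    by (subst lborel.nn_integral_fst[symmetric]) auto
  finally have eq: "(\<integral>\<^sup>+x. ennreal (\<phi> x) \<partial>lborel)
      = ennreal \<epsilon> * (\<integral>\<^sup>+p. ennreal (?w (fst p) (snd p)) \<partial>(sphere_measure \<Otimes>\<^sub>M lborel))" .
  have "(LINT x|lborel. \<phi> x) = enn2real (\<integral>\<^sup>+x. ennreal (\<phi> x) \<partial>lborel)"
    using nonneg by (intro integral_eq_nn_integral) auto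
  also have "\<dots> = \<epsilon> * enn2real (\<integral>\<^sup>+p. ennreal (?w (fst p) (snd p)) \<partial>(sphere_measure \<Otimes>\<^sub>M lborel))"
    using \<epsilon> by (simp add: eq enn2real_mult)
  also have "enn2real (\<integral>\<^sup>+p. ennreal (?w (fst p) (snd p)) \<partial>(sphere_measure \<Otimes>\<^sub>M lborel))
      = (LINT p|(sphere_measure \<Otimes>\<^sub>M lborel). ?w (fst p) (snd p))"
    using w0 by (intro integral_eq_nn_integral[symmetric]) auto
  finally show ?thesis .
qed

section \<open>The Loewner position\<close>

text \<open>
  The square of the factor is \<open>q (1 + c / n)\<^sup>n\<close> with \<open>q = 1 - 2 c\<close>. This is at most
  \<open>exp (- 2 c) exp c < 1\<close>.
\<close>

lemma ellipsoid_volume_factor_less_1: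
  fixes n :: nat
  assumes n: "n > 0"
  defines "c \<equiv> 1 / (real n + 2)"
  shows "(1 - c) * ((1 - c) / sqrt (1 - 2 * c)) ^ (n - 1) < 1"
proof -
  let ?N = "real n"
  define q where "q = 1 - 2 * c"
  have q: "q = ?N / (?N + 2)" "q > 0" using n by (auto simp: q_def c_def field_simps)
  have c: "0 < c" "c < 1" using n by (auto simp: c_def field_simps)
  have a2: "(1 - c)\<^sup>2 = q + c\<^sup>2" by (simp add: q_def power2_eq_square algebra_simps)
  have ratio: "(1 - c)\<^sup>2 / q = 1 + c / ?N"
  proof -
    have "q = ?N * c" by (simp add: q(1) c_def)
    then have "c\<^sup>2 / q = c / ?N" using c by (simp add: power2_eq_square)
    then show ?thesis using q(2) by (simp add: a2 add_divide_distrib)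
  qed
  let ?v = "(1 - c) * ((1 - c) / sqrt q) ^ (n - 1)"
  have "?v\<^sup>2 = (1 - c)\<^sup>2 * (((1 - c) / sqrt q)\<^sup>2) ^ (n - 1)"
    unfolding power2_eq_square power_mult_distrib by (simp only: mult_ac)
  also have "((1 - c) / sqrt q)\<^sup>2 = (1 - c)\<^sup>2 / q"
    using q(2) by (simp add: power_divide)
  also have "(1 - c)\<^sup>2 * ((1 - c)\<^sup>2 / q) ^ (n - 1) = q * ((1 - c)\<^sup>2 / q) ^ Suc (n - 1)"
    using q(2) by simp
  also have "\<dots> = q * (1 + c / ?N) ^ n" using n by (simp add: ratio)
  also have "\<dots> \<le> exp (- 2 * c) * exp (c / ?N) ^ n"
    using c n q exp_ge_add_one_self[of "- 2 * c"] exp_ge_add_one_self[of "c / ?N"]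
    by (intro mult_mono power_mono) (auto simp: q_def)
  also have "\<dots> = exp (- c)"
    using n by (simp add: exp_of_nat_mult[symmetric] exp_add[symmetric])
  also have "\<dots> < 1" using c by simp
  finally have "?v\<^sup>2 < 1\<^sup>2" by simp
  then show ?thesis unfolding q_def by (rule power2_less_imp_less) simp
qed

text \<open>
  The ellipsoid with centre \<open>c e\<close>, semi-axis \<open>\<alpha>\<close> along \<open>e\<close> and semi-axes \<open>\<beta>\<close> orthogonal to \<open>e\<close>.
\<close>

lemma measure_ellipsoid_cap:
  fixes e :: "real^'n"
  assumes e: "norm e = 1" and \<alpha>: "0 < \<alpha>" and \<beta>: "0 < \<beta>"
  shows "\<exists>E. ellipsoid E \<and> measure lebesgue E = \<alpha> * \<beta> ^ (CARD('n) - 1) * measure lebesgue (cball (0::real^'n) 1)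
    \<and> {x. (norm (x - (x \<bullet> e) *\<^sub>R e))\<^sup>2 / \<beta>\<^sup>2 + (x \<bullet> e - c)\<^sup>2 / \<alpha>\<^sup>2 \<le> 1} \<subseteq> E"
proof -
  obtain e0 :: "real^'n" where e0: "e0 \<in> Basis" using nonempty_Basis by blast
  have e00: "e0 \<bullet> e0 = 1" using e0 by simp
  obtain U where U: "orthogonal_transformation U" "U e0 = e"
    using orthogonal_transformation_exists_1[of e0 e] e e0 by auto
  have inner: "U x \<bullet> U y = x \<bullet> y" for x y
    using U(1) by (simp add: orthogonal_transformation_def)
  have linU: "linear U" using U(1) by (simp add: orthogonal_transformation_linear)
  define D where "D y = \<beta> *\<^sub>R y + ((\<alpha> - \<beta>) * (y \<bullet> e0)) *\<^sub>R e0" for y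
  have linD: "linear D"
    by (rule linearI) (simp_all add: D_def inner_add_left algebra_simps)
  have D_inner: "D y \<bullet> b = (if b = e0 then \<alpha> else \<beta>) * (y \<bullet> b)" if "b \<in> Basis" for y b
    using that e0 by (auto simp: D_def inner_add_left inner_Basis algebra_simps)
  have D_sum: "D y = 0 + (\<Sum>j\<in>Basis. ((if j = e0 then \<alpha> else \<beta>) * (y \<bullet> j)) *\<^sub>R j)" for y
  proof (rule euclidean_eqI)
    fix b :: "real^'n" assume b: "b \<in> Basis"
    then show "D y \<bullet> b = (0 + (\<Sum>j\<in>Basis. ((if j = e0 then \<alpha> else \<beta>) * (y \<bullet> j)) *\<^sub>R j)) \<bullet> b"
      by (simp add: D_inner inner_sum_left_Basis)
  qed
  have injD: "inj D"
    unfolding linear_injective_0[OF linD]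
  proof (intro allI impI)
    fix y assume "D y = 0"
    show "y = 0"
    proof (rule euclidean_eqI)
      fix b :: "real^'n" assume "b \<in> Basis"
      then have "(if b = e0 then \<alpha> else \<beta>) * (y \<bullet> b) = 0"
        using D_inner[of b y] \<open>D y = 0\<close> by simp
      then show "y \<bullet> b = 0 \<bullet> b" using \<alpha> \<beta> by (simp split: if_splits)
    qed
  qed
  define A where "A = matrix (U \<circ> D)"
  have linUD: "linear (U \<circ> D)" by (rule linear_compose[OF linD linU])
  have Av: "A *v x = U (D x)" for x
    using matrix_vector_mul(2)[OF linUD] by (simp add: A_def fun_eq_iff)
  have "inj ((*v) A)"
    using inj_compose[OF orthogonal_transformation_inj[OF U(1)] injD]
    by (simp add: Av[abs_def] comp_def)
  then have inv: "invertible A"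
    by (simp add: invertible_left_inverse matrix_left_invertible_injective)
  define E where "E = (\<lambda>x. c *\<^sub>R e + A *v x) ` cball 0 1"
  have "ellipsoid E" unfolding ellipsoid_def E_def using inv by blast
  have compact: "compact (f ` S)" if "linear f" "compact S" for f :: "real^'n \<Rightarrow> real^'n" and S
    using that by (intro compact_continuous_image linear_continuous_on linear_conv_bounded_linear[THEN iffD1])
  have closedD: "D ` cball 0 1 \<in> sets borel"
    by (intro borel_closed compact_imp_closed compact linD) simp
  have UD: "U ` D ` cball 0 1 \<in> sets borel"
    by (intro borel_closed compact_imp_closed compact linD linU) simp
  have E: "E = (+) (c *\<^sub>R e) ` U ` D ` cball 0 1"
    by (simp add: E_def Av image_image)
  have "emeasure lborel E = emeasure lborel (U ` D ` cball 0 1)"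
    unfolding E by (rule emeasure_lborel_translate[OF UD])
  also have "\<dots> = emeasure lborel (D ` cball 0 1)"
    using emeasure_lborel_orthogonal_vimage[OF U(1) UD]
    by (simp add: inj_vimage_image_eq[OF orthogonal_transformation_inj[OF U(1)]])
  also have "\<dots> = ennreal (\<alpha> * \<beta> ^ (CARD('n) - 1)) * emeasure lborel (cball (0::real^'n) 1)"
  proof -
    let ?c = "\<lambda>j. if j = e0 then \<alpha> else \<beta>"
    have "(lborel :: (real^'n) measure) = density (distr lborel borel D) (\<lambda>_. (\<Prod>j\<in>Basis. \<bar>?c j\<bar>))"
      unfolding D_sum[abs_def] by (rule lborel_affine_euclidean) (use \<alpha> \<beta> in auto)
    moreover have "(\<Prod>j\<in>Basis. \<bar>?c j\<bar>) = \<alpha> * \<beta> ^ (CARD('n) - 1)"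
    proof -
      have "(\<Prod>j\<in>Basis. \<bar>?c j\<bar>) = \<bar>?c e0\<bar> * (\<Prod>j\<in>Basis - {e0}. \<bar>?c j\<bar>)"
        by (rule prod.remove) (use e0 in auto)
      also have "(\<Prod>j\<in>Basis - {e0}. \<bar>?c j\<bar>) = (\<Prod>j\<in>Basis - {e0}. \<beta>)"
        using \<beta> by (intro prod.cong) auto
      also have "\<dots> = \<beta> ^ (CARD('n) - 1)"
        using e0 by (simp add: prod_constant)
      finally show ?thesis using \<alpha> by simp
    qed
    ultimately have lb: "(lborel :: (real^'n) measure) = density (distr lborel borel D) (\<lambda>_. ennreal (\<alpha> * \<beta> ^ (CARD('n) - 1)))"
      by simp
    have [measurable]: "D \<in> borel_measurable borel"
      using linD by (intro borel_measurable_continuous_onI linear_continuous_on linear_conv_bounded_linear[THEN iffD1])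
    have "emeasure lborel (D ` cball 0 1) = ennreal (\<alpha> * \<beta> ^ (CARD('n) - 1)) * emeasure (distr lborel borel D) (D ` cball 0 1)"
      using closedD by (subst lb) (simp add: emeasure_density nn_integral_cmult_indicator)
    also have "emeasure (distr lborel borel D) (D ` cball 0 1) = emeasure lborel (cball (0::real^'n) 1)"
      using closedD by (subst emeasure_distr) (auto simp: inj_vimage_image_eq[OF injD])
    finally show ?thesis .
  qed
  finally have em: "emeasure lborel E = ennreal (\<alpha> * \<beta> ^ (CARD('n) - 1)) * emeasure lborel (cball (0::real^'n) 1)" .
  have Eb: "E \<in> sets borel" unfolding E by (rule sets_borel_translate[OF UD])
  have "measure lebesgue E = measure lborel E"
    using Eb by (simp add: measure_completion)
  also have "\<dots> = \<alpha> * \<beta> ^ (CARD('n) - 1) * measure lborel (cball (0::real^'n) 1)"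
    using \<alpha> \<beta> by (simp add: measure_def em enn2real_mult)
  also have "measure lborel (cball (0::real^'n) 1) = measure lebesgue (cball (0::real^'n) 1)"
    by (simp add: measure_completion)
  finally have vol: "measure lebesgue E = \<alpha> * \<beta> ^ (CARD('n) - 1) * measure lebesgue (cball (0::real^'n) 1)" .
  have "x \<in> E" if x: "(norm (x - (x \<bullet> e) *\<^sub>R e))\<^sup>2 / \<beta>\<^sup>2 + (x \<bullet> e - c)\<^sup>2 / \<alpha>\<^sup>2 \<le> 1" for x
  proof -
    obtain z where z: "x = U z"
      using orthogonal_transformation_surj[OF U(1)] by (metis surjD)
    define t where "t = z \<bullet> e0"
    have xe: "x \<bullet> e = t" using inner[of z e0] U(2) by (simp add: z t_def)
    define p where "p = z - t *\<^sub>R e0"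
    have pe: "p \<bullet> e0 = 0" by (simp add: p_def inner_diff_left t_def e00)
    have "x - (x \<bullet> e) *\<^sub>R e = U p"
      unfolding xe using U(2) by (simp add: p_def z linear_diff[OF linU] linear_scale[OF linU])
    then have np: "norm (x - (x \<bullet> e) *\<^sub>R e) = norm p"
      using orthogonal_transformation_norm[OF U(1)] by simp
    define y where "y = (1 / \<beta>) *\<^sub>R p + ((t - c) / \<alpha>) *\<^sub>R e0"
    have ye: "y \<bullet> e0 = (t - c) / \<alpha>" by (simp add: y_def inner_add_left pe e00)
    have "(norm y)\<^sup>2 = (norm p)\<^sup>2 / \<beta>\<^sup>2 + (t - c)\<^sup>2 / \<alpha>\<^sup>2"
      unfolding power2_norm_eq_inner
      by (simp add: y_def inner_add_left inner_add_right pe inner_commute[of e0 p] e00 power2_eq_square)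
    also have "\<dots> \<le> 1" using x unfolding np unfolding xe .
    finally have "norm y \<le> 1" by (simp add: power_le_one_iff)
    moreover have "c *\<^sub>R e + A *v y = x"
    proof -
      have "D y = p + (t - c) *\<^sub>R e0"
      proof -
        have "D y = \<beta> *\<^sub>R y + ((\<alpha> - \<beta>) * ((t - c) / \<alpha>)) *\<^sub>R e0" by (simp add: D_def ye)
        also have "\<dots> = p + (\<beta> * ((t - c) / \<alpha>) + (\<alpha> - \<beta>) * ((t - c) / \<alpha>)) *\<^sub>R e0"
          using \<beta> by (simp add: y_def scaleR_add_right scaleR_add_left)
        also have "\<beta> * ((t - c) / \<alpha>) + (\<alpha> - \<beta>) * ((t - c) / \<alpha>) = t - c"
          using \<alpha> by (simp add: field_simps)
        finally show ?thesis .
      qed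
      then have "A *v y = U p + (t - c) *\<^sub>R e"
        by (simp add: Av linear_add[OF linU] linear_scale[OF linU] U(2))
      moreover have "x = U p + t *\<^sub>R e"
        by (simp add: p_def z linear_diff[OF linU] linear_scale[OF linU] U(2))
      ultimately show ?thesis by (simp add: algebra_simps)
    qed
    ultimately show "x \<in> E" unfolding E_def by (intro image_eqI[of _ _ y]) auto
  qed
  with \<open>ellipsoid E\<close> vol show ?thesis by blast
qed

lemma loewner_position_subset: "loewner_position K \<Longrightarrow> K \<subseteq> cball 0 1"
  by (simp add: loewner_position_def is_arg_min_def)

text \<open>
  If \<open>0\<close> were not an interior point, the body would lie in a half ball. Moving the centre of the
  ball by \<open>c\<close> towards that half, shrinking the axis in this direction to \<open>1 - c\<close> and enlarging the
  others just enough to keep the equator covered gives an ellipsoid which contains the half ball. The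
  enlargement is of second order in \<open>c\<close>, so for small \<open>c\<close> the volume decreases.
\<close>

lemma loewner_position_zero_interior:
  fixes K :: "(real^'n) set"
  assumes body: "convex_body K" and loewner: "loewner_position K"
  shows "0 \<in> interior K"
proof (rule ccontr)
  assume "0 \<notin> interior K"
  moreover have cK: "convex K" "compact K" "interior K \<noteq> {}" using body by (auto simp: convex_body_def)
  ultimately obtain u where u: "u \<noteq> 0" "\<And>x. x \<in> interior K \<Longrightarrow> 0 \<le> u \<bullet> x"
    using separating_hyperplane_set_0[of "interior K"] by (auto simp: convex_interior)
  have "K \<subseteq> closure (interior K)"
    using convex_closure_interior[OF cK(1,3)] closure_subset by auto
  also have "\<dots> \<subseteq> {x. 0 \<le> u \<bullet> x}"
    by (rule closure_minimal) (use u(2) in \<open>auto simp: closed_halfspace_ge\<close>)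
  finally have K_half: "\<And>x. x \<in> K \<Longrightarrow> 0 \<le> u \<bullet> x" by auto
  define e where "e = u /\<^sub>R norm u"
  have e1: "norm e = 1" using u(1) by (simp add: e_def)
  then have ee: "e \<bullet> e = 1" by (simp only: norm_eq_1)
  define c where "c = 1 / (real CARD('n) + 2)"
  define q where "q = 1 - 2 * c"
  define \<beta> where "\<beta> = (1 - c) / sqrt q"
  have "real CARD('n) > 0" by simp
  then have c: "0 < c" "c < 1 / 2" unfolding c_def by (auto simp: field_simps simp del: of_nat_0_less_iff zero_less_card_finite)
  then have q: "q > 0" by (simp add: q_def)
  have \<beta>: "\<beta> > 0" "\<beta>\<^sup>2 = (1 - c)\<^sup>2 / q" using c q by (auto simp: \<beta>_def power_divide)
  obtain E where E: "ellipsoid E"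
      "measure lebesgue E = (1 - c) * \<beta> ^ (CARD('n) - 1) * measure lebesgue (cball (0::real^'n) 1)"
      "{x. (norm (x - (x \<bullet> e) *\<^sub>R e))\<^sup>2 / \<beta>\<^sup>2 + (x \<bullet> e - c)\<^sup>2 / (1 - c)\<^sup>2 \<le> 1} \<subseteq> E"
    using measure_ellipsoid_cap[OF e1, of "1 - c" \<beta> c] c \<beta> by auto
  have "K \<subseteq> E"
  proof
    fix x assume x: "x \<in> K"
    define t where "t = x \<bullet> e"
    have "norm x \<le> 1" using loewner_position_subset[OF loewner] x by auto
    then have nx: "(norm x)\<^sup>2 \<le> 1" by (simp add: power_le_one)
    have t0: "0 \<le> t" using K_half[OF x] by (simp add: t_def e_def inner_commute)
    have t1: "t \<le> 1" using norm_cauchy_schwarz[of x e] e1 \<open>norm x \<le> 1\<close> by (simp add: t_def)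
    have "(norm (x - t *\<^sub>R e))\<^sup>2 = (norm x)\<^sup>2 - t\<^sup>2"
      unfolding power2_norm_eq_inner
      by (simp add: inner_diff_left inner_diff_right inner_commute[of e x] ee t_def[symmetric] power2_eq_square)
    then have "(norm (x - t *\<^sub>R e))\<^sup>2 * q + (t - c)\<^sup>2 \<le> (1 - t\<^sup>2) * q + (t - c)\<^sup>2"
      using nx q by (intro add_right_mono mult_right_mono) auto
    also have "\<dots> = (1 - c)\<^sup>2 - 2 * c * (t * (1 - t))"
      by (simp add: q_def power2_eq_square algebra_simps)
    also have "\<dots> \<le> (1 - c)\<^sup>2" using c t0 t1 by simp
    finally have "((norm (x - t *\<^sub>R e))\<^sup>2 * q + (t - c)\<^sup>2) / (1 - c)\<^sup>2 \<le> 1"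
      using c by (subst divide_le_eq_1_pos) auto
    then have "(norm (x - t *\<^sub>R e))\<^sup>2 / \<beta>\<^sup>2 + (t - c)\<^sup>2 / (1 - c)\<^sup>2 \<le> 1"
      by (simp add: \<beta>(2) add_divide_distrib)
    then show "x \<in> E" using E(3) by (auto simp: t_def)
  qed
  moreover have "measure lebesgue E < measure lebesgue (cball (0::real^'n) 1)"
  proof -
    have "(1 - c) * \<beta> ^ (CARD('n) - 1) < 1"
      using ellipsoid_volume_factor_less_1[of "CARD('n)"] by (simp add: c_def \<beta>_def q_def)
    moreover have "0 < measure lebesgue (cball (0::real^'n) 1)"
      by (simp add: measure_completion content_cball unit_ball_vol_pos)
    ultimately show ?thesis unfolding E(2) by (simp add: mult_less_cancel_right1)
  qed
  ultimately show False
    using loewner E(1) by (auto simp: loewner_position_def is_arg_min_def)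
qed

section \<open>The convolution of the two profiles\<close>

lemma integrable_bounded_support:
  fixes \<phi> :: "real \<Rightarrow> real"
  assumes [measurable]: "\<phi> \<in> borel_measurable borel"
    and bound: "\<And>t. a \<le> t \<Longrightarrow> t \<le> b \<Longrightarrow> \<bar>\<phi> t\<bar> \<le> c" and zero: "\<And>t. t < a \<or> b < t \<Longrightarrow> \<phi> t = 0"
  shows "integrable lborel \<phi>"
proof (rule Bochner_Integration.integrable_bound)
  show "integrable lborel (\<lambda>t. c * indicator {a..b} t)"
    by (intro integrable_mult_right) (simp add: integrable_indicator_iff emeasure_lborel_Icc_eq)
  show "AE t in lborel. norm (\<phi> t) \<le> norm (c * indicator {a..b} t)"
    using bound zero by (intro AE_I2) (force simp: indicator_def not_le)
qed simp

lemma integral_pos_of_continuous: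
  fixes \<phi> :: "real \<Rightarrow> real"
  assumes cont: "continuous_on UNIV \<phi>" and int: "integrable lborel \<phi>"
    and nonneg: "\<And>t. 0 \<le> \<phi> t" and pos: "0 < \<phi> t0"
  shows "0 < (LINT t|lborel. \<phi> t)"
proof -
  have "isCont \<phi> t0" using cont by (simp add: continuous_on_eq_continuous_at)
  then obtain d where d: "d > 0" "\<And>t. \<bar>t - t0\<bar> < d \<Longrightarrow> \<bar>\<phi> t - \<phi> t0\<bar> < \<phi> t0 / 2"
    using pos unfolding continuous_at_eps_delta dist_real_def
    by (metis half_gt_zero)
  have "0 < d * (\<phi> t0 / 2)" using d pos by simp
  also have "d * (\<phi> t0 / 2) = (LINT t|lborel. (\<phi> t0 / 2) * indicator {t0..t0 + d / 2} t) * 2"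
    using d by simp
  also have "\<dots> \<le> (LINT t|lborel. \<phi> t) * 2"
  proof (intro mult_right_mono integral_mono int)
    fix t
    show "\<phi> t0 / 2 * indicator {t0..t0 + d / 2} t \<le> \<phi> t"
    proof (cases "t \<in> {t0..t0 + d / 2}")
      case True
      then have "\<bar>\<phi> t - \<phi> t0\<bar> < \<phi> t0 / 2" using d(1) by (intro d(2)) auto
      then have "\<phi> t0 / 2 \<le> \<phi> t" by linarith
      then show ?thesis using True by simp
    qed (use nonneg[of t] in simp)
  qed (auto simp: integrable_indicator_iff emeasure_lborel_Icc_eq intro!: integrable_mult_right)
  finally show ?thesis by simp
qed

lemma locally_Lipschitz_imp_continuous:
  assumes "locally_Lipschitz f"
  shows "continuous_on UNIV f"
proof -
  have "isCont f x" for x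
  proof -
    obtain u L where u: "u > 0" "L-lipschitz_on (cball x u) f"
      using assms unfolding locally_Lipschitz_def by blast
    then have "continuous_on (cball x u) f" by (intro lipschitz_on_continuous_on)
    then show ?thesis
      using u by (intro continuous_on_interior[of "cball x u"]) auto
  qed
  then show ?thesis by (simp add: continuous_at_imp_continuous_on)
qed

locale profiles =
  fixes f g :: "real \<Rightarrow> real"
  assumes f_lip: "locally_Lipschitz f" and f_convex: "convex_on UNIV f"
    and f_zero: "\<And>x. x \<le> -1 \<Longrightarrow> f x = 0" and f_strict: "strict_mono_on {-1..} f"
    and g_lip: "locally_Lipschitz g" and g_antimono: "antimono g"
    and g_one: "\<And>x. x \<le> -1 \<Longrightarrow> g x = 1" and g_pos: "\<And>x. -1 < x \<Longrightarrow> x < 1 \<Longrightarrow> 0 < g x"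
    and g_zero: "\<And>x. 1 \<le> x \<Longrightarrow> g x = 0"
begin

lemma f_cont: "continuous_on UNIV f" and g_cont: "continuous_on UNIV g"
  using f_lip g_lip by (auto intro: locally_Lipschitz_imp_continuous)

lemma f_borel [measurable]: "f \<in> borel_measurable borel"
  and g_borel [measurable]: "g \<in> borel_measurable borel"
  using f_cont g_cont by (auto intro: borel_measurable_continuous_onI)

lemma f_pos: "-1 < x \<Longrightarrow> 0 < f x"
  using strict_mono_onD[OF f_strict, of "-1" x] f_zero[of "-1"] by simp

lemma f_nonneg: "0 \<le> f x"
  using f_pos[of x] f_zero[of x] by (cases "x \<le> -1") auto

lemma f_mono: "x \<le> y \<Longrightarrow> f x \<le> f y"
proof -
  assume xy: "x \<le> y"
  show ?thesis
  proof (cases "x \<le> -1")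
    case True
    then show ?thesis using f_zero[of x] f_nonneg[of y] by simp
  next
    case False
    then show ?thesis
      using xy f_strict by (cases "x = y") (auto simp: strict_mono_on_def intro!: less_imp_le)
  qed
qed

lemma g_mono: "x \<le> y \<Longrightarrow> g y \<le> g x"
  using g_antimono by (simp add: antimono_def)

lemma g_nonneg: "0 \<le> g x" and g_le_1: "g x \<le> 1"
  using g_mono[of x "max x 1"] g_mono[of "min x (-1)" x] by (auto simp: g_zero g_one)

lemma F_conv_shift: "F_conv f g x = (LINT u|lborel. f (u + x) * g u)"
proof -
  have "F_conv f g x = (LINT t|lborel. f t * g (t - x))"
    by (simp add: F_conv_def convolution_def)
  also have "\<dots> = (LINT u|lborel. f (x + 1 * u) * g (x + 1 * u - x))"
    using lborel_integral_real_affine[of 1 "\<lambda>t. f t * g (t - x)" x] by simp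
  finally show ?thesis by (simp add: add.commute)
qed

lemma integrable_shift: "integrable lborel (\<lambda>u. f (u + x) * g u)"
proof (rule integrable_bounded_support[where a = "-1 - x" and b = 1 and c = "f (1 + x)"])
  fix u :: real assume "u \<le> 1"
  then have "f (u + x) * g u \<le> f (1 + x) * 1"
    by (intro mult_mono f_mono f_nonneg g_le_1 g_nonneg) auto
  then show "\<bar>f (u + x) * g u\<bar> \<le> f (1 + x)" by (simp add: f_nonneg g_nonneg)
qed (auto simp: f_zero g_zero)

lemma cont_shift: "continuous_on UNIV (\<lambda>u. f (u + x) * g u)"
  by (intro continuous_intros continuous_on_compose2[OF f_cont] continuous_on_compose2[OF g_cont]) auto

lemma F_nonneg: "0 \<le> F_conv f g x"
  unfolding F_conv_shift by (intro Bochner_Integration.integral_nonneg) (simp add: f_nonneg g_nonneg)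

lemma F_mono: "mono (F_conv f g)"
  unfolding F_conv_shift[abs_def]
  by (intro monoI integral_mono integrable_shift mult_right_mono f_mono g_nonneg) auto

lemma F_convex: "convex_on UNIV (F_conv f g)"
proof (rule convex_onI)
  fix t x y :: real assume t: "0 < t" "t < 1"
  have "F_conv f g ((1 - t) *\<^sub>R x + t *\<^sub>R y)
      \<le> (LINT u|lborel. (1 - t) * (f (u + x) * g u) + t * (f (u + y) * g u))"
    unfolding F_conv_shift
  proof (intro integral_mono integrable_shift Bochner_Integration.integrable_add integrable_mult_right)
    fix u
    have "u + ((1 - t) * x + t * y) = (1 - t) * (u + x) + t * (u + y)" by (simp add: algebra_simps)
    then have "f (u + ((1 - t) * x + t * y)) \<le> (1 - t) * f (u + x) + t * f (u + y)"
      using convex_onD[OF f_convex, of t "u + x" "u + y"] t by simp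
    then show "f (u + ((1 - t) *\<^sub>R x + t *\<^sub>R y)) * g u \<le> (1 - t) * (f (u + x) * g u) + t * (f (u + y) * g u)"
      using mult_right_mono[OF _ g_nonneg[of u]] by (fastforce simp: algebra_simps)
  qed
  also have "\<dots> = (1 - t) * F_conv f g x + t * F_conv f g y"
    by (simp add: F_conv_shift integrable_shift)
  finally show "F_conv f g ((1 - t) *\<^sub>R x + t *\<^sub>R y) \<le> (1 - t) * F_conv f g x + t * F_conv f g y" .
qed simp

text \<open>
  The defect of convexity is an integral of a continuous nonnegative function of \<open>u\<close>. At
  \<open>u = - 1 - z\<close>, where \<open>z\<close> is the intermediate point, \<open>f\<close> vanishes at \<open>u + z\<close> but is positive at one
  of \<open>u + x\<close>, \<open>u + y\<close>, and \<open>g\<close> is \<open>1\<close> since \<open>z \<ge> 0\<close>.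
\<close>

lemma F_strictly_convex: "strictly_convex_on {0..} (F_conv f g)"
  unfolding strictly_convex_on_def
proof (intro conjI ballI allI impI)
  fix x y t :: real assume "x \<in> {0..}" "y \<in> {0..}" and xy: "x \<noteq> y" and t: "0 < t" "t < 1"
  define z where "z = (1 - t) * x + t * y"
  define \<phi> where "\<phi> u = (1 - t) * (f (u + x) * g u) + t * (f (u + y) * g u) - f (u + z) * g u" for u
  have "0 < (LINT u|lborel. \<phi> u)"
  proof (rule integral_pos_of_continuous[where ?t0.0 = "-1 - z"])
    show "continuous_on UNIV \<phi>" unfolding \<phi>_def by (intro continuous_intros cont_shift)
    show "integrable lborel \<phi>"
      unfolding \<phi>_def by (intro Bochner_Integration.integrable_diff Bochner_Integration.integrable_add
        integrable_mult_right integrable_shift)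
    have eq: "\<phi> u = ((1 - t) * f (u + x) + t * f (u + y) - f (u + z)) * g u" for u
      by (simp add: \<phi>_def algebra_simps)
    show "0 \<le> \<phi> u" for u
    proof -
      have "u + z = (1 - t) * (u + x) + t * (u + y)" by (simp add: z_def algebra_simps)
      then have "f (u + z) \<le> (1 - t) * f (u + x) + t * f (u + y)"
        using convex_onD[OF f_convex, of t "u + x" "u + y"] t by simp
      then show ?thesis by (simp add: eq g_nonneg)
    qed
    show "0 < \<phi> (- 1 - z)"
    proof -
      have z: "0 \<le> z" using t \<open>x \<in> {0..}\<close> \<open>y \<in> {0..}\<close> by (simp add: z_def)
      have "z - x = t * (y - x)" "y - z = (1 - t) * (y - x)" by (simp_all add: z_def algebra_simps)
      moreover have "t * (y - x) < 0 \<or> 0 < (1 - t) * (y - x)"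
        using xy t by (cases "x < y") (auto simp: mult_less_0_iff)
      ultimately have "z < x \<or> z < y" by linarith
      then have "0 < (1 - t) * f (- 1 - z + x) + t * f (- 1 - z + y)"
        using t f_nonneg[of "- 1 - z + x"] f_nonneg[of "- 1 - z + y"] f_pos[of "- 1 - z + x"] f_pos[of "- 1 - z + y"]
        by (auto intro: add_pos_nonneg add_nonneg_pos)
      then show ?thesis using z by (simp add: eq g_one f_zero)
    qed
  qed
  then show "F_conv f g ((1 - t) * x + t * y) < (1 - t) * F_conv f g x + t * F_conv f g y"
    unfolding F_conv_shift \<phi>_def
    by (subst (asm) Bochner_Integration.integral_diff)
       (auto simp: z_def integrable_shift intro!: Bochner_Integration.integrable_add integrable_mult_right)
qed simp

text \<open>
  The right derivative of \<open>f\<close>. Only two of its properties matter: it is a subgradient and it is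
  monotone, hence measurable.
\<close>

definition slope :: "real \<Rightarrow> real" where
  "slope x = Inf ((\<lambda>t. (f x - f t) / (x - t)) ` ({x<..} \<inter> UNIV))"

lemma slope_le: "f x + slope x * (y - x) \<le> f y"
  unfolding slope_def using f_convex by (intro convex_le_Inf_differential[where I = UNIV]) auto

lemma slope_mono: "mono slope"
proof (rule monoI)
  fix x y :: real assume "x \<le> y"
  show "slope x \<le> slope y"
  proof (cases "x = y")
    case False
    have "slope x * (y - x) \<le> slope y * (y - x)"
      using slope_le[of x y] slope_le[of y x] by (simp add: algebra_simps)
    then show ?thesis using False \<open>x \<le> y\<close> by (simp add: mult_le_cancel_right)
  qed simp
qed

lemma slope_borel [measurable]: "slope \<in> borel_measurable borel"
  by (rule borel_measurable_mono[OF slope_mono])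

lemma slope_nonneg: "0 \<le> slope x"
proof -
  have "slope x * 1 \<ge> 0"
    using slope_le[of x "x - 1"] f_mono[of "x - 1" x] by simp
  then show ?thesis by simp
qed

lemma slope_zero: "x < -1 \<Longrightarrow> slope x = 0"
proof -
  assume x: "x < -1"
  have "slope x * (-1 - x) \<le> 0" using slope_le[of x "-1"] x by (simp add: f_zero)
  then have "slope x \<le> 0" using x by (simp add: mult_le_0_iff)
  then show ?thesis using slope_nonneg[of x] by simp
qed

definition F_slope :: "real \<Rightarrow> real" where
  "F_slope x = (LINT t|lborel. slope t * g (t - x))"

lemma integrable_slope: "integrable lborel (\<lambda>t. slope t * g (t - x))"
proof (rule integrable_bounded_support[where a = "-1" and b = "1 + x" and c = "slope (1 + x)"])
  fix t assume "t \<le> 1 + x"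
  then have "slope t * g (t - x) \<le> slope (1 + x) * 1"
    by (intro mult_mono monoD[OF slope_mono] slope_nonneg g_le_1 g_nonneg) auto
  then show "\<bar>slope t * g (t - x)\<bar> \<le> slope (1 + x)" by (simp add: slope_nonneg g_nonneg)
qed (auto simp: slope_zero g_zero)

lemma F_slope_shift: "F_slope x = (LINT u|lborel. slope (u + x) * g u)"
  and integrable_slope_shift: "integrable lborel (\<lambda>u. slope (u + x) * g u)"
  using lborel_integral_real_affine[of 1 "\<lambda>t. slope t * g (t - x)" x]
    lborel_integrable_real_affine[OF integrable_slope, of 1 x x]
  by (simp_all add: F_slope_def add.commute)

lemma F_slope_le: "F_conv f g x + F_slope x * (y - x) \<le> F_conv f g y"
proof -
  have "F_conv f g x + F_slope x * (y - x)
      = (LINT u|lborel. f (u + x) * g u + slope (u + x) * g u * (y - x))"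
    by (simp add: F_conv_shift F_slope_shift integrable_shift integrable_slope_shift)
  also have "\<dots> \<le> (LINT u|lborel. f (u + y) * g u)"
  proof (intro integral_mono Bochner_Integration.integrable_add integrable_mult_left integrable_shift integrable_slope_shift)
    fix u
    have "(f (u + x) + slope (u + x) * (y - x)) * g u \<le> f (u + y) * g u"
      using slope_le[of "u + x" "u + y"] by (intro mult_right_mono g_nonneg) simp
    then show "f (u + x) * g u + slope (u + x) * g u * (y - x) \<le> f (u + y) * g u"
      by (simp add: algebra_simps)
  qed
  finally show ?thesis by (simp add: F_conv_shift)
qed

lemma F_slope_cont: "continuous_on UNIV F_slope"
proof -
  have "(\<lambda>n. F_slope (X n)) \<longlonglongrightarrow> F_slope x" if X: "X \<longlonglongrightarrow> x" for X x
  proof -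
    have "Bseq X" using X by (intro convergent_imp_Bseq convergentI)
    then obtain R where R: "\<And>n. X n \<le> R" by (metis BseqE abs_le_D1 real_norm_def)
    show ?thesis
      unfolding F_slope_def
    proof (rule integral_dominated_convergence[where w = "\<lambda>t. slope (1 + R) * indicator {-1..1 + R} t"])
      show "integrable lborel (\<lambda>t. slope (1 + R) * indicator {-1..1 + R} t)"
        by (intro integrable_mult_right) (simp add: integrable_indicator_iff emeasure_lborel_Icc_eq)
      have "isCont g y" for y using g_cont by (simp add: continuous_on_eq_continuous_at)
      then have "(\<lambda>n. g (t - X n)) \<longlonglongrightarrow> g (t - x)" for t
        by (rule isCont_tendsto_compose) (intro tendsto_intros X)
      then show "AE t in lborel. (\<lambda>n. slope t * g (t - X n)) \<longlonglongrightarrow> slope t * g (t - x)"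
        by (intro AE_I2 tendsto_intros)
      show "AE t in lborel. norm (slope t * g (t - X n)) \<le> slope (1 + R) * indicator {-1..1 + R} t" for n
      proof (intro AE_I2)
        fix t
        show "norm (slope t * g (t - X n)) \<le> slope (1 + R) * indicator {-1..1 + R} t"
        proof (cases "t \<in> {-1..1 + R}")
          case True
          then have "slope t * g (t - X n) \<le> slope (1 + R) * 1"
            by (intro mult_mono monoD[OF slope_mono] slope_nonneg g_le_1 g_nonneg) auto
          then show ?thesis using True by (simp add: slope_nonneg g_nonneg)
        next
          case False
          then have "t < -1 \<or> 1 \<le> t - X n" using R[of n] by auto
          then show ?thesis using False by (auto simp: slope_zero g_zero)
        qed
      qed
    qed auto
  qed
  then show ?thesis by (simp add: continuous_on_sequentially comp_def)
qed

text \<open>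
  A continuous selection of subgradients is the derivative: the difference quotient between \<open>x\<close> and
  \<open>y\<close> lies between the subgradients at \<open>x\<close> and at \<open>y\<close>. In this way the points where \<open>f\<close> fails to be
  differentiable never enter.
\<close>

lemma F_has_derivative: "(F_conv f g has_real_derivative F_slope x) (at x)"
proof -
  have "((\<lambda>y. (F_conv f g y - F_conv f g x) / (y - x) - F_slope x) \<longlongrightarrow> 0) (at x)"
  proof (rule Lim_null_comparison)
    have "isCont F_slope x" using F_slope_cont by (simp add: continuous_on_eq_continuous_at)
    then have "(F_slope \<longlongrightarrow> F_slope x) (at x)" by (simp add: isCont_def)
    then show "((\<lambda>y. \<bar>F_slope y - F_slope x\<bar>) \<longlongrightarrow> 0) (at x)"
      by (intro tendsto_rabs_zero) (simp add: LIM_zero)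
    show "\<forall>\<^sub>F y in at x. norm ((F_conv f g y - F_conv f g x) / (y - x) - F_slope x) \<le> \<bar>F_slope y - F_slope x\<bar>"
      unfolding eventually_at_filter
    proof (intro always_eventually allI impI)
      fix y assume y: "y \<noteq> x"
      define q where "q = (F_conv f g y - F_conv f g x) / (y - x)"
      have q: "q * (y - x) = F_conv f g y - F_conv f g x" using y by (simp add: q_def)
      have 1: "F_slope x * (y - x) \<le> q * (y - x)" "q * (y - x) \<le> F_slope y * (y - x)"
        using F_slope_le[of x y] F_slope_le[of y x] unfolding q by (simp_all add: algebra_simps)
      show "norm (q - F_slope x) \<le> \<bar>F_slope y - F_slope x\<bar>"
        using 1 y by (cases "y < x") (auto simp: mult_le_cancel_right)
    qed
  qed
  then show ?thesis by (simp add: has_field_derivative_iff LIM_zero_iff)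
qed

lemma F_C1: "F_conv f g C1_differentiable_on UNIV"
  unfolding C1_differentiable_on_def
  using F_has_derivative F_slope_cont
  by (intro exI[of _ F_slope]) (auto simp: has_real_derivative_iff_has_vector_derivative)

text \<open>
  In the integral for \<open>F(-2)\<close> one of the two factors vanishes at every point, whereas \<open>F(0)\<close> is
  positive. The subgradient inequality then forces a positive slope at \<open>0\<close>.
\<close>

lemma F_deriv_pos: "0 < deriv (F_conv f g) 0"
proof -
  have "F_conv f g (-2) = 0"
  proof -
    have "(\<lambda>u. f (u + - 2) * g u) = (\<lambda>_. 0)"
    proof
      fix u show "f (u + - 2) * g u = 0" by (cases "1 \<le> u") (auto simp: f_zero g_zero)
    qed
    then show ?thesis unfolding F_conv_shift by (simp only:) simp
  qed
  moreover have "0 < F_conv f g 0"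
    unfolding F_conv_shift
    by (rule integral_pos_of_continuous[OF cont_shift integrable_shift, where ?t0.0 = 0])
       (auto simp: f_nonneg g_nonneg f_pos g_pos)
  ultimately have "0 < F_slope 0" using F_slope_le[of 0 "-2"] by simp
  then show ?thesis using DERIV_imp_deriv[OF F_has_derivative, of 0] by simp
qed

end

section \<open>Perturbations of the identity matrix\<close>

lemma norm_matrix_vector_mult_le:
  fixes A :: "real^'n^'m"
  shows "norm (A *v x) \<le> norm A * norm x"
proof -
  have "norm (A *v x) = L2_set (\<lambda>i. \<bar>A $ i \<bullet> x\<bar>) UNIV"
    by (simp add: norm_vec_def matrix_vector_mul_component)
  also have "\<dots> \<le> L2_set (\<lambda>i. norm (A $ i) * norm x) UNIV"
    by (intro L2_set_mono) (auto simp: Cauchy_Schwarz_ineq2)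
  also have "\<dots> = norm A * norm x"
    by (simp add: L2_set_left_distrib norm_vec_def)
  finally show ?thesis .
qed

lemma tendsto_matrix_vector_mult:
  fixes A :: "'b \<Rightarrow> real^'n^'m"
  assumes "(A \<longlongrightarrow> L) F" "(w \<longlongrightarrow> x) F"
  shows "((\<lambda>k. A k *v w k) \<longlongrightarrow> L *v x) F"
  unfolding matrix_vector_mult_def
  by (intro tendsto_vec_lambda tendsto_sum tendsto_mult tendsto_vec_nth assms)

lemma tendsto_det:
  fixes A :: "'b \<Rightarrow> real^'n^'n"
  assumes "(A \<longlongrightarrow> L) F"
  shows "((\<lambda>k. det (A k)) \<longlongrightarrow> det L) F"
  unfolding det_def by (intro tendsto_intros tendsto_vec_nth assms)

lemma matrix_inv_mult:
  fixes A :: "real^'n^'n"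
  assumes "invertible A"
  shows "A *v (matrix_inv A *v x) = x" "matrix_inv A *v (A *v x) = x"
proof -
  have "A ** matrix_inv A = mat 1 \<and> matrix_inv A ** A = mat 1"
    using assms unfolding invertible_def matrix_inv_def by (rule someI_ex)
  then show "A *v (matrix_inv A *v x) = x" "matrix_inv A *v (A *v x) = x"
    by (simp_all add: matrix_vector_mul_assoc)
qed

text \<open>
  Cramer's rule expresses the solution of a linear system by determinants.
\<close>

lemma tendsto_matrix_inv_mult:
  fixes A :: "'b \<Rightarrow> real^'n^'n"
  assumes A: "(A \<longlongrightarrow> L) F" and w: "(w \<longlongrightarrow> x) F" and inv: "\<And>k. invertible (A k)" "invertible L"
  shows "((\<lambda>k. matrix_inv (A k) *v w k) \<longlongrightarrow> matrix_inv L *v x) F"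
proof -
  have solve: "matrix_inv B *v y = (\<chi> k. det (\<chi> i j. if j = k then y $ i else B $ i $ j) / det B)"
    if "invertible B" for B :: "real^'n^'n" and y
    using cramer[of B "matrix_inv B *v y" y] matrix_inv_mult(1)[OF that] that
    by (simp add: invertible_det_nz)
  have entry: "((\<lambda>k. \<chi> i j. if j = m then w k $ i else A k $ i $ j) \<longlongrightarrow> (\<chi> i j. if j = m then x $ i else L $ i $ j)) F" for m
    by (intro tendsto_vec_lambda) (auto intro!: tendsto_vec_nth A w)
  show ?thesis
    unfolding solve[OF inv(1)] solve[OF inv(2)]
    using inv(2) by (intro tendsto_vec_lambda tendsto_divide tendsto_det entry A) (simp add: invertible_det_nz)
qed

lemma invertible_near_identity:
  fixes M :: "real^'n^'n"
  assumes "\<epsilon> * norm M < 1" "0 \<le> \<epsilon>"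
  shows "invertible (mat 1 + \<epsilon> *\<^sub>R M)"
proof -
  have "x = 0" if "(mat 1 + \<epsilon> *\<^sub>R M) *v x = 0" for x
  proof -
    have "x = - (\<epsilon> *\<^sub>R (M *v x))"
      using that by (simp add: matrix_vector_mult_add_rdistrib scaleR_matrix_vector_assoc eq_neg_iff_add_eq_0)
    then have "norm x = \<epsilon> * norm (M *v x)" using assms(2) by (metis abs_of_nonneg norm_minus_cancel norm_scaleR)
    also have "\<dots> \<le> \<epsilon> * (norm M * norm x)" by (intro mult_left_mono norm_matrix_vector_mult_le assms)
    finally have "norm x * (1 - \<epsilon> * norm M) \<le> 0" by (simp add: algebra_simps)
    then show "x = 0" using assms(1) by (simp add: mult_le_0_iff)
  qed
  then have "\<exists>B. B ** (mat 1 + \<epsilon> *\<^sub>R M) = mat 1"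
    by (subst matrix_left_invertible_ker) blast
  then show ?thesis by (simp add: invertible_left_inverse)
qed

section \<open>The gauge at contact points\<close>

locale inscribed_body =
  fixes K :: "'a::euclidean_space set"
  assumes K_compact: "compact K" and K_convex: "convex K" and K_zero: "0 \<in> interior K"
    and K_ball: "K \<subseteq> cball 0 1" and K_smooth: "C1_smooth_boundary K"
begin

lemma inner_radius: "\<exists>\<rho>>0. cball 0 \<rho> \<subseteq> K"
  using K_zero by (meson mem_interior_cball)

lemma gauge_set_bound:
  assumes "t > 0" "x \<in> (*\<^sub>R) t ` K"
  shows "norm x \<le> t"
proof -
  obtain k where k: "k \<in> K" "x = t *\<^sub>R k" using assms by auto
  then have "norm k \<le> 1" using K_ball by auto
  then show ?thesis using assms k by simp
qed

lemma gauge_set_nonempty: "\<exists>t>0. x \<in> (*\<^sub>R) t ` K"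
proof -
  obtain \<rho> where \<rho>: "\<rho> > 0" "cball 0 \<rho> \<subseteq> K" using inner_radius by blast
  define t where "t = norm x / \<rho> + 1"
  have t: "t > 0" using \<rho> by (simp add: t_def add_nonneg_pos)
  have "norm x \<le> \<rho> * t" using \<rho> by (simp add: t_def distrib_left)
  then have "norm (x /\<^sub>R t) \<le> \<rho>" using t by (simp add: field_simps)
  then have "x /\<^sub>R t \<in> K" using \<rho> by auto
  then have "x \<in> (*\<^sub>R) t ` K" using t by (intro image_eqI[of _ _ "x /\<^sub>R t"]) auto
  then show ?thesis using t by blast
qed

lemma norm_le_gauge: "norm x \<le> gauge_norm K x"
  unfolding gauge_norm_def
  using gauge_set_nonempty[of x] gauge_set_bound by (intro cInf_greatest) auto

lemma gauge_le: "t > 0 \<Longrightarrow> x \<in> (*\<^sub>R) t ` K \<Longrightarrow> gauge_norm K x \<le> t"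
  unfolding gauge_norm_def by (rule cInf_lower) (auto intro!: bdd_belowI[of _ 0])

lemma gauge_le_1: "x \<in> K \<Longrightarrow> gauge_norm K x \<le> 1"
  by (rule gauge_le) auto

lemma gauge_zero: "gauge_norm K 0 = 0"
proof (rule antisym)
  have "gauge_norm K 0 \<le> t" if "t > 0" for t
  proof (rule gauge_le[OF that])
    show "0 \<in> (*\<^sub>R) t ` K" using K_zero interior_subset by (intro image_eqI[of _ _ 0]) auto
  qed
  then show "gauge_norm K 0 \<le> 0" by (rule field_le_epsilon) simp
  show "0 \<le> gauge_norm K 0" using norm_le_gauge[of 0] by simp
qed

text \<open>
  The body is star-shaped about \<open>0\<close>, so it contains \<open>x / s\<close> for every \<open>s > 1\<close>; it is also closed.
\<close>

lemma gauge_le_1_imp_mem: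
  assumes "gauge_norm K x \<le> 1"
  shows "x \<in> K"
proof -
  have star: "a *\<^sub>R k \<in> K" if "k \<in> K" "0 \<le> a" "a \<le> 1" for a k
    using convexD[OF K_convex that(1), of 0 a "1 - a"] K_zero interior_subset that by auto
  have mem: "x /\<^sub>R (1 + 1 / real (Suc n)) \<in> K" for n
  proof -
    let ?s = "1 + 1 / real (Suc n)"
    have "gauge_norm K x < ?s" using assms by (auto intro: le_less_trans)
    then obtain t where t: "t > 0" "x \<in> (*\<^sub>R) t ` K" "t < ?s"
      unfolding gauge_norm_def using gauge_set_nonempty[of x]
      by (subst (asm) cInf_less_iff) (auto intro!: bdd_belowI[of _ 0])
    then obtain k where k: "k \<in> K" "x = t *\<^sub>R k" by auto
    have "(t / ?s) *\<^sub>R k \<in> K" using t k by (intro star) (auto simp: divide_simps)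
    then show ?thesis using k by (simp add: divide_inverse mult.commute)
  qed
  have "(\<lambda>n. 1 / real (Suc n)) \<longlonglongrightarrow> 0"
    using LIMSEQ_inverse_real_of_nat by (simp add: inverse_eq_divide)
  then have "(\<lambda>n. x /\<^sub>R (1 + 1 / real (Suc n))) \<longlonglongrightarrow> x /\<^sub>R (1 + 0)"
    by (intro tendsto_scaleR tendsto_inverse tendsto_add tendsto_const) auto
  then show ?thesis
    using closed_sequentially[OF compact_imp_closed[OF K_compact] mem] by simp
qed

lemma gauge_smooth:
  obtains D where "\<And>x. x \<noteq> 0 \<Longrightarrow> (gauge_norm K has_derivative blinfun_apply (D x)) (at x)"
  using K_smooth unfolding C1_smooth_boundary_def C1_on_def by auto

lemma gauge_cont: "continuous_on UNIV (gauge_norm K)"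
proof -
  obtain D where D: "\<And>x. x \<noteq> 0 \<Longrightarrow> (gauge_norm K has_derivative blinfun_apply (D x)) (at x)"
    using gauge_smooth by blast
  have "isCont (gauge_norm K) x" for x
  proof (cases "x = 0")
    case True
    obtain \<rho> where \<rho>: "\<rho> > 0" "cball 0 \<rho> \<subseteq> K" using inner_radius by blast
    have bound: "gauge_norm K y \<le> norm y / \<rho>" for y
    proof (cases "y = 0")
      case False
      have "y = (norm y / \<rho>) *\<^sub>R ((\<rho> / norm y) *\<^sub>R y)" using False \<rho> by simp
      moreover have "(\<rho> / norm y) *\<^sub>R y \<in> K" using \<rho> False by (intro subsetD[OF \<rho>(2)]) simp
      ultimately have "y \<in> (*\<^sub>R) (norm y / \<rho>) ` K" by (rule image_eqI)
      then show ?thesis using False \<rho> by (intro gauge_le) auto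
    qed (simp add: gauge_zero)
    have "(gauge_norm K \<longlongrightarrow> 0) (at 0)"
    proof (rule tendsto_sandwich[OF _ _ tendsto_const])
      show "\<forall>\<^sub>F y in at 0. 0 \<le> gauge_norm K y"
        using order_trans[OF norm_ge_zero norm_le_gauge] by simp
      show "\<forall>\<^sub>F y in at 0. gauge_norm K y \<le> norm y / \<rho>" using bound by simp
      have "((\<lambda>y::'a. norm y / \<rho>) \<longlongrightarrow> norm (0::'a) / \<rho>) (at 0)"
        using \<rho> by (intro tendsto_intros) auto
      then show "((\<lambda>y::'a. norm y / \<rho>) \<longlongrightarrow> 0) (at 0)" by simp
    qed
    then show ?thesis by (simp add: True isCont_def gauge_zero)
  qed (use D has_derivative_continuous in blast)
  then show ?thesis by (simp add: continuous_at_imp_continuous_on)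
qed

lemma gauge_borel [measurable]: "gauge_norm K \<in> borel_measurable borel"
  using gauge_cont by (rule borel_measurable_continuous_onI)

lemma gauge_eq_1_iff:
  assumes "norm \<xi> = 1"
  shows "gauge_norm K \<xi> = 1 \<longleftrightarrow> \<xi> \<in> K" and "\<xi> \<notin> K \<Longrightarrow> 1 < gauge_norm K \<xi>"
  using gauge_le_1[of \<xi>] gauge_le_1_imp_mem[of \<xi>] norm_le_gauge[of \<xi>] assms by force+

lemma sphere_Int_frontier: "sphere 0 1 \<inter> frontier K = sphere 0 1 \<inter> K"
proof -
  have "interior K \<subseteq> ball 0 1"
    using interior_mono[OF K_ball] by simp
  then have "\<xi> \<notin> interior K" if "norm \<xi> = 1" for \<xi> using that by auto
  then show ?thesis
    using compact_imp_closed[OF K_compact] by (auto simp: frontier_def)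
qed

text \<open>
  Since the body lies in the ball, the gauge is at least the norm. At a contact point the two agree,
  so their difference has a minimum there and the two derivatives coincide.
\<close>

lemma gauge_derivative_contact:
  assumes \<xi>: "norm \<xi> = 1" "\<xi> \<in> K"
  shows "(gauge_norm K has_derivative (\<lambda>h. \<xi> \<bullet> h)) (at \<xi>)"
proof -
  have ne: "\<xi> \<noteq> 0" using \<xi> by auto
  obtain D where "\<And>x. x \<noteq> 0 \<Longrightarrow> (gauge_norm K has_derivative blinfun_apply (D x)) (at x)"
    using gauge_smooth by blast
  then have D: "(gauge_norm K has_derivative blinfun_apply (D \<xi>)) (at \<xi>)" using ne by blast
  have N: "(norm has_derivative (\<lambda>h. h \<bullet> sgn \<xi>)) (at \<xi>)"
    by (rule has_derivative_norm[OF ne])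
  have "(\<lambda>h. blinfun_apply (D \<xi>) h - h \<bullet> sgn \<xi>) = (\<lambda>h. 0)"
  proof (rule differential_zero_maxmin[of \<xi> UNIV "\<lambda>x. gauge_norm K x - norm x"])
    show "((\<lambda>x. gauge_norm K x - norm x) has_derivative (\<lambda>h. blinfun_apply (D \<xi>) h - h \<bullet> sgn \<xi>)) (at \<xi>)"
      by (intro has_derivative_diff D N)
    have "gauge_norm K \<xi> - norm \<xi> = 0" using gauge_eq_1_iff(1)[of \<xi>] \<xi> by simp
    then show "(\<forall>y\<in>UNIV. gauge_norm K y - norm y \<le> gauge_norm K \<xi> - norm \<xi>)
      \<or> (\<forall>y\<in>UNIV. gauge_norm K \<xi> - norm \<xi> \<le> gauge_norm K y - norm y)"
      using norm_le_gauge by auto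
  qed auto
  then have "blinfun_apply (D \<xi>) = (\<lambda>h. \<xi> \<bullet> h)"
    using \<xi> by (auto simp: fun_eq_iff sgn_div_norm inner_commute)
  then show ?thesis using D by simp
qed

text \<open>
  The direction \<open>z k\<close> varies with the step, so a directional derivative would not suffice; the full
  derivative at the contact point is used.
\<close>

lemma gauge_difference_quotient:
  assumes \<xi>: "norm \<xi> = 1" "\<xi> \<in> K" and \<epsilon>: "\<epsilon> \<longlonglongrightarrow> 0" "\<And>k. 0 < \<epsilon> k" and z: "z \<longlonglongrightarrow> (z0 :: 'a)"
  shows "(\<lambda>k. (gauge_norm K (\<xi> + \<epsilon> k *\<^sub>R z k) - 1) / \<epsilon> k) \<longlonglongrightarrow> \<xi> \<bullet> z0"
proof -
  let ?h = "\<lambda>k. \<epsilon> k *\<^sub>R z k"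
  let ?G = "\<lambda>k. gauge_norm K (\<xi> + ?h k)"
  obtain R where R: "R > 0" "\<And>k. norm (z k) \<le> R"
    using z convergent_imp_Bseq[of z] by (auto simp: convergent_def Bseq_def)
  have gauge1: "gauge_norm K \<xi> = 1" using gauge_eq_1_iff(1)[OF \<xi>(1)] \<xi>(2) by blast
  have "(\<lambda>k. (?G k - 1) / \<epsilon> k - \<xi> \<bullet> z k) \<longlonglongrightarrow> 0"
  proof (rule LIMSEQ_I)
    fix e :: real assume e: "0 < e"
    then have "0 < e / (2 * R)" using R by simp
    then obtain d where d: "d > 0"
      "\<And>y. norm (y - \<xi>) < d \<Longrightarrow> norm (gauge_norm K y - gauge_norm K \<xi> - \<xi> \<bullet> (y - \<xi>)) \<le> e / (2 * R) * norm (y - \<xi>)"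
      using gauge_derivative_contact[OF \<xi>] unfolding has_derivative_at_alt by blast
    have "\<forall>\<^sub>F k in sequentially. \<epsilon> k < d / R"
      using order_tendstoD(2)[OF \<epsilon>(1), of "d / R"] d R by simp
    then obtain N where N: "\<And>k. k \<ge> N \<Longrightarrow> \<epsilon> k < d / R" by (auto simp: eventually_sequentially)
    show "\<exists>N. \<forall>k\<ge>N. norm ((?G k - 1) / \<epsilon> k - \<xi> \<bullet> z k - 0) < e"
    proof (intro exI[of _ N] allI impI)
      fix k assume "k \<ge> N"
      have ek: "0 < \<epsilon> k" by (rule \<epsilon>(2))
      have nz: "norm (?h k) \<le> \<epsilon> k * R" using ek R(2)[of k] by simp
      also have "\<epsilon> k * R < d" using N[OF \<open>k \<ge> N\<close>] R(1) by (simp add: pos_less_divide_eq)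
      finally have "norm (?G k - 1 - \<xi> \<bullet> (?h k)) \<le> e / (2 * R) * norm (?h k)"
        using d(2)[of "\<xi> + \<epsilon> k *\<^sub>R z k"] by (simp add: gauge1)
      also have "\<dots> \<le> e / (2 * R) * (\<epsilon> k * R)" using e R nz by (intro mult_left_mono) auto
      also have "\<dots> = e / 2 * \<epsilon> k" using R(1) by simp
      finally have "norm (?G k - 1 - \<xi> \<bullet> (?h k)) / \<epsilon> k \<le> e / 2"
        using ek by (simp add: divide_le_eq)
      also have "norm (?G k - 1 - \<xi> \<bullet> (?h k)) / \<epsilon> k
        = norm ((?G k - 1) / \<epsilon> k - \<xi> \<bullet> z k - 0)"
      proof -
        have "(?G k - 1 - \<xi> \<bullet> (?h k)) / \<epsilon> k
          = (?G k - 1) / \<epsilon> k - \<xi> \<bullet> z k"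
          using ek by (simp add: diff_divide_distrib)
        then show ?thesis using ek by (metis abs_of_pos diff_zero norm_divide real_norm_def)
      qed
      finally show "norm ((?G k - 1) / \<epsilon> k - \<xi> \<bullet> z k - 0) < e"
        using e by linarith
    qed
  qed
  moreover have "(\<lambda>k. \<xi> \<bullet> z k) \<longlonglongrightarrow> \<xi> \<bullet> z0" by (intro tendsto_intros z)
  ultimately show ?thesis using tendsto_add by fastforce
qed

end

section \<open>The limit of the functionals\<close>

lemma continuous_on_matrix_vector_mult [continuous_intros]:
  fixes M :: "real^'n^'m"
  shows "continuous_on S h \<Longrightarrow> continuous_on S (\<lambda>x. M *v h x)"
  unfolding continuous_on_def by (auto intro: tendsto_matrix_vector_mult)

lemma shell_Compl_sphere: "shell (- sphere 0 1) 0 1 = {}"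
proof -
  have "norm (x /\<^sub>R norm x) = 1" if "0 < norm x" for x :: 'a using that by simp
  then show ?thesis unfolding shell_def by fastforce
qed

lemma AE_sphere: "AE \<xi> in sphere_measure. norm (\<xi> :: real^'n) = 1"
proof -
  let ?N = "- sphere 0 1 :: (real^'n) set"
  have N: "?N \<in> sets borel" by (intro borel_open open_Compl) auto
  show ?thesis
    using N by (intro AE_I[where N = ?N]) (auto simp: emeasure_sphere_measure shell_Compl_sphere)
qed

lemma AE_sphere_pair: "AE p in sphere_measure \<Otimes>\<^sub>M (lborel :: real measure). norm (fst p :: real^'n) = 1"
proof -
  let ?N = "- sphere 0 1 :: (real^'n) set"
  have N: "?N \<in> sets borel" by (intro borel_open open_Compl) auto
  then have "emeasure sphere_measure ?N = 0" by (simp add: emeasure_sphere_measure shell_Compl_sphere)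
  then show ?thesis
    using N by (intro AE_I[where N = "?N \<times> UNIV"])
      (auto simp: space_pair_measure lborel.emeasure_pair_measure_Times)
qed

lemma convergent_common_bound:
  fixes M :: "nat \<Rightarrow> 'b::real_normed_vector" and v :: "nat \<Rightarrow> 'c::real_normed_vector"
  assumes "M \<longlonglongrightarrow> M0" "v \<longlonglongrightarrow> v0"
  shows "\<exists>R. \<forall>k. norm (M k) \<le> R \<and> norm (v k) \<le> R"
proof -
  have "Bseq M" "Bseq v" using assms by (auto intro!: convergent_imp_Bseq simp: convergent_def)
  then obtain R1 R2 where "\<And>k. norm (M k) \<le> R1" "\<And>k. norm (v k) \<le> R2" by (auto simp: Bseq_def)
  then show ?thesis by (intro exI[of _ "max R1 R2"]) (simp add: le_max_iff_disj)
qed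

lemma tendsto_at_withinI_sequentially:
  fixes \<phi> :: "'b::first_countable_topology \<Rightarrow> 'c::metric_space"
  assumes "\<And>X. (\<And>k. X k \<in> S) \<Longrightarrow> X \<longlonglongrightarrow> a \<Longrightarrow> (\<lambda>k. \<phi> (X k)) \<longlonglongrightarrow> l"
  shows "(\<phi> \<longlongrightarrow> l) (at a within S)"
proof (rule tendstoI)
  fix e :: real assume "0 < e"
  then show "\<forall>\<^sub>F x in at a within S. dist (\<phi> x) l < e"
    using assms by (intro sequentially_imp_eventually_within allI impI) (auto intro: tendstoD)
qed

locale functional = inscribed_body K + profiles f g
  for K :: "(real^'n) set" and f g :: "real \<Rightarrow> real"
begin

text \<open>
  The point whose gauge enters the functional at \<open>x\<close>.
\<close>

definition pullback :: "real \<Rightarrow> real^'n^'n \<Rightarrow> real^'n \<Rightarrow> real^'n \<Rightarrow> real^'n" where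
  "pullback \<epsilon> M v x = matrix_inv (mat 1 + \<epsilon> *\<^sub>R M) *v (x - \<epsilon> *\<^sub>R v)"

lemma pullback_borel [measurable]: "pullback \<epsilon> M v \<in> borel_measurable borel"
proof -
  have "continuous_on UNIV (pullback \<epsilon> M v)"
    unfolding pullback_def[abs_def]
    by (intro continuous_intros)
  then show ?thesis by (rule borel_measurable_continuous_onI)
qed

lemma pullback_inverse:
  assumes "invertible (mat 1 + \<epsilon> *\<^sub>R M)"
  shows "x = pullback \<epsilon> M v x + \<epsilon> *\<^sub>R (M *v pullback \<epsilon> M v x) + \<epsilon> *\<^sub>R v"
proof -
  have "x - \<epsilon> *\<^sub>R v = (mat 1 + \<epsilon> *\<^sub>R M) *v pullback \<epsilon> M v x"
    unfolding pullback_def by (rule matrix_inv_mult(1)[OF assms, symmetric])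
  also have "\<dots> = pullback \<epsilon> M v x + \<epsilon> *\<^sub>R (M *v pullback \<epsilon> M v x)"
    by (simp add: matrix_vector_mult_add_rdistrib scaleR_matrix_vector_assoc)
  finally show ?thesis by (simp add: algebra_simps)
qed

text \<open>
  This writes the pullback of a point near the sphere as an increment of order \<open>\<epsilon>\<close> from \<open>\<xi>\<close>, which is
  the form needed for the difference quotient of the gauge.
\<close>

lemma pullback_ray:
  assumes inv: "invertible (mat 1 + \<epsilon> *\<^sub>R M)"
  shows "pullback \<epsilon> M v ((1 + \<epsilon> * s) *\<^sub>R \<xi>)
    = \<xi> + \<epsilon> *\<^sub>R (matrix_inv (mat 1 + \<epsilon> *\<^sub>R M) *v (s *\<^sub>R \<xi> - v - M *v \<xi>))"
proof -
  let ?A = "mat 1 + \<epsilon> *\<^sub>R M"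
  have "(1 + \<epsilon> * s) *\<^sub>R \<xi> - \<epsilon> *\<^sub>R v = ?A *v \<xi> + \<epsilon> *\<^sub>R (s *\<^sub>R \<xi> - v - M *v \<xi>)"
    by (simp add: matrix_vector_mult_add_rdistrib scaleR_matrix_vector_assoc algebra_simps)
  then show ?thesis
    by (simp add: pullback_def matrix_vector_right_distrib matrix_vector_mult_scaleR matrix_inv_mult(2)[OF inv])
qed

text \<open>
  The integrand of the functional in the polar coordinates \<open>x = (1 + \<epsilon> s) \<xi>\<close> with \<open>p = (\<xi>, s)\<close>. The
  factor \<open>1 / (1 - r)\<close> of the functional is cancelled by the Jacobian.
\<close>

definition scaled_integrand :: "real \<Rightarrow> real^'n^'n \<Rightarrow> real^'n \<Rightarrow> (real^'n) \<times> real \<Rightarrow> real" where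
  "scaled_integrand \<epsilon> M v p = (1 + \<epsilon> * snd p) ^ (CARD('n) - 1) * indicator {0<..} (1 + \<epsilon> * snd p) *
     (f (snd p) * g ((gauge_norm K (pullback \<epsilon> M v ((1 + \<epsilon> * snd p) *\<^sub>R fst p)) - 1) / \<epsilon>))"

definition limit_integrand :: "real^'n^'n \<Rightarrow> real^'n \<Rightarrow> (real^'n) \<times> real \<Rightarrow> real" where
  "limit_integrand M v p = indicator K (fst p) * (f (snd p) * g (snd p - fst p \<bullet> (M *v fst p + v)))"

lemma scaled_integrand_borel [measurable]:
  "scaled_integrand \<epsilon> M v \<in> borel_measurable (borel \<Otimes>\<^sub>M borel)"
  unfolding scaled_integrand_def[abs_def] by measurable

lemma K_borel [measurable]: "K \<in> sets borel"
  by (intro borel_compact K_compact)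

lemma quadratic_borel [measurable]:
  fixes M :: "real^'n^'n" and v :: "real^'n"
  shows "(\<lambda>\<xi>. \<xi> \<bullet> (M *v \<xi> + v)) \<in> borel_measurable borel"
proof -
  have "continuous_on UNIV (\<lambda>\<xi>. \<xi> \<bullet> (M *v \<xi> + v))"
    by (intro continuous_intros continuous_on_matrix_vector_mult[of UNIV "\<lambda>x. x" M, OF continuous_on_id])
  then show ?thesis by (rule borel_measurable_continuous_onI)
qed

lemma limit_integrand_borel [measurable]: "limit_integrand M v \<in> borel_measurable (borel \<Otimes>\<^sub>M borel)"
proof -
  have [measurable]: "(\<lambda>p :: (real^'n) \<times> real. fst p \<bullet> (M *v fst p + v)) \<in> borel_measurable (borel \<Otimes>\<^sub>M borel)"
    using measurable_compose[OF measurable_fst quadratic_borel] by simp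
  show ?thesis unfolding limit_integrand_def[abs_def] by measurable
qed

lemma I_fun_eq:
  assumes \<epsilon>: "0 < \<epsilon>"
  shows "I_fun K f g (1 - \<epsilon>) M v = (LINT p|(sphere_measure \<Otimes>\<^sub>M lborel). scaled_integrand \<epsilon> M v p)"
proof -
  define \<phi> where "\<phi> x = f ((norm x - 1) / \<epsilon>) * g ((gauge_norm K (pullback \<epsilon> M v x) - 1) / \<epsilon>)" for x
  let ?i = "\<lambda>p. (1 + \<epsilon> * snd p) ^ (CARD('n) - 1) * indicator {0<..} (1 + \<epsilon> * snd p) * \<phi> ((1 + \<epsilon> * snd p) *\<^sub>R fst p)"
  have [measurable]: "\<phi> \<in> borel_measurable borel" unfolding \<phi>_def by measurable
  have "I_fun K f g (1 - \<epsilon>) M v = 1 / \<epsilon> * (LINT x|lborel. \<phi> x)"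
    by (simp add: I_fun_def rescale_def \<phi>_def pullback_def)
  also have "(LINT x|lborel. \<phi> x) = \<epsilon> * (LINT p|(sphere_measure \<Otimes>\<^sub>M lborel). ?i p)"
    by (rule integral_polar_affine) (auto simp: \<phi>_def f_nonneg g_nonneg \<epsilon>)
  also have "(LINT p|(sphere_measure \<Otimes>\<^sub>M lborel). ?i p)
      = (LINT p|(sphere_measure \<Otimes>\<^sub>M lborel). scaled_integrand \<epsilon> M v p)"
  proof (rule integral_cong_AE)
    show "AE p in sphere_measure \<Otimes>\<^sub>M lborel.
      (1 + \<epsilon> * snd p) ^ (CARD('n) - 1) * indicator {0<..} (1 + \<epsilon> * snd p) * \<phi> ((1 + \<epsilon> * snd p) *\<^sub>R fst p)
      = scaled_integrand \<epsilon> M v p"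
      using AE_sphere_pair
    proof eventually_elim
      case (elim p)
      then show ?case
        using \<epsilon> by (auto simp: scaled_integrand_def \<phi>_def indicator_def)
    qed
  qed measurable
  finally show ?thesis using \<epsilon> by simp
qed

lemma F_conv_lint: "F_conv f g x = (LINT t|lborel. f t * g (t - x))"
  by (simp add: F_conv_def convolution_def)

lemma F_cont: "continuous_on UNIV (F_conv f g)"
  using F_has_derivative by (meson DERIV_isCont continuous_at_imp_continuous_on)

lemma F_borel [measurable]: "F_conv f g \<in> borel_measurable borel"
  using F_cont by (rule borel_measurable_continuous_onI)

lemma quadratic_bound:
  fixes M :: "real^'n^'n"
  assumes "norm \<xi> = 1" "norm M \<le> R" "norm v \<le> R"
  shows "\<bar>\<xi> \<bullet> (M *v \<xi> + v)\<bar> \<le> 2 * R"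
proof -
  have "\<bar>\<xi> \<bullet> (M *v \<xi> + v)\<bar> \<le> norm \<xi> * norm (M *v \<xi> + v)" by (rule Cauchy_Schwarz_ineq2)
  also have "\<dots> \<le> norm (M *v \<xi>) + norm v" using assms(1) norm_triangle_ineq by simp
  also have "\<dots> \<le> 2 * R" using norm_matrix_vector_mult_le[of M \<xi>] assms by simp
  finally show ?thesis .
qed

lemma I_one_eq_sphere:
  "I_one K f g M v = (LINT \<xi>|sphere_measure. indicator K \<xi> * F_conv f g (\<xi> \<bullet> (M *v \<xi> + v)))"
proof -
  have [measurable]: "sphere 0 1 \<in> sets (borel :: (real^'n) measure)" by (intro borel_closed) auto
  have "(LINT \<xi>|sphere_measure. indicator K \<xi> * F_conv f g (\<xi> \<bullet> (M *v \<xi> + v)))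
    = (LINT \<xi>|density (hausdorff_measure (CARD('n) - 1)) (\<lambda>\<xi>. ennreal (indicator (sphere 0 1) \<xi>)).
        indicator K \<xi> * F_conv f g (\<xi> \<bullet> (M *v \<xi> + v)))"
    by (simp add: sphere_measure_def ennreal_indicator)
  also have "\<dots> = (LINT \<xi>|hausdorff_measure (CARD('n) - 1).
        indicator (sphere 0 1) \<xi> *\<^sub>R (indicator K \<xi> * F_conv f g (\<xi> \<bullet> (M *v \<xi> + v))))"
    by (rule integral_density) auto
  also have "\<dots> = I_one K f g M v"
    unfolding I_one_def set_lebesgue_integral_def sphere_Int_frontier
    by (intro Bochner_Integration.integral_cong) (auto simp: indicator_def)
  finally show ?thesis ..
qed

lemma limit_integrand_bound:
  assumes \<xi>: "norm (fst p) = 1" and R: "norm M \<le> R" "norm v \<le> R"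
  shows "norm (limit_integrand M v p) \<le> f (1 + 2 * R) * indicator (UNIV \<times> {-1..1 + 2 * R}) p"
proof -
  have q: "\<bar>fst p \<bullet> (M *v fst p + v)\<bar> \<le> 2 * R" by (rule quadratic_bound[OF \<xi> R])
  show ?thesis
  proof (cases "snd p \<in> {-1..1 + 2 * R}")
    case True
    then have "f (snd p) * g (snd p - fst p \<bullet> (M *v fst p + v)) \<le> f (1 + 2 * R) * 1"
      by (intro mult_mono f_mono f_nonneg g_le_1 g_nonneg) auto
    then show ?thesis
      using True by (cases p) (auto simp: limit_integrand_def indicator_def f_nonneg g_nonneg)
  next
    case False
    then have "snd p < -1 \<or> 1 \<le> snd p - fst p \<bullet> (M *v fst p + v)" using q by auto
    then show ?thesis
      using False by (cases p) (auto simp: limit_integrand_def f_zero g_zero indicator_def)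
  qed
qed

lemma integrable_box: "integrable (sphere_measure \<Otimes>\<^sub>M lborel) (\<lambda>p. c * indicator (UNIV \<times> {a..b}) (p :: (real^'n) \<times> real) :: real)"
proof (intro integrable_mult_right)
  have "emeasure (sphere_measure \<Otimes>\<^sub>M lborel) ((UNIV :: (real^'n) set) \<times> {a..b})
      = emeasure sphere_measure (UNIV :: (real^'n) set) * emeasure lborel {a..b}"
    by (rule lborel.emeasure_pair_measure_Times) auto
  also have "\<dots> < \<infinity>"
    using emeasure_sphere_measure_finite[of "UNIV :: (real^'n) set"]
    by (cases "emeasure sphere_measure (UNIV :: (real^'n) set)")
       (auto simp: emeasure_lborel_Icc_eq ennreal_mult[symmetric])
  finally show "integrable (sphere_measure \<Otimes>\<^sub>M lborel) (indicator (UNIV \<times> {a..b}) :: (real^'n) \<times> real \<Rightarrow> real)"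
    by (simp add: integrable_indicator_iff)
qed

lemma I_one_eq_pair: "I_one K f g M v = (LINT p|(sphere_measure \<Otimes>\<^sub>M lborel). limit_integrand M v p)"
proof -
  interpret S: finite_measure "sphere_measure :: (real^'n) measure" by (rule finite_measure_sphere_measure)
  interpret P: pair_sigma_finite "sphere_measure :: (real^'n) measure" "lborel :: real measure" ..
  define R where "R = max (norm M) (norm v)"
  have int: "integrable (sphere_measure \<Otimes>\<^sub>M lborel) (limit_integrand M v)"
  proof (rule Bochner_Integration.integrable_bound[OF integrable_box])
    show "AE p in sphere_measure \<Otimes>\<^sub>M lborel. norm (limit_integrand M v p)
        \<le> norm (f (1 + 2 * R) * indicator (UNIV \<times> {-1..1 + 2 * R}) p)"
      using AE_sphere_pair
    proof eventually_elim
      case (elim p)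
      then show ?case
        using limit_integrand_bound[of p M R v] by (simp add: R_def f_nonneg)
    qed
  qed measurable
  have "(LINT p|(sphere_measure \<Otimes>\<^sub>M lborel). limit_integrand M v p)
    = (LINT \<xi>|sphere_measure. LINT s|lborel. limit_integrand M v (\<xi>, s))"
    by (rule P.integral_fst'[symmetric, OF int])
  also have "\<dots> = (LINT \<xi>|sphere_measure. indicator K \<xi> * F_conv f g (\<xi> \<bullet> (M *v \<xi> + v)))"
    by (intro Bochner_Integration.integral_cong) (simp_all add: limit_integrand_def F_conv_lint)
  finally show ?thesis by (simp add: I_one_eq_sphere)
qed

lemma I_one_tendsto:
  assumes M: "M \<longlonglongrightarrow> M0" and v: "v \<longlonglongrightarrow> v0"
  shows "(\<lambda>k. I_one K f g (M k) (v k)) \<longlonglongrightarrow> I_one K f g M0 v0"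
proof -
  interpret S: finite_measure "sphere_measure :: (real^'n) measure" by (rule finite_measure_sphere_measure)
  obtain R where R: "\<And>k. norm (M k) \<le> R" "\<And>k. norm (v k) \<le> R"
    using convergent_common_bound[OF M v] by blast
  let ?c = "F_conv f g (2 * R)"
  show ?thesis
    unfolding I_one_eq_sphere
  proof (rule integral_dominated_convergence[where w = "\<lambda>_. ?c"])
    have "isCont (F_conv f g) y" for y using F_cont by (simp add: continuous_on_eq_continuous_at)
    then have "(\<lambda>k. F_conv f g (\<xi> \<bullet> (M k *v \<xi> + v k))) \<longlonglongrightarrow> F_conv f g (\<xi> \<bullet> (M0 *v \<xi> + v0))" for \<xi>
      by (rule isCont_tendsto_compose) (intro tendsto_intros tendsto_matrix_vector_mult M v)
    then show "AE \<xi> in sphere_measure. (\<lambda>k. indicator K \<xi> * F_conv f g (\<xi> \<bullet> (M k *v \<xi> + v k)))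
        \<longlonglongrightarrow> indicator K \<xi> * F_conv f g (\<xi> \<bullet> (M0 *v \<xi> + v0))"
      by (intro AE_I2 tendsto_mult tendsto_const)
    show "AE \<xi> in sphere_measure. norm (indicator K \<xi> * F_conv f g (\<xi> \<bullet> (M k *v \<xi> + v k))) \<le> ?c" for k
      using AE_sphere
    proof eventually_elim
      case (elim \<xi>)
      have "\<xi> \<bullet> (M k *v \<xi> + v k) \<le> 2 * R"
        using quadratic_bound[OF elim R[of k]] by linarith
      then have "F_conv f g (\<xi> \<bullet> (M k *v \<xi> + v k)) \<le> ?c" by (rule monoD[OF F_mono])
      then show ?case by (auto simp: indicator_def F_nonneg)
    qed
  qed auto
qed

lemma scaled_integrand_eq:
  assumes "0 < \<epsilon>" "\<epsilon> < 1"
  shows "scaled_integrand \<epsilon> M v p = (1 + \<epsilon> * snd p) ^ (CARD('n) - 1) *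
     (f (snd p) * g ((gauge_norm K (pullback \<epsilon> M v ((1 + \<epsilon> * snd p) *\<^sub>R fst p)) - 1) / \<epsilon>))"
proof (cases "snd p \<le> -1")
  case False
  then have "\<epsilon> * (-1) < \<epsilon> * snd p" using assms by (intro mult_strict_left_mono) auto
  then have "0 < 1 + \<epsilon> * snd p" using assms by linarith
  then show ?thesis by (simp add: scaled_integrand_def)
qed (simp add: scaled_integrand_def f_zero)

text \<open>
  On the support of the integrand the pullback \<open>y\<close> has gauge, and hence norm, less than \<open>1 + \<epsilon>\<close>. As
  \<open>(1 + \<epsilon> s) \<xi> = y + \<epsilon> M y + \<epsilon> v\<close>, this bounds \<open>s\<close> from above independently of \<open>\<epsilon>\<close>; from below, \<open>f\<close>
  cuts off at \<open>-1\<close>.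
\<close>

lemma scaled_integrand_bound:
  assumes \<xi>: "norm (fst p) = 1" and \<epsilon>: "0 < \<epsilon>" "\<epsilon> < 1" and inv: "invertible (mat 1 + \<epsilon> *\<^sub>R M)"
    and R: "norm M \<le> R" "norm v \<le> R"
  shows "norm (scaled_integrand \<epsilon> M v p)
      \<le> (2 + 3 * R) ^ (CARD('n) - 1) * f (1 + 3 * R) * indicator (UNIV \<times> {-1..1 + 3 * R}) p"
proof (cases "scaled_integrand \<epsilon> M v p = 0")
  case True
  have "0 \<le> R" using R(1) norm_ge_zero order_trans by blast
  then show ?thesis using True by (simp add: f_nonneg)
next
  case False
  define s where "s = snd p"
  define y where "y = pullback \<epsilon> M v ((1 + \<epsilon> * s) *\<^sub>R fst p)"
  have R0: "0 \<le> R" using R(1) norm_ge_zero order_trans by blast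
  have pos: "0 < 1 + \<epsilon> * s" "f s \<noteq> 0" "g ((gauge_norm K y - 1) / \<epsilon>) \<noteq> 0"
    using False by (auto simp: scaled_integrand_def s_def y_def indicator_def split: if_splits)
  have s1: "-1 < s" using pos(2) f_zero[of s] by (cases "s \<le> -1") auto
  have "(gauge_norm K y - 1) / \<epsilon> < 1" using pos(3) g_zero[of "(gauge_norm K y - 1) / \<epsilon>"] by linarith
  then have "gauge_norm K y < 1 + \<epsilon>" using \<epsilon> by (simp add: divide_less_eq)
  then have ny: "norm y \<le> 1 + \<epsilon>" using norm_le_gauge[of y] by linarith
  have "1 + \<epsilon> * s = norm ((1 + \<epsilon> * s) *\<^sub>R fst p)" using \<xi> pos(1) by simp
  also have "\<dots> = norm (y + \<epsilon> *\<^sub>R (M *v y) + \<epsilon> *\<^sub>R v)"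
    using pullback_inverse[OF inv, of "(1 + \<epsilon> * s) *\<^sub>R fst p" v] by (simp add: y_def)
  also have "\<dots> \<le> norm y + norm (\<epsilon> *\<^sub>R (M *v y)) + norm (\<epsilon> *\<^sub>R v)"
    by (intro order_trans[OF norm_triangle_ineq] add_right_mono norm_triangle_ineq)
  also have "\<dots> \<le> (1 + \<epsilon>) + \<epsilon> * (R * 2) + \<epsilon> * R"
  proof (intro add_mono ny)
    have "norm (M *v y) \<le> norm M * norm y" by (rule norm_matrix_vector_mult_le)
    also have "\<dots> \<le> R * 2" using R ny \<epsilon> R0 by (intro mult_mono) auto
    finally show "norm (\<epsilon> *\<^sub>R (M *v y)) \<le> \<epsilon> * (R * 2)" using \<epsilon> by simp
    show "norm (\<epsilon> *\<^sub>R v) \<le> \<epsilon> * R" using \<epsilon> R by simp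
  qed
  finally have "\<epsilon> * s \<le> \<epsilon> * (1 + 3 * R)" by (simp add: algebra_simps)
  then have s2: "s \<le> 1 + 3 * R" using \<epsilon> by simp
  have "\<epsilon> * s \<le> 1 * (1 + 3 * R)"
  proof (rule order_trans[OF \<open>\<epsilon> * s \<le> \<epsilon> * (1 + 3 * R)\<close>])
    show "\<epsilon> * (1 + 3 * R) \<le> 1 * (1 + 3 * R)" using \<epsilon> R0 by (intro mult_right_mono) auto
  qed
  then have base: "1 + \<epsilon> * s \<le> 2 + 3 * R" by simp
  have "norm (scaled_integrand \<epsilon> M v p) = (1 + \<epsilon> * s) ^ (CARD('n) - 1) * (f s * g ((gauge_norm K y - 1) / \<epsilon>))"
    using pos(1) by (simp add: scaled_integrand_def s_def[symmetric] y_def[symmetric] f_nonneg g_nonneg abs_mult)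
  also have "\<dots> \<le> (2 + 3 * R) ^ (CARD('n) - 1) * (f (1 + 3 * R) * 1)"
    using base pos(1) s2 R0
    by (intro mult_mono power_mono f_mono g_le_1 mult_nonneg_nonneg f_nonneg g_nonneg) auto
  finally show ?thesis using s1 s2 by (cases p) (simp add: s_def)
qed

lemma I_fun_dominated_convergence:
  assumes \<epsilon>: "\<And>k. 0 < \<epsilon> k" "\<And>k. \<epsilon> k < 1" and inv: "\<And>k. invertible (mat 1 + \<epsilon> k *\<^sub>R M k)"
    and M: "M \<longlonglongrightarrow> M0" and v: "v \<longlonglongrightarrow> v0"
    and [measurable]: "L \<in> borel_measurable (borel \<Otimes>\<^sub>M borel)"
    and lim: "\<And>p. norm (fst p) = 1 \<Longrightarrow> (\<lambda>k. scaled_integrand (\<epsilon> k) (M k) (v k) p) \<longlonglongrightarrow> L p"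
  shows "(\<lambda>k. I_fun K f g (1 - \<epsilon> k) (M k) (v k)) \<longlonglongrightarrow> (LINT p|(sphere_measure \<Otimes>\<^sub>M lborel). L p)"
proof -
  obtain R where R: "\<And>k. norm (M k) \<le> R" "\<And>k. norm (v k) \<le> R"
    using convergent_common_bound[OF M v] by blast
  show ?thesis
    unfolding I_fun_eq[OF \<epsilon>(1)]
  proof (rule integral_dominated_convergence[OF _ _ integrable_box])
    show "AE p in sphere_measure \<Otimes>\<^sub>M lborel. (\<lambda>k. scaled_integrand (\<epsilon> k) (M k) (v k) p) \<longlonglongrightarrow> L p"
      using AE_sphere_pair by eventually_elim (rule lim)
    show "AE p in sphere_measure \<Otimes>\<^sub>M lborel. norm (scaled_integrand (\<epsilon> k) (M k) (v k) p)
        \<le> (2 + 3 * R) ^ (CARD('n) - 1) * f (1 + 3 * R) * indicator (UNIV \<times> {-1..1 + 3 * R}) p" for k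
      using AE_sphere_pair by eventually_elim (rule scaled_integrand_bound[OF _ \<epsilon> inv R])
  qed measurable
qed

text \<open>
  At a point \<open>\<xi>\<close> of the sphere outside \<open>K\<close> the gauge stays above \<open>1\<close>, so the argument of \<open>g\<close> tends to
  infinity. At a point of \<open>K\<close> it tends to the derivative of the gauge in the limiting direction.
\<close>

lemma I_fun_tendsto_I_one:
  assumes \<epsilon>: "\<And>k. 0 < \<epsilon> k" "\<And>k. \<epsilon> k < 1" "\<epsilon> \<longlonglongrightarrow> 0" and inv: "\<And>k. invertible (mat 1 + \<epsilon> k *\<^sub>R M k)"
    and M: "M \<longlonglongrightarrow> M0" and v: "v \<longlonglongrightarrow> v0"
  shows "(\<lambda>k. I_fun K f g (1 - \<epsilon> k) (M k) (v k)) \<longlonglongrightarrow> I_one K f g M0 v0"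
  unfolding I_one_eq_pair
proof (rule I_fun_dominated_convergence[OF \<epsilon>(1,2) inv M v limit_integrand_borel])
  fix p :: "(real^'n) \<times> real" assume p: "norm (fst p) = 1"
  define \<xi> where "\<xi> = fst p"
  define s where "s = snd p"
  define z where "z k = matrix_inv (mat 1 + \<epsilon> k *\<^sub>R M k) *v (s *\<^sub>R \<xi> - v k - M k *v \<xi>)" for k
  have A: "(\<lambda>k. mat 1 + \<epsilon> k *\<^sub>R M k) \<longlonglongrightarrow> mat 1 + 0 *\<^sub>R M0"
    by (intro tendsto_intros \<epsilon> M)
  have id: "invertible (mat 1 :: real^'n^'n)"
    unfolding invertible_def by (intro exI[of _ "mat 1"]) simp
  have z: "z \<longlonglongrightarrow> s *\<^sub>R \<xi> - v0 - M0 *v \<xi>"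
  proof -
    have "z \<longlonglongrightarrow> matrix_inv (mat 1 + 0 *\<^sub>R M0) *v (s *\<^sub>R \<xi> - v0 - M0 *v \<xi>)"
      unfolding z_def
      by (intro tendsto_matrix_inv_mult A inv tendsto_intros tendsto_matrix_vector_mult M v) (simp add: id)
    then show ?thesis using matrix_inv_mult(2)[OF id, of "s *\<^sub>R \<xi> - v0 - M0 *v \<xi>"] by simp
  qed
  have ray: "pullback (\<epsilon> k) (M k) (v k) ((1 + \<epsilon> k * s) *\<^sub>R \<xi>) = \<xi> + \<epsilon> k *\<^sub>R z k" for k
    unfolding z_def by (rule pullback_ray[OF inv])
  define q where "q k = (gauge_norm K (\<xi> + \<epsilon> k *\<^sub>R z k) - 1) / \<epsilon> k" for k
  have g_lim: "(\<lambda>k. g (q k)) \<longlonglongrightarrow> indicator K \<xi> * g (s - \<xi> \<bullet> (M0 *v \<xi> + v0))"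
  proof (cases "\<xi> \<in> K")
    case True
    have "q \<longlonglongrightarrow> \<xi> \<bullet> (s *\<^sub>R \<xi> - v0 - M0 *v \<xi>)"
      unfolding q_def using p True by (intro gauge_difference_quotient \<epsilon> z) (auto simp: \<xi>_def)
    also have "\<xi> \<bullet> (s *\<^sub>R \<xi> - v0 - M0 *v \<xi>) = s - \<xi> \<bullet> (M0 *v \<xi> + v0)"
    proof -
      have "\<xi> \<bullet> \<xi> = 1" using p by (simp add: \<xi>_def norm_eq_1)
      then show ?thesis by (simp add: inner_diff_right inner_add_right)
    qed
    finally have "q \<longlonglongrightarrow> s - \<xi> \<bullet> (M0 *v \<xi> + v0)" .
    moreover have "isCont g y" for y using g_cont by (simp add: continuous_on_eq_continuous_at)
    ultimately show ?thesis using True by (simp add: isCont_tendsto_compose)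
  next
    case False
    define d where "d = (gauge_norm K \<xi> - 1) / 2"
    have d: "d > 0" using gauge_eq_1_iff(2)[of \<xi>] p False by (simp add: d_def \<xi>_def)
    have "(\<lambda>k. \<xi> + \<epsilon> k *\<^sub>R z k) \<longlonglongrightarrow> \<xi> + 0 *\<^sub>R (s *\<^sub>R \<xi> - v0 - M0 *v \<xi>)"
      by (intro tendsto_intros \<epsilon> z)
    moreover have "isCont (gauge_norm K) \<xi>" using gauge_cont by (simp add: continuous_on_eq_continuous_at)
    ultimately have "(\<lambda>k. gauge_norm K (\<xi> + \<epsilon> k *\<^sub>R z k)) \<longlonglongrightarrow> gauge_norm K \<xi>"
      by (intro isCont_tendsto_compose[of _ "gauge_norm K"]) auto
    then have "\<forall>\<^sub>F k in sequentially. 1 + d < gauge_norm K (\<xi> + \<epsilon> k *\<^sub>R z k)"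
      by (rule order_tendstoD) (use d in \<open>simp add: d_def field_simps\<close>)
    moreover have "\<forall>\<^sub>F k in sequentially. \<epsilon> k < d" by (rule order_tendstoD(2)[OF \<epsilon>(3) d])
    ultimately have "\<forall>\<^sub>F k in sequentially. g (q k) = 0"
    proof eventually_elim
      case (elim k)
      then have "1 \<le> q k" using \<epsilon>(1)[of k] by (simp add: q_def le_divide_eq)
      then show ?case by (rule g_zero)
    qed
    then show ?thesis using False by (simp add: tendsto_eventually)
  qed
  have limit_eq: "limit_integrand M0 v0 p = f s * (indicator K \<xi> * g (s - \<xi> \<bullet> (M0 *v \<xi> + v0)))"
    by (simp add: limit_integrand_def \<xi>_def s_def)
  have "(\<lambda>k. (1 + \<epsilon> k * s) ^ (CARD('n) - 1) * (f s * g (q k)))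
    \<longlonglongrightarrow> (1 + 0 * s) ^ (CARD('n) - 1) * (f s * (indicator K \<xi> * g (s - \<xi> \<bullet> (M0 *v \<xi> + v0))))"
    by (intro tendsto_intros \<epsilon> g_lim)
  then show "(\<lambda>k. scaled_integrand (\<epsilon> k) (M k) (v k) p) \<longlonglongrightarrow> limit_integrand M0 v0 p"
    unfolding scaled_integrand_eq[OF \<epsilon>(1,2)] \<xi>_def[symmetric] s_def[symmetric] ray q_def[symmetric] limit_eq
    by simp
qed

lemma I_fun_tendsto_I_fun:
  assumes \<epsilon>: "\<And>k. 0 < \<epsilon> k" "\<And>k. \<epsilon> k < 1" "\<epsilon> \<longlonglongrightarrow> \<epsilon>0" "0 < \<epsilon>0" "\<epsilon>0 < 1"
    and inv: "\<And>k. invertible (mat 1 + \<epsilon> k *\<^sub>R M k)" "invertible (mat 1 + \<epsilon>0 *\<^sub>R M0)"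
    and M: "M \<longlonglongrightarrow> M0" and v: "v \<longlonglongrightarrow> v0"
  shows "(\<lambda>k. I_fun K f g (1 - \<epsilon> k) (M k) (v k)) \<longlonglongrightarrow> I_fun K f g (1 - \<epsilon>0) M0 v0"
  unfolding I_fun_eq[OF \<epsilon>(4)]
proof (rule I_fun_dominated_convergence[OF \<epsilon>(1,2) inv(1) M v scaled_integrand_borel])
  fix p :: "(real^'n) \<times> real"
  let ?y = "\<lambda>k. pullback (\<epsilon> k) (M k) (v k) ((1 + \<epsilon> k * snd p) *\<^sub>R fst p)"
    and ?l = "pullback \<epsilon>0 M0 v0 ((1 + \<epsilon>0 * snd p) *\<^sub>R fst p)"
  have "(\<lambda>k. ?y k)
      \<longlonglongrightarrow> ?l"
    unfolding pullback_def by (intro tendsto_matrix_inv_mult tendsto_intros inv \<epsilon>(3) M v)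
  moreover have "isCont (gauge_norm K) y" for y using gauge_cont by (simp add: continuous_on_eq_continuous_at)
  ultimately have G: "(\<lambda>k. gauge_norm K (?y k))
      \<longlonglongrightarrow> gauge_norm K (?l)"
    by (rule isCont_tendsto_compose[rotated])
  have "isCont g y" for y using g_cont by (simp add: continuous_on_eq_continuous_at)
  then have "(\<lambda>k. g ((gauge_norm K (?y k) - 1) / \<epsilon> k))
      \<longlonglongrightarrow> g ((gauge_norm K (?l) - 1) / \<epsilon>0)"
    by (rule isCont_tendsto_compose) (use \<epsilon>(4) in \<open>intro tendsto_intros G \<epsilon>(3), simp\<close>)
  then show "(\<lambda>k. scaled_integrand (\<epsilon> k) (M k) (v k) p) \<longlonglongrightarrow> scaled_integrand \<epsilon>0 M0 v0 p"
    unfolding scaled_integrand_eq[OF \<epsilon>(1,2)] scaled_integrand_eq[OF \<epsilon>(4,5)]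
    by (intro tendsto_intros \<epsilon>(3))
qed

text \<open>
  The domain splits into the parts \<open>r < 1\<close> and \<open>r = 1\<close>. It suffices to approach a point within one
  of them at a time.
\<close>

lemma I_ext_continuous: "continuous_on I_ext_dom (\<lambda>(r, M, v). I_ext K f g r M v)"
proof -
  define D1 :: "(real \<times> (real^'n^'n) \<times> (real^'n)) set"
    where "D1 = {(r, M, v). 1/2 < r \<and> r < 1 \<and> M \<in> B_dom r}"
  define D2 :: "(real \<times> (real^'n^'n) \<times> (real^'n)) set" where "D2 = {(r, M, v). r = 1 \<and> M \<in> Sym}"
  let ?I = "\<lambda>x. I_ext K f g (fst x) (fst (snd x)) (snd (snd x))"
  have D1: "1/2 < fst x" "fst x < 1" "invertible (mat 1 + (1 - fst x) *\<^sub>R fst (snd x))"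
      "?I x = I_fun K f g (1 - (1 - fst x)) (fst (snd x)) (snd (snd x))" if "x \<in> D1" for x
    using that by (auto simp: D1_def B_dom_def I_ext_def)
  have D2: "fst x = 1" "?I x = I_one K f g (fst (snd x)) (snd (snd x))" if "x \<in> D2" for x
    using that by (auto simp: D2_def I_ext_def)
  have comp: "(\<lambda>k. 1 - fst (X k)) \<longlonglongrightarrow> 1 - fst a" "(\<lambda>k. fst (snd (X k))) \<longlonglongrightarrow> fst (snd a)"
      "(\<lambda>k. snd (snd (X k))) \<longlonglongrightarrow> snd (snd a)"
    if "X \<longlonglongrightarrow> a" for X and a :: "real \<times> (real^'n^'n) \<times> (real^'n)"
    by (intro tendsto_intros that)+
  have lim1: "(?I \<longlongrightarrow> ?I a) (at a within D1)" if a: "a \<in> D1 \<union> D2" for a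
  proof (rule tendsto_at_withinI_sequentially)
    fix X :: "nat \<Rightarrow> real \<times> (real^'n^'n) \<times> (real^'n)"
    assume X: "\<And>k. X k \<in> D1" "X \<longlonglongrightarrow> a"
    have \<epsilon>: "0 < 1 - fst (X k)" "1 - fst (X k) < 1" for k using D1(1,2)[OF X(1), of k] by auto
    show "(\<lambda>k. ?I (X k)) \<longlonglongrightarrow> ?I a"
    proof (cases "a \<in> D1")
      case True
      show ?thesis
        unfolding D1(4)[OF X(1)] D1(4)[OF True]
        using D1(1,2)[OF True]
        by (intro I_fun_tendsto_I_fun \<epsilon> comp[OF X(2)] D1(3)[OF X(1)] D1(3)[OF True]) auto
    next
      case False
      then have "a \<in> D2" using a by blast
      then show ?thesis
        unfolding D1(4)[OF X(1)] D2(2)[OF \<open>a \<in> D2\<close>]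
        using comp(1)[OF X(2)] D2(1)[OF \<open>a \<in> D2\<close>]
        by (intro I_fun_tendsto_I_one \<epsilon> comp(2,3)[OF X(2)] D1(3)[OF X(1)]) simp
    qed
  qed
  have lim2: "(?I \<longlongrightarrow> ?I a) (at a within D2)" if a: "a \<in> D1 \<union> D2" for a
  proof (rule tendsto_at_withinI_sequentially)
    fix X :: "nat \<Rightarrow> real \<times> (real^'n^'n) \<times> (real^'n)"
    assume X: "\<And>k. X k \<in> D2" "X \<longlonglongrightarrow> a"
    have "(\<lambda>k. 1 - fst (X k)) \<longlonglongrightarrow> 0" by (simp add: D2(1)[OF X(1)])
    then have "1 - fst a = 0" by (rule LIMSEQ_unique[OF comp(1)[OF X(2)]])
    then have "fst a = 1" by simp
    then have "a \<in> D2" using a D1(2)[of a] by auto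
    show "(\<lambda>k. ?I (X k)) \<longlonglongrightarrow> ?I a"
      unfolding D2(2)[OF X(1)] D2(2)[OF \<open>a \<in> D2\<close>] by (intro I_one_tendsto comp[OF X(2)])
  qed
  have "continuous_on (D1 \<union> D2) ?I"
    unfolding continuous_on_def using Lim_Un[OF lim1 lim2] by blast
  then show ?thesis
    by (simp add: I_ext_dom_def D1_def D2_def case_prod_unfold)
qed

text \<open>
  For \<open>r\<close> close to \<open>1\<close> the set \<open>[r, 1] \<times> C\<close> is a compact subset of the domain, on which the extended
  functional is uniformly continuous.
\<close>

lemma I_fun_uniform_limit:
  fixes C :: "((real^'n^'n) \<times> (real^'n)) set"
  assumes C: "compact C" "C \<subseteq> Sym \<times> UNIV"
  shows "uniform_limit C (\<lambda>r (M, v). I_fun K f g r M v) (\<lambda>(M, v). I_one K f g M v) (at_left 1)"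
proof (rule uniform_limitI)
  fix e :: real assume e: "0 < e"
  obtain R where R: "R > 0" "\<And>M v. (M, v) \<in> C \<Longrightarrow> norm M \<le> R"
  proof -
    obtain B where B: "B > 0" "\<And>x. x \<in> C \<Longrightarrow> norm x \<le> B"
      using compact_imp_bounded[OF C(1)] by (auto simp: bounded_pos)
    show thesis
      using B norm_fst_le order_trans by (intro that[of B]) (fastforce, blast)
  qed
  define r0 where "r0 = max (3/4) (1 - 1 / (2 * R))"
  have r0: "1/2 < r0" "r0 < 1" using R(1) by (auto simp: r0_def less_max_iff_disj)
  have dom: "{r0..1} \<times> C \<subseteq> I_ext_dom"
  proof clarify
    fix r M v assume r: "r \<in> {r0..1}" and MC: "(M, v) \<in> C"
    have Sym: "M \<in> Sym" using MC C(2) by auto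
    have "(1 - r) * norm M \<le> (1 / (2 * R)) * R"
      using r R(1) R(2)[OF MC] by (intro mult_mono) (auto simp: r0_def)
    also have "\<dots> < 1" using R(1) by simp
    finally have "invertible (mat 1 + (1 - r) *\<^sub>R M)"
      using r by (intro invertible_near_identity) auto
    then show "(r, M, v) \<in> I_ext_dom"
      using r r0 Sym by (auto simp: I_ext_dom_def B_dom_def)
  qed
  let ?J = "\<lambda>(r, M, v). I_ext K f g r M v"
  have "uniformly_continuous_on ({r0..1} \<times> C) ?J"
    by (intro compact_uniformly_continuous continuous_on_subset[OF I_ext_continuous dom] compact_Times C) simp
  then obtain d where d: "d > 0"
    "\<And>x y. x \<in> {r0..1} \<times> C \<Longrightarrow> y \<in> {r0..1} \<times> C \<Longrightarrow> dist y x < d \<Longrightarrow> dist (?J y) (?J x) < e"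
    using e unfolding uniformly_continuous_on_def by metis
  show "\<forall>\<^sub>F r in at_left 1. \<forall>x\<in>C. dist (case x of (M, v) \<Rightarrow> I_fun K f g r M v) (case x of (M, v) \<Rightarrow> I_one K f g M v) < e"
    unfolding eventually_at_left_field
  proof (intro exI[of _ "max r0 (1 - d)"] conjI allI impI ballI)
    show "max r0 (1 - d) < 1" using r0 d by simp
    fix r x assume r: "max r0 (1 - d) < r" "r < 1" and x: "x \<in> C"
    have "dist (r, x) (1, x) < d" using r by (simp add: dist_Pair_Pair dist_real_def)
    then have "dist (?J (r, x)) (?J (1, x)) < e" using r x r0 by (intro d(2)) auto
    then show "dist (case x of (M, v) \<Rightarrow> I_fun K f g r M v) (case x of (M, v) \<Rightarrow> I_one K f g M v) < e"
      using r by (simp add: case_prod_unfold I_ext_def)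
  qed
qed

end

text \<open>
  The remaining work is to read off from the hypotheses that the body lies in the unit ball and has
  \<open>0\<close> in its interior; both come from the minimality of the ball.
\<close>

theorem theorem8:
  fixes K :: "(real^'n) set" and f g :: "real \<Rightarrow> real"
  assumes "convex_body K"
    and "loewner_position K"
    and "C1_smooth_boundary K"
    and "locally_Lipschitz f"
    and "convex_on UNIV f"
    and "\<forall>x\<le>-1. f x = 0"
    and "strict_mono_on {-1..} f"
    and "locally_Lipschitz g"
    and "antimono g"
    and "\<forall>x\<le>-1. g x = 1"
    and "\<forall>x\<in>{-1<..<1}. g x > 0"
    and "\<forall>x\<ge>1. g x = 0"
  shows "continuous_on (I_ext_dom :: (real \<times> (real^'n^'n) \<times> (real^'n)) set)
           (\<lambda>(r, M, v). I_ext K f g r M v)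
       \<and> F_conv f g C1_differentiable_on UNIV
       \<and> (\<forall>x. F_conv f g x \<ge> 0)
       \<and> mono (F_conv f g)
       \<and> convex_on UNIV (F_conv f g)
       \<and> strictly_convex_on {0..} (F_conv f g)
       \<and> deriv (F_conv f g) 0 > 0
       \<and> (\<forall>C. compact C \<longrightarrow> C \<subseteq> Sym \<times> UNIV \<longrightarrow>
            uniform_limit C (\<lambda>r (M, v). I_fun K f g r M v) (\<lambda>(M, v). I_one K f g M v) (at_left 1))"
proof -
  interpret functional K f g
  proof unfold_locales
    show "compact K" "convex K" using assms(1) by (auto simp: convex_body_def)
    show "0 \<in> interior K" by (rule loewner_position_zero_interior[OF assms(1,2)])
    show "K \<subseteq> cball 0 1" by (rule loewner_position_subset[OF assms(2)])
  qed (use assms in auto)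
  show ?thesis
    using I_ext_continuous F_C1 F_nonneg F_mono F_convex F_strictly_convex F_deriv_pos I_fun_uniform_limit
    by blast
qed

end
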